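(* Let $p\ge 1$ and $N$ be integers with $N>p+2$. Then there exists a complete maximal map of genus $p$ which has $2N$ complete ends and at least $2N$ singular components. That is, there exist a compact connected Riemann surface $\overline{M}$ of genus $p$, a set $E\subset\overline{M}$ of $2N$ distinct points, and Weierstrass data $(M,G,\Omega)$ for a maximal map on $M=\overline{M}\setminus E$ such that the resulting maximal map $X:M\to\mathbb{E}^3_1$ is complete, every point of $E$ is a complete end of $X$, and the set $\{q\in M : |G(q)|=1\}$ has at least $2N$ connected components.
   Context: $\mathbb{E}^3_1$ is $\mathbb{R}^3$ with the Lorentzian metric $dx^2+dy^2-dz^2$. Weierstrass data for a maximal map: a triple $(M,g,\omega)$ where $M$ is a connected Riemann surface, $g$ is a meromorphic function on $M$, and $\omega$ is a holomorphic $1$-form on $M$ such that $g\omega$ and $g^{-1}\omega$ are also holomorphic $1$-forms on $M$, satisfying: (1) $|g|\not\equiv 1$ on $M$; (2) (period conditions) for every closed loop $\gamma$ in $M$, $\int_\gamma g\omega+\overline{\int_\gamma g^{-1}\omega}=0$ and $\operatorname{Re}\int_\gamma\omega=0$. The associated maximal map is $X:M\to\mathbb{E}^3_1$, $X(z)=\operatorname{Re}\int_{z_0}^z\big(\tfrac12(g^{-1}+g),\tfrac{i}{2}(g^{-1}-g),1\big)\omega$ for a base point $z_0\in M$. Branch singularities (zeros of $\omega$) are allowed. The function $g$ is called the Gauss map of $X$. The induced (possibly degenerate) metric is $ds^2=\frac14(|g|^{-1}-|g|)^2|\omega|^2$. The maximal map $X$ is complete if there exist a compact subset $C\subset M$ and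 a symmetric $2$-tensor $T$ on $M$ such that $T\equiv0$ on $M\setminus C$ and $ds^2+T$ is a complete Riemannian metric on $M$. If $M=\overline{M}\setminus\{p_1,\dots,p_k\}$ with $\overline{M}$ a compact Riemann surface and the $p_i$ distinct, the genus of $X$ is the genus of $\overline{M}$, and the punctures $p_i$ are the ends of $X$. An end $p_i$ is a complete end if the induced metric $ds^2$ is complete at $p_i$ (paths in $M$ diverging to $p_i$ have infinite $ds^2$-length). The singular components of $X$ are the connected components of the set $\{q\in M:|g(q)|=1\}$. *)

theory Defs
  imports "HOL-Complex_Analysis.Complex_Analysis"
begin

section \<open>Riemann surfaces\<close>

type_synonym 'a chart = "'a set \<times> ('a \<Rightarrow> complex)"

record 'a surface =
  stop :: "'a topology"
  atlas :: "'a chart set"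

abbreviation points :: "'a surface \<Rightarrow> 'a set" where
  "points M \<equiv> topspace (stop M)"

abbreviation param :: "'a chart \<Rightarrow> complex \<Rightarrow> 'a" where
  "param c \<equiv> inv_into (fst c) (snd c)"

abbreviation chart_image :: "'a chart \<Rightarrow> complex set" where
  "chart_image c \<equiv> snd c ` fst c"

definition is_chart :: "'a topology \<Rightarrow> 'a chart \<Rightarrow> bool" where
  "is_chart X c \<longleftrightarrow> openin X (fst c) \<and> open (chart_image c) \<and>
     homeomorphic_map (subtopology X (fst c)) (top_of_set (chart_image c)) (snd c)"

definition transition :: "'a chart \<Rightarrow> 'a chart \<Rightarrow> complex \<Rightarrow> complex" where
  "transition c d = snd d \<circ> param c"

definition connected_riemann_surface :: "'a surface \<Rightarrow> bool" where
  "connected_riemann_surface M \<longleftrightarrow>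
     points M \<noteq> {} \<and> connected_space (stop M) \<and> Hausdorff_space (stop M) \<and>
     (\<forall>c\<in>atlas M. is_chart (stop M) c) \<and> \<Union> (fst ` atlas M) = points M \<and>
     (\<forall>c\<in>atlas M. \<forall>d\<in>atlas M. transition c d holomorphic_on snd c ` (fst c \<inter> fst d))"

definition puncture :: "'a surface \<Rightarrow> 'a set \<Rightarrow> 'a surface" where
  "puncture M E = \<lparr> stop = subtopology (stop M) (points M - E),
                    atlas = (\<lambda>c. (fst c - E, snd c)) ` atlas M \<rparr>"


section \<open>Meromorphic functions and holomorphic 1-forms\<close>

text \<open>A meromorphic function is encoded as a complex-valued function that takes the dummy value
  0 at its poles (this is what \<^const>\<open>nicely_meromorphic_on\<close> says) and is continuous
  elsewhere. In particular \<open>|g| = 1\<close> never holds at a pole of \<open>g\<close>.\<close>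

definition meromorphic_function :: "'a surface \<Rightarrow> ('a \<Rightarrow> complex) \<Rightarrow> bool" where
  "meromorphic_function M g \<longleftrightarrow>
     (\<forall>c\<in>atlas M. (g \<circ> param c) nicely_meromorphic_on chart_image c)"

text \<open>A 1-form of type (1,0) is given by its coefficients: in the chart \<open>c = (U, \<phi>)\<close> the form
  \<open>\<omega>\<close> equals \<open>\<omega> c q d\<phi>\<close> at \<open>q \<in> U\<close>.\<close>

type_synonym 'a form = "'a chart \<Rightarrow> 'a \<Rightarrow> complex"

definition holomorphic_form :: "'a surface \<Rightarrow> 'a form \<Rightarrow> bool" where
  "holomorphic_form M \<omega> \<longleftrightarrow>
     (\<forall>c\<in>atlas M. (\<omega> c \<circ> param c) holomorphic_on chart_image c) \<and>
     (\<forall>c\<in>atlas M. \<forall>d\<in>atlas M. \<forall>q \<in> fst c \<inter> fst d.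
        \<omega> c q = \<omega> d q * deriv (transition c d) (snd c q))"

text \<open>The product of a meromorphic function and a holomorphic form, with removable singularities
  removed. At a genuine pole of the product the coefficient is set to 0, so the result is then
  discontinuous there: it is a holomorphic form iff the meromorphic form \<open>f\<omega>\<close> is holomorphic.\<close>

definition form_mult :: "('a \<Rightarrow> complex) \<Rightarrow> 'a form \<Rightarrow> 'a form" where
  "form_mult f \<omega> c q = remove_sings (\<lambda>z. f (param c z) * \<omega> c (param c z)) (snd c q)"


section \<open>Genus\<close>

text \<open>The genus of a compact Riemann surface (geometric genus, equal to the number of handles) is
  the dimension of its complex vector space of holomorphic 1-forms: there are \<open>p\<close> holomorphic forms such that every holomorphic form is, in
  exactly one way, a linear combination of them.\<close>

definition has_genus :: "'a surface \<Rightarrow> nat \<Rightarrow> bool" where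
  "has_genus M p \<longleftrightarrow> (\<exists>\<eta> :: nat \<Rightarrow> 'a form.
     (\<forall>i<p. holomorphic_form M (\<eta> i)) \<and>
     (\<forall>\<omega>. holomorphic_form M \<omega> \<longrightarrow>
        (\<exists>!a. a \<in> extensional {..<p} \<and>
           (\<forall>c\<in>atlas M. \<forall>q\<in>fst c. \<omega> c q = (\<Sum>i<p. a i * \<eta> i c q)))))"


section \<open>Paths and integrals of 1-forms\<close>

text \<open>Piecewise continuously differentiable paths defined on a real interval \<open>I\<close>.\<close>

definition surface_path :: "'a surface \<Rightarrow> real set \<Rightarrow> (real \<Rightarrow> 'a) \<Rightarrow> bool" where
  "surface_path M I \<gamma> \<longleftrightarrow> continuous_map (top_of_set I) (stop M) \<gamma> \<and>
     (\<forall>c\<in>atlas M. \<forall>a b. a \<le> b \<and> {a..b} \<subseteq> I \<and> \<gamma> ` {a..b} \<subseteq> fst c \<longrightarrow>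
        (snd c \<circ> \<gamma>) piecewise_C1_differentiable_on {a..b})"

definition some_chart :: "'a surface \<Rightarrow> 'a \<Rightarrow> 'a chart" where
  "some_chart M q = (SOME c. c \<in> atlas M \<and> q \<in> fst c)"

definition velocity :: "'a chart \<Rightarrow> (real \<Rightarrow> 'a) \<Rightarrow> real \<Rightarrow> complex" where
  "velocity c \<gamma> t = vector_derivative (snd c \<circ> \<gamma>) (at t)"

text \<open>Both here and for lengths below, the chart in which the integrand is computed at time \<open>t\<close>
  is irrelevant by the transformation law of forms and tensors.\<close>

definition form_integral :: "'a surface \<Rightarrow> 'a form \<Rightarrow> (real \<Rightarrow> 'a) \<Rightarrow> complex" where
  "form_integral M \<omega> \<gamma> =
     integral {0..1} (\<lambda>t. let c = some_chart M (\<gamma> t) in \<omega> c (\<gamma> t) * velocity c \<gamma> t)"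

definition closed_loop :: "'a surface \<Rightarrow> (real \<Rightarrow> 'a) \<Rightarrow> bool" where
  "closed_loop M \<gamma> \<longleftrightarrow> surface_path M {0..1} \<gamma> \<and> \<gamma> 0 = \<gamma> 1"


section \<open>Weierstrass data and maximal maps\<close>

abbreviation g_form :: "('a \<Rightarrow> complex) \<Rightarrow> 'a form \<Rightarrow> 'a form" where
  "g_form g \<omega> \<equiv> form_mult g \<omega>"

abbreviation ginv_form :: "('a \<Rightarrow> complex) \<Rightarrow> 'a form \<Rightarrow> 'a form" where
  "ginv_form g \<omega> \<equiv> form_mult (\<lambda>q. inverse (g q)) \<omega>"

text \<open>The condition that \<open>g\<close> does not vanish identically is implicit in the use of the
  meromorphic function \<open>1/g\<close>.\<close>

definition weierstrass_data :: "'a surface \<Rightarrow> ('a \<Rightarrow> complex) \<Rightarrow> 'a form \<Rightarrow> bool" where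
  "weierstrass_data M g \<omega> \<longleftrightarrow>
     connected_riemann_surface M \<and>
     meromorphic_function M g \<and> (\<exists>q\<in>points M. g q \<noteq> 0) \<and>
     holomorphic_form M \<omega> \<and>
     holomorphic_form M (g_form g \<omega>) \<and> holomorphic_form M (ginv_form g \<omega>) \<and>
     (\<exists>q\<in>points M. norm (g q) \<noteq> 1) \<and>
     (\<forall>\<gamma>. closed_loop M \<gamma> \<longrightarrow>
        form_integral M (g_form g \<omega>) \<gamma> + cnj (form_integral M (ginv_form g \<omega>) \<gamma>) = 0 \<and>
        Re (form_integral M \<omega> \<gamma>) = 0)"

text \<open>The coordinates \<open>(x, y, z)\<close> of the Lorentz space with metric \<open>dx\<^sup>2 + dy\<^sup>2 - dz\<^sup>2\<close> are
  the components of \<^typ>\<open>real^3\<close>. By the period conditions the integral from the base point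
  does not depend on the path.\<close>

definition is_maximal_map ::
    "'a surface \<Rightarrow> ('a \<Rightarrow> complex) \<Rightarrow> 'a form \<Rightarrow> ('a \<Rightarrow> real^3) \<Rightarrow> bool" where
  "is_maximal_map M g \<omega> X \<longleftrightarrow> weierstrass_data M g \<omega> \<and>
     (\<exists>z0\<in>points M. \<forall>\<gamma>. surface_path M {0..1} \<gamma> \<and> \<gamma> 0 = z0 \<longrightarrow>
        X (\<gamma> 1) = vector
          [Re (form_integral M (\<lambda>c q. 1/2 * (ginv_form g \<omega> c q + g_form g \<omega> c q)) \<gamma>),
           Re (form_integral M (\<lambda>c q. \<i>/2 * (ginv_form g \<omega> c q - g_form g \<omega> c q)) \<gamma>),
           Re (form_integral M \<omega> \<gamma>)])"

definition singular_set :: "'a surface \<Rightarrow> ('a \<Rightarrow> complex) \<Rightarrow> 'a set" where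
  "singular_set M g = {q \<in> points M. norm (g q) = 1}"

definition singular_components :: "'a surface \<Rightarrow> ('a \<Rightarrow> complex) \<Rightarrow> 'a set set" where
  "singular_components M g = connected_components_of (subtopology (stop M) (singular_set M g))"


section \<open>Metrics and completeness\<close>

primrec Ck_on :: "nat \<Rightarrow> (complex \<Rightarrow> real) \<Rightarrow> complex set \<Rightarrow> bool" where
  "Ck_on 0 f S \<longleftrightarrow> continuous_on S f"
| "Ck_on (Suc k) f S \<longleftrightarrow> (\<forall>z\<in>S. f differentiable (at z)) \<and>
     (\<forall>v. Ck_on k (\<lambda>z. frechet_derivative f (at z) v) S)"

definition smooth_on :: "(complex \<Rightarrow> real) \<Rightarrow> complex set \<Rightarrow> bool" where
  "smooth_on f S \<longleftrightarrow> (\<forall>k. Ck_on k f S)"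

text \<open>A covariant 2-tensor is given by its expressions in charts: \<open>h c q u v\<close> is its value at
  \<open>q\<close> on the tangent vectors with coordinates \<open>u, v \<in> \<complex> = \<real>\<^sup>2\<close> in the chart \<open>c\<close>.\<close>

type_synonym 'a tensor2 = "'a chart \<Rightarrow> 'a \<Rightarrow> complex \<Rightarrow> complex \<Rightarrow> real"

definition symmetric_2_tensor :: "'a surface \<Rightarrow> 'a tensor2 \<Rightarrow> bool" where
  "symmetric_2_tensor M h \<longleftrightarrow>
     (\<forall>c\<in>atlas M. \<forall>q\<in>fst c. bilinear (h c q) \<and> (\<forall>u v. h c q u v = h c q v u)) \<and>
     (\<forall>c\<in>atlas M. \<forall>u v. smooth_on (\<lambda>z. h c (param c z) u v) (chart_image c)) \<and>
     (\<forall>c\<in>atlas M. \<forall>d\<in>atlas M. \<forall>q \<in> fst c \<inter> fst d. \<forall>u v.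
        h c q u v = h d q (deriv (transition c d) (snd c q) * u) (deriv (transition c d) (snd c q) * v))"

definition riemannian_metric :: "'a surface \<Rightarrow> 'a tensor2 \<Rightarrow> bool" where
  "riemannian_metric M h \<longleftrightarrow> symmetric_2_tensor M h \<and>
     (\<forall>c\<in>atlas M. \<forall>q\<in>fst c. \<forall>u. u \<noteq> 0 \<longrightarrow> h c q u u > 0)"

definition path_length :: "'a surface \<Rightarrow> 'a tensor2 \<Rightarrow> real set \<Rightarrow> (real \<Rightarrow> 'a) \<Rightarrow> ennreal" where
  "path_length M h I \<gamma> =
     (\<integral>\<^sup>+t\<in>I. (let c = some_chart M (\<gamma> t); v = velocity c \<gamma> t
              in ennreal (sqrt (h c (\<gamma> t) v v))) \<partial>lborel)"

definition riemannian_distance :: "'a surface \<Rightarrow> 'a tensor2 \<Rightarrow> 'a \<Rightarrow> 'a \<Rightarrow> real" where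
  "riemannian_distance M h x y = enn2real
     (INF \<gamma>\<in>{\<gamma>. surface_path M {0..1} \<gamma> \<and> \<gamma> 0 = x \<and> \<gamma> 1 = y}. path_length M h {0..1} \<gamma>)"

definition complete_riemannian_metric :: "'a surface \<Rightarrow> 'a tensor2 \<Rightarrow> bool" where
  "complete_riemannian_metric M h \<longleftrightarrow> riemannian_metric M h \<and>
     Metric_space.mcomplete (points M) (riemannian_distance M h)"

text \<open>The metric \<open>ds\<^sup>2 = (1/4) (|g|\<^sup>-\<^sup>1 - |g|)\<^sup>2 |\<omega>|\<^sup>2\<close>, written as \<open>(1/4) (|g\<^sup>-\<^sup>1\<omega>| - |g\<omega>|)\<^sup>2\<close>
  so that it also makes sense at the zeros and poles of \<open>g\<close>.\<close>

definition induced_metric :: "('a \<Rightarrow> complex) \<Rightarrow> 'a form \<Rightarrow> 'a tensor2" where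
  "induced_metric g \<omega> c q u v =
     1/4 * (norm (ginv_form g \<omega> c q) - norm (g_form g \<omega> c q))\<^sup>2 * (u \<bullet> v)"

definition complete_maximal_map ::
    "'a surface \<Rightarrow> ('a \<Rightarrow> complex) \<Rightarrow> 'a form \<Rightarrow> ('a \<Rightarrow> real^3) \<Rightarrow> bool" where
  "complete_maximal_map M g \<omega> X \<longleftrightarrow> is_maximal_map M g \<omega> X \<and>
     (\<exists>C T. compactin (stop M) C \<and> symmetric_2_tensor M T \<and>
        (\<forall>c\<in>atlas M. \<forall>q \<in> fst c - C. \<forall>u v. T c q u v = 0) \<and>
        complete_riemannian_metric M (\<lambda>c q u v. induced_metric g \<omega> c q u v + T c q u v))"

text \<open>For data on \<open>puncture Mbar E\<close>: every path in the punctured surface diverging to \<open>e \<in> E\<close>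
  has infinite length.\<close>

definition complete_end ::
    "'a surface \<Rightarrow> 'a set \<Rightarrow> ('a \<Rightarrow> complex) \<Rightarrow> 'a form \<Rightarrow> 'a \<Rightarrow> bool" where
  "complete_end Mbar E g \<omega> e \<longleftrightarrow> e \<in> E \<and>
     (\<forall>\<gamma>. surface_path (puncture Mbar E) {0..<1} \<gamma> \<and> limitin (stop Mbar) \<gamma> e (at_left 1) \<longrightarrow>
        path_length (puncture Mbar E) (induced_metric g \<omega>) {0..<1} \<gamma> = \<infinity>)"

text \<open>The underlying set of a connected Riemann surface has the cardinality of the continuum (and
  its topology is not tied to that of the ambient type), so quantifying over surfaces whose points
  are taken from the following type is quantifying over all of them up to isomorphism.\<close>

type_synonym surface_point = "complex \<times> complex"

end

theory Submission
  imports Defs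
begin

text \<open>
  The maximal map is Enneper's surface along a meromorphic function. If \<open>G\<close> is holomorphic on a Riemann
  surface \<open>M\<close>, then for the data \<open>(G, G dG)\<close> the three forms \<open>G \<cdot> G dG = d(G\<^sup>3/3)\<close>, \<open>G dG = d(G\<^sup>2/2)\<close> and
  \<open>G\<^sup>-\<^sup>1 \<cdot> G dG = dG\<close> are holomorphic and exact. So all period conditions hold, and the map is \<open>enneper (G q)\<close>
  up to a translation. Its metric is \<open>1/4 (1 - |G|\<^sup>2)\<^sup>2 |dG|\<^sup>2\<close>. If \<open>M\<close> is a compact surface minus the poles of
  \<open>G\<close>, then this metric is larger than a multiple of \<open>|dG|\<^sup>2\<close> near the punctures, where \<open>|G|\<close> tends to infinity,
  so every puncture is a complete end. The points with \<open>|G| = 1\<close> and the critical points of \<open>G\<close> stay away from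
  the poles. On a compact set around them the metric is corrected by a smooth cutoff of \<open>|G|\<^sup>2\<close> times a
  positive metric. The corrected metric makes \<open>G\<close> a proper Lipschitz function, which forces completeness
  (\<open>complete_if_proper_lipschitz_function\<close>).

  What is left is a compact surface of genus \<open>p\<close> with a function that has \<open>2N\<close> poles, each encircled by its own
  component of \<open>|G| = 1\<close>. The surface is the hyperelliptic curve \<open>w\<^sup>2 = 1 + z\<^sup>2\<^sup>m\<close> with \<open>m = p + 1\<close>, and
  \<open>G = 1 / (4 z\<^sup>N - 2)\<close>. Its poles are the \<open>2N\<close> points over the solutions of \<open>z\<^sup>N = 1/2\<close>. The equation \<open>|G| = 1\<close>
  says \<open>|z\<^sup>N - 1/2| = 1/4\<close>, so \<open>z\<close> lies in one of \<open>N\<close> disjoint sectors and inside the unit disc, over which the two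
  sheets of the curve are separated by the sign of \<open>Re w\<close>. These invariants distinguish \<open>2N\<close> components
  (\<open>singular_components_curve\<close>).

  The genus (\<open>has_genus_curve\<close>) is computed by writing a holomorphic form as \<open>F dz/w\<close>. The sums of \<open>F\<close> and of
  \<open>w F\<close> over the two sheets are entire functions of \<open>z\<close> whose growth is controlled at infinity, hence polynomials.
  The second one has too many zeros, at the branch points, and vanishes. Thus \<open>F\<close> is a polynomial in \<open>z\<close> of degree
  less than \<open>p\<close>.
\<close>

section \<open>Lower integrals\<close>

text \<open>The speed of a path is a function with no evident measurability. The next inequalities hold for arbitrary
  integrands, because it is enough to prove them for the measurable functions below.\<close>

lemma nn_integral_eq_SUP_measurable:
  "(\<integral>\<^sup>+x. f x \<partial>M) = (SUP g\<in>{g \<in> borel_measurable M. g \<le> f}. \<integral>\<^sup>+x. g x \<partial>M)"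
proof (rule antisym)
  show "(\<integral>\<^sup>+x. f x \<partial>M) \<le> (SUP g\<in>{g \<in> borel_measurable M. g \<le> f}. \<integral>\<^sup>+x. g x \<partial>M)"
    unfolding nn_integral_def[of M f]
  proof (rule SUP_least)
    fix g assume g: "g \<in> {g. simple_function M g \<and> g \<le> f}"
    then have "integral\<^sup>S M g = (\<integral>\<^sup>+x. g x \<partial>M)"
      by (simp add: nn_integral_eq_simple_integral)
    also have "\<dots> \<le> (SUP g\<in>{g \<in> borel_measurable M. g \<le> f}. \<integral>\<^sup>+x. g x \<partial>M)"
      by (rule SUP_upper) (use g in \<open>auto intro: borel_measurable_simple_function\<close>)
    finally show "integral\<^sup>S M g \<le> (SUP g\<in>{g \<in> borel_measurable M. g \<le> f}. \<integral>\<^sup>+x. g x \<partial>M)" .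
  qed
  show "(SUP g\<in>{g \<in> borel_measurable M. g \<le> f}. \<integral>\<^sup>+x. g x \<partial>M) \<le> (\<integral>\<^sup>+x. f x \<partial>M)"
    by (rule SUP_least) (auto intro!: nn_integral_mono simp: le_fun_def)
qed

lemma nn_integral_affine_le:
  fixes f :: "real \<Rightarrow> ennreal"
  assumes "a \<noteq> 0"
  shows "(\<integral>\<^sup>+t. ennreal \<bar>a\<bar> * f (b + a * t) \<partial>lborel) \<le> (\<integral>\<^sup>+t. f t \<partial>lborel)"
  unfolding nn_integral_eq_SUP_measurable[of lborel "\<lambda>t. ennreal \<bar>a\<bar> * f (b + a * t)"]
proof (rule SUP_least)
  fix g :: "real \<Rightarrow> ennreal"
  assume g: "g \<in> {g \<in> borel_measurable lborel. g \<le> (\<lambda>t. ennreal \<bar>a\<bar> * f (b + a * t))}"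
  then have [measurable]: "g \<in> borel_measurable borel" by simp
  have a: "ennreal \<bar>a\<bar> * ennreal (1 / \<bar>a\<bar>) = 1"
    using assms by (simp flip: ennreal_mult)
  define k where "k = (\<lambda>s. ennreal (1 / \<bar>a\<bar>) * g ((s - b) / a))"
  have [measurable]: "k \<in> borel_measurable borel" unfolding k_def by measurable
  have "(\<integral>\<^sup>+t. g t \<partial>lborel) = (\<integral>\<^sup>+t. ennreal \<bar>a\<bar> * k (b + a * t) \<partial>lborel)"
    unfolding k_def mult.assoc[symmetric] a using assms by simp
  also have "\<dots> = (\<integral>\<^sup>+t. k t \<partial>lborel)"
    by (subst nn_integral_real_affine[of k a b]) (use assms in \<open>auto intro!: nn_integral_cmult\<close>)
  also have "\<dots> \<le> (\<integral>\<^sup>+t. f t \<partial>lborel)"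
  proof (rule nn_integral_mono)
    fix t
    have "g ((t - b) / a) \<le> ennreal \<bar>a\<bar> * f (b + a * ((t - b) / a))"
      using g unfolding le_fun_def by blast
    moreover have "b + a * ((t - b) / a) = t" using assms by simp
    ultimately have "k t \<le> ennreal (1 / \<bar>a\<bar>) * (ennreal \<bar>a\<bar> * f t)"
      unfolding k_def by (metis mult_left_mono zero_le)
    also have "\<dots> = (ennreal \<bar>a\<bar> * ennreal (1 / \<bar>a\<bar>)) * f t" by (simp only: mult.assoc mult.left_commute)
    also have "\<dots> = f t" by (simp only: a mult_1)
    finally show "k t \<le> f t" .
  qed
  finally show "(\<integral>\<^sup>+t. g t \<partial>lborel) \<le> (\<integral>\<^sup>+t. f t \<partial>lborel)" .
qed

lemma nn_integral_set_Un_le: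
  assumes [measurable]: "A \<in> sets M" "B \<in> sets M"
  shows "(\<integral>\<^sup>+x\<in>A \<union> B. f x \<partial>M) \<le> (\<integral>\<^sup>+x\<in>A. f x \<partial>M) + (\<integral>\<^sup>+x\<in>B. f x \<partial>M)"
  unfolding nn_integral_eq_SUP_measurable[of M "\<lambda>x. f x * indicator (A \<union> B) x"]
proof (rule SUP_least)
  fix g assume "g \<in> {g \<in> borel_measurable M. g \<le> (\<lambda>x. f x * indicator (A \<union> B) x)}"
  then have [measurable]: "g \<in> borel_measurable M" and le: "\<And>x. g x \<le> f x * indicator (A \<union> B) x"
    by (auto simp: le_fun_def)
  have "(\<integral>\<^sup>+x. g x \<partial>M) \<le> (\<integral>\<^sup>+x. g x * indicator A x + g x * indicator B x \<partial>M)"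
  proof (rule nn_integral_mono)
    fix x show "g x \<le> g x * indicator A x + g x * indicator B x"
      using le[of x] by (auto simp: indicator_def split: if_splits)
  qed
  also have "\<dots> = (\<integral>\<^sup>+x. g x * indicator A x \<partial>M) + (\<integral>\<^sup>+x. g x * indicator B x \<partial>M)"
    by (rule nn_integral_add) auto
  also have "\<dots> \<le> (\<integral>\<^sup>+x\<in>A. f x \<partial>M) + (\<integral>\<^sup>+x\<in>B. f x \<partial>M)"
  proof (intro add_mono nn_integral_mono)
    fix x show "g x * indicator A x \<le> f x * indicator A x"
      using le[of x] by (auto simp: indicator_def split: if_splits)
    show "g x * indicator B x \<le> f x * indicator B x"
      using le[of x] by (auto simp: indicator_def split: if_splits)
  qed
  finally show "(\<integral>\<^sup>+x. g x \<partial>M) \<le> (\<integral>\<^sup>+x\<in>A. f x \<partial>M) + (\<integral>\<^sup>+x\<in>B. f x \<partial>M)" .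
qed

lemma AE_lborel_not_in_finite: "finite S \<Longrightarrow> AE t in lborel. (t::real) \<notin> S"
  by (metis AE_not_in finite_imp_null_set_lborel)

text \<open>The derivative may be unbounded near the exceptional times. If the integral of its norm is infinite, there is
  nothing to show. Otherwise it is Lebesgue integrable, its integral is the increment by the fundamental theorem for
  the gauge integral, and the usual norm bound applies.\<close>

lemma norm_increment_le_nn_integral:
  fixes f :: "real \<Rightarrow> complex"
  assumes "finite S" "a \<le> b" "continuous_on {a..b} f"
    and der: "\<And>t. t \<in> {a<..<b} - S \<Longrightarrow> (f has_vector_derivative f' t) (at t)"
    and le: "\<And>t. t \<in> {a<..<b} - S \<Longrightarrow> ennreal (norm (f' t)) \<le> s t"
  shows "ennreal (norm (f b - f a)) \<le> (\<integral>\<^sup>+t\<in>{a..b}. s t \<partial>lborel)"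
proof -
  have int: "(f' has_integral (f b - f a)) {a..b}"
    by (rule fundamental_theorem_of_calculus_interior_strong[OF assms(1,2) der assms(3)])
  have meas: "f' \<in> borel_measurable (lebesgue_on {a..b})"
    using int by (intro integrable_imp_measurable) (auto simp: integrable_on_def)
  have mono: "(\<integral>\<^sup>+t\<in>{a..b}. ennreal (norm (f' t)) \<partial>lborel) \<le> (\<integral>\<^sup>+t\<in>{a..b}. s t \<partial>lborel)"
  proof (rule nn_integral_mono_AE)
    have "AE t in lborel. t \<notin> S \<union> {a,b}"
      by (rule AE_lborel_not_in_finite) (use assms(1) in auto)
    then show "AE t in lborel. ennreal (norm (f' t)) * indicator {a..b} t \<le> s t * indicator {a..b} t"
      by eventually_elim (use le in \<open>auto simp: indicator_def\<close>)
  qed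
  show ?thesis
  proof (cases "(\<integral>\<^sup>+t\<in>{a..b}. ennreal (norm (f' t)) \<partial>lborel) = \<infinity>")
    case True
    then show ?thesis using mono by (simp add: top_unique)
  next
    case False
    have eq: "(\<integral>\<^sup>+t. ennreal (norm (f' t)) \<partial>lebesgue_on {a..b}) =
        (\<integral>\<^sup>+t\<in>{a..b}. ennreal (norm (f' t)) \<partial>lborel)"
      by (subst nn_integral_restrict_space) (auto simp: nn_integral_completion)
    have "integrable (lebesgue_on {a..b}) f'"
      using meas False eq by (auto simp: integrable_iff_bounded less_top)
    then have abs: "f' absolutely_integrable_on {a..b}"
      by (simp add: integrable_restrict_space set_integrable_def)
    then have L: "(LINT t:{a..b}|lebesgue. f' t) = f b - f a"
      using int set_lebesgue_integral_eq_integral(2) by (metis integral_unique)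
    have "ennreal (norm (f b - f a)) = ennreal (norm (LINT t|lebesgue. indicator {a..b} t *\<^sub>R f' t))"
      using L by (simp add: set_lebesgue_integral_def)
    also have "\<dots> \<le> (\<integral>\<^sup>+t. ennreal (norm (indicator {a..b} t *\<^sub>R f' t)) \<partial>lebesgue)"
      by (rule integral_norm_bound_ennreal) (use abs in \<open>simp add: set_integrable_def\<close>)
    also have "\<dots> = (\<integral>\<^sup>+t\<in>{a..b}. ennreal (norm (f' t)) \<partial>lborel)"
      by (auto simp: nn_integral_completion indicator_def intro!: nn_integral_cong)
    finally show ?thesis using mono by simp
  qed
qed

section \<open>Holomorphic functions and their differentials\<close>

locale riemann_surface =
  fixes M :: "'a surface"
  assumes connected_riemann_surface: "connected_riemann_surface M"
begin

lemma
  assumes "c \<in> atlas M"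
  shows openin_chart: "openin (stop M) (fst c)"
    and open_chart_image: "open (chart_image c)"
    and homeomorphic_map_chart:
      "homeomorphic_map (subtopology (stop M) (fst c)) (top_of_set (chart_image c)) (snd c)"
  using assms connected_riemann_surface
  by (auto simp: connected_riemann_surface_def is_chart_def)

lemma transition_holomorphic:
  "c \<in> atlas M \<Longrightarrow> d \<in> atlas M \<Longrightarrow> transition c d holomorphic_on snd c ` (fst c \<inter> fst d)"
  using connected_riemann_surface by (auto simp: connected_riemann_surface_def)

lemma chart_subset: "c \<in> atlas M \<Longrightarrow> fst c \<subseteq> points M"
  using openin_chart openin_subset by blast

lemma chart_inj: "c \<in> atlas M \<Longrightarrow> inj_on (snd c) (fst c)"
  using homeomorphic_imp_injective_map[OF homeomorphic_map_chart[of c]] chart_subset[of c]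
  by (simp add: Int_absorb1)

lemma param_chart [simp]: "c \<in> atlas M \<Longrightarrow> q \<in> fst c \<Longrightarrow> param c (snd c q) = q"
  by (simp add: chart_inj)

lemma chart_param [simp]: "z \<in> chart_image c \<Longrightarrow> snd c (param c z) = z"
  by (rule f_inv_into_f)

lemma param_in_chart: "z \<in> chart_image c \<Longrightarrow> param c z \<in> fst c"
  by (rule inv_into_into)

lemma continuous_map_chart:
  "c \<in> atlas M \<Longrightarrow> continuous_map (subtopology (stop M) (fst c)) euclidean (snd c)"
  using homeomorphic_imp_continuous_map[OF homeomorphic_map_chart[of c]]
  by (simp add: continuous_map_in_subtopology)

lemma continuous_map_param:
  assumes "c \<in> atlas M"
  shows "continuous_map (top_of_set (chart_image c)) (stop M) (param c)"
proof -
  obtain g where g: "homeomorphic_maps (subtopology (stop M) (fst c)) (top_of_set (chart_image c)) (snd c) g"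
    using homeomorphic_map_chart[OF assms] homeomorphic_map_maps by blast
  then have "continuous_map (top_of_set (chart_image c)) (subtopology (stop M) (fst c)) g"
    by (auto simp: homeomorphic_maps_def)
  moreover have "g z = param c z" if "z \<in> chart_image c" for z
  proof -
    have "g z \<in> fst c" "snd c (g z) = z"
      using g that assms chart_subset[OF assms]
      by (auto simp: homeomorphic_maps_def continuous_map_def)
    then show ?thesis using assms by (metis param_chart)
  qed
  ultimately have "continuous_map (top_of_set (chart_image c)) (subtopology (stop M) (fst c)) (param c)"
    by (rule continuous_map_eq) simp
  then show ?thesis by (simp add: continuous_map_in_subtopology)
qed

lemma openin_param_image:
  assumes "c \<in> atlas M" "open V" "V \<subseteq> chart_image c"
  shows "openin (stop M) (param c ` V)"
proof -
  have "param c ` V = {q \<in> topspace (subtopology (stop M) (fst c)). snd c q \<in> V}"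
  proof (intro equalityI subsetI)
    fix q assume "q \<in> param c ` V"
    then obtain z where z: "z \<in> V" "q = param c z" by blast
    then have "z \<in> chart_image c" using assms(3) by blast
    then have "q \<in> fst c" "snd c q = z" using z(2) by (simp_all add: param_in_chart)
    then show "q \<in> {q \<in> topspace (subtopology (stop M) (fst c)). snd c q \<in> V}"
      using z(1) chart_subset[OF assms(1)] by auto
  next
    fix q assume q: "q \<in> {q \<in> topspace (subtopology (stop M) (fst c)). snd c q \<in> V}"
    then have "q = param c (snd c q)" using assms(1) by simp
    then show "q \<in> param c ` V" using q by blast
  qed
  moreover have "openin (subtopology (stop M) (fst c)) {q \<in> topspace (subtopology (stop M) (fst c)). snd c q \<in> V}"
    using openin_continuous_map_preimage[OF continuous_map_chart[OF assms(1)], of V] assms(2) by simp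
  ultimately show ?thesis
    using openin_chart[OF assms(1)] by (simp add: openin_open_subtopology)
qed

lemma open_chart_overlap:
  assumes "c \<in> atlas M" "openin (stop M) W"
  shows "open (snd c ` (fst c \<inter> W))"
proof -
  have "snd c ` (fst c \<inter> W) = {z \<in> chart_image c. param c z \<in> W}"
    using assms(1) by auto
  moreover have "openin (top_of_set (chart_image c)) {z \<in> topspace (top_of_set (chart_image c)). param c z \<in> W}"
    using continuous_map_param[OF assms(1)] assms(2) by (rule openin_continuous_map_preimage)
  ultimately show ?thesis
    using open_chart_image[OF assms(1)] by (simp add: openin_open_eq)
qed

lemma has_field_derivative_transition:
  assumes "c \<in> atlas M" "d \<in> atlas M" "q \<in> fst c \<inter> fst d"
  shows "(transition c d has_field_derivative deriv (transition c d) (snd c q)) (at (snd c q))"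
  using transition_holomorphic[OF assms(1,2)] open_chart_overlap[OF assms(1) openin_chart[OF assms(2)]] assms(3)
  by (intro holomorphic_derivI) auto

lemma some_chart:
  assumes "q \<in> points M" shows "some_chart M q \<in> atlas M" "q \<in> fst (some_chart M q)"
proof -
  have "\<exists>c. c \<in> atlas M \<and> q \<in> fst c"
    using assms connected_riemann_surface unfolding connected_riemann_surface_def by (metis UN_E)
  then have "some_chart M q \<in> atlas M \<and> q \<in> fst (some_chart M q)"
    unfolding some_chart_def by (rule someI_ex)
  then show "some_chart M q \<in> atlas M" "q \<in> fst (some_chart M q)" by auto
qed

end

definition holomorphic_function :: "'a surface \<Rightarrow> ('a \<Rightarrow> complex) \<Rightarrow> bool" where
  "holomorphic_function M F \<longleftrightarrow> (\<forall>c\<in>atlas M. (F \<circ> param c) holomorphic_on chart_image c)"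

text \<open>The coefficient depends only on the germ of the coordinate, so it does not change when the chart domain
  shrinks. \<open>F\<close> may be any function that is holomorphic near the point.\<close>

definition differential :: "('a \<Rightarrow> complex) \<Rightarrow> 'a form" where
  "differential F c q = deriv (F \<circ> param c) (snd c q)"

context riemann_surface
begin

lemma has_field_derivative_differential:
  assumes "holomorphic_function M F" "c \<in> atlas M" "q \<in> fst c"
  shows "(F \<circ> param c has_field_derivative differential F c q) (at (snd c q))"
  unfolding differential_def using assms open_chart_image[of c]
  by (intro holomorphic_derivI) (auto simp: holomorphic_function_def)

text \<open>Only the chain rule near the point is used, so this covers functions that are holomorphic
  just on part of the surface, such as the coordinates of a curve away from their poles.\<close>

lemma differential_transition:
  assumes "c \<in> atlas M" "d \<in> atlas M" "q \<in> fst c \<inter> fst d"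
    and F: "F \<circ> param d field_differentiable at (snd d q)"
  shows "differential F c q = differential F d q * deriv (transition c d) (snd c q)"
proof -
  let ?S = "snd c ` (fst c \<inter> fst d)"
  have o: "open ?S" by (rule open_chart_overlap[OF assms(1) openin_chart[OF assms(2)]])
  have t: "transition c d (snd c q) = snd d q" using assms by (simp add: transition_def)
  have "((F \<circ> param d) \<circ> transition c d has_field_derivative
      differential F d q * deriv (transition c d) (snd c q)) (at (snd c q))"
    using F unfolding differential_def
    by (intro DERIV_chain has_field_derivative_transition assms)
       (simp add: t DERIV_deriv_iff_field_differentiable)
  then have "(F \<circ> param c has_field_derivative
      differential F d q * deriv (transition c d) (snd c q)) (at (snd c q))"
    by (rule has_field_derivative_transform_within_open[OF _ o])
       (use assms in \<open>auto simp: transition_def\<close>)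
  then show ?thesis unfolding differential_def by (rule DERIV_imp_deriv)
qed

lemma holomorphic_on_differential:
  assumes "c \<in> atlas M" "open S" "S \<subseteq> chart_image c" "(F \<circ> param c) holomorphic_on S"
  shows "(differential F c \<circ> param c) holomorphic_on S"
proof -
  have "deriv (F \<circ> param c) holomorphic_on S" using assms by (intro holomorphic_deriv) auto
  then show ?thesis
    by (rule holomorphic_transform) (use assms in \<open>auto simp: differential_def subset_iff\<close>)
qed

lemma holomorphic_form_differential:
  assumes F: "holomorphic_function M F"
  shows "holomorphic_form M (differential F)"
  unfolding holomorphic_form_def
proof (intro conjI ballI)
  fix c assume "c \<in> atlas M"
  then show "(differential F c \<circ> param c) holomorphic_on chart_image c"
    using F by (intro holomorphic_on_differential open_chart_image) (auto simp: holomorphic_function_def)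
next
  fix c d q assume "c \<in> atlas M" "d \<in> atlas M" "q \<in> fst c \<inter> fst d"
  then show "differential F c q = differential F d q * deriv (transition c d) (snd c q)"
    using has_field_derivative_differential[OF F, of d q]
    by (intro differential_transition) (auto simp: field_differentiable_def)
qed

subsection \<open>Paths\<close>

lemma path_stays_in_open:
  fixes t :: real
  assumes "continuous_map (top_of_set I) (stop M) \<gamma>" "openin (stop M) W" "t \<in> I" "\<gamma> t \<in> W"
  shows "\<exists>e>0. \<forall>s\<in>I. \<bar>s - t\<bar> < e \<longrightarrow> \<gamma> s \<in> W"
proof -
  have "openin (top_of_set I) {s \<in> topspace (top_of_set I). \<gamma> s \<in> W}"
    using assms(1,2) by (rule openin_continuous_map_preimage)
  then have "openin (top_of_set I) {s \<in> I. \<gamma> s \<in> W}" by simp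
  then obtain e where "e > 0" "\<And>s. s \<in> I \<Longrightarrow> dist s t < e \<Longrightarrow> s \<in> {s \<in> I. \<gamma> s \<in> W}"
    using assms(3,4) unfolding openin_euclidean_subtopology_iff by blast
  then show ?thesis by (auto simp: dist_real_def)
qed

lemma surface_path_in:
  "surface_path M I \<gamma> \<Longrightarrow> t \<in> I \<Longrightarrow> \<gamma> t \<in> points M"
  by (auto simp: surface_path_def continuous_map_def)

lemma surface_path_subset:
  "surface_path M I \<gamma> \<Longrightarrow> J \<subseteq> I \<Longrightarrow> surface_path M J \<gamma>"
  unfolding surface_path_def by (meson continuous_map_from_subtopology_mono dual_order.trans)

lemma has_vector_derivative_change_chart:
  assumes "c \<in> atlas M" "d \<in> atlas M" "\<gamma> t \<in> fst c \<inter> fst d"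
    and ev: "\<forall>\<^sub>F s in nhds t. \<gamma> s \<in> fst c"
    and D: "(snd c \<circ> \<gamma> has_vector_derivative v) (at t)"
  shows "(snd d \<circ> \<gamma> has_vector_derivative deriv (transition c d) (snd c (\<gamma> t)) * v) (at t)"
proof -
  have *: "((transition c d \<circ> (snd c \<circ> \<gamma>)) has_vector_derivative
      (v * deriv (transition c d) (snd c (\<gamma> t)))) (at t)"
    using has_field_derivative_transition[OF assms(1,2,3)] by (intro field_vector_diff_chain_at D) auto
  obtain S where S: "open S" "t \<in> S" "\<And>s. s \<in> S \<Longrightarrow> \<gamma> s \<in> fst c"
    using ev by (auto simp: eventually_nhds)
  have "(snd d \<circ> \<gamma> has_vector_derivative (v * deriv (transition c d) (snd c (\<gamma> t)))) (at t)"
    by (rule has_vector_derivative_transform_within_open[OF * S(1,2)])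
       (use assms(1) S(3) in \<open>auto simp: transition_def\<close>)
  then show ?thesis by (simp only: mult.commute)
qed

lemma path_eventually_in_open:
  fixes t :: real
  assumes "continuous_map (top_of_set {a..b}) (stop M) \<gamma>" "openin (stop M) W" "t \<in> {a<..<b}" "\<gamma> t \<in> W"
  shows "\<forall>\<^sub>F s in nhds t. \<gamma> s \<in> W"
proof -
  obtain e where e: "e > 0" "\<forall>s\<in>{a..b}. \<bar>s - t\<bar> < e \<longrightarrow> \<gamma> s \<in> W"
    using path_stays_in_open[OF assms(1,2) _ assms(4)] assms(3) by auto
  show ?thesis
    unfolding eventually_nhds_metric
  proof (intro exI[of _ "min e (min (t - a) (b - t))"] conjI allI impI)
    fix s assume "dist s t < min e (min (t - a) (b - t))"
    then have "s \<in> {a..b}" "\<bar>s - t\<bar> < e" by (auto simp: dist_real_def)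
    then show "\<gamma> s \<in> W" using e(2) by blast
  qed (use e(1) assms(3) in auto)
qed

text \<open>A surface path is differentiable in every chart at all but finitely many times: a bisection
  argument patches the finite exceptional sets of the pieces that lie in one chart.\<close>

lemma path_differentiable:
  assumes \<gamma>: "surface_path M {a..b} \<gamma>" and "a \<le> b"
  obtains S where "finite S"
    "\<And>c t. c \<in> atlas M \<Longrightarrow> t \<in> {a<..<b} - S \<Longrightarrow> \<gamma> t \<in> fst c \<Longrightarrow>
       (snd c \<circ> \<gamma> has_vector_derivative velocity c \<gamma> t) (at t)"
proof -
  have cont: "continuous_map (top_of_set {a..b}) (stop M) \<gamma>" using \<gamma> by (simp add: surface_path_def)
  define P where "P x y \<longleftrightarrow> (\<exists>S. finite S \<and> (\<forall>c\<in>atlas M. \<forall>t \<in> {x<..<y} \<inter> {a<..<b} - S. \<gamma> t \<in> fst c \<longrightarrow>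
       (snd c \<circ> \<gamma> has_vector_derivative velocity c \<gamma> t) (at t)))" for x y
  have "P a b" using \<open>a \<le> b\<close>
  proof (induction rule: Bolzano)
    case (trans x y z)
    then obtain S1 S2 where "finite S1" "finite S2"
      "\<forall>c\<in>atlas M. \<forall>t \<in> {x<..<y} \<inter> {a<..<b} - S1. \<gamma> t \<in> fst c \<longrightarrow>
       (snd c \<circ> \<gamma> has_vector_derivative velocity c \<gamma> t) (at t)"
      "\<forall>c\<in>atlas M. \<forall>t \<in> {y<..<z} \<inter> {a<..<b} - S2. \<gamma> t \<in> fst c \<longrightarrow>
       (snd c \<circ> \<gamma> has_vector_derivative velocity c \<gamma> t) (at t)"
      unfolding P_def by blast
    then show ?case unfolding P_def by (intro exI[of _ "{y} \<union> S1 \<union> S2"]) force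
  next
    case (local t)
    then have t: "t \<in> {a..b}" by simp
    define c where "c = some_chart M (\<gamma> t)"
    have c: "c \<in> atlas M" "\<gamma> t \<in> fst c"
      using some_chart[OF surface_path_in[OF \<gamma> t]] by (auto simp: c_def)
    obtain e where e: "e > 0" "\<forall>s\<in>{a..b}. \<bar>s - t\<bar> < e \<longrightarrow> \<gamma> s \<in> fst c"
      using path_stays_in_open[OF cont openin_chart[OF c(1)] t c(2)] by auto
    show ?case
    proof (intro exI[of _ e] conjI allI impI e(1))
      fix x y assume xy: "x \<le> t \<and> t \<le> y \<and> y - x < e"
      define x' where "x' = max x a"
      define y' where "y' = min y b"
      have sub: "{x'..y'} \<subseteq> {a..b}" "x' \<le> y'" using xy t by (auto simp: x'_def y'_def)
      have "\<gamma> ` {x'..y'} \<subseteq> fst c" using e(2) xy by (auto simp: x'_def y'_def)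
      then have "(snd c \<circ> \<gamma>) piecewise_C1_differentiable_on {x'..y'}"
        using \<gamma> c(1) sub unfolding surface_path_def by blast
      then obtain S where S: "finite S" "(snd c \<circ> \<gamma>) C1_differentiable_on ({x'..y'} - S)"
        unfolding piecewise_C1_differentiable_on_def by blast
      have "(snd d \<circ> \<gamma> has_vector_derivative velocity d \<gamma> s) (at s)"
        if d: "d \<in> atlas M" and s: "s \<in> {x<..<y} \<inter> {a<..<b} - S" and sd: "\<gamma> s \<in> fst d" for d s
      proof -
        have s': "s \<in> {x'..y'} - S" using s by (auto simp: x'_def y'_def)
        then obtain v where v: "(snd c \<circ> \<gamma> has_vector_derivative v) (at s)"
          using S(2) unfolding C1_differentiable_on_def by blast
        have sc: "\<gamma> s \<in> fst c" using s' \<open>\<gamma> ` {x'..y'} \<subseteq> fst c\<close> by auto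
        have "\<forall>\<^sub>F s in nhds s. \<gamma> s \<in> fst c"
          by (rule path_eventually_in_open[OF cont openin_chart[OF c(1)] _ sc]) (use s in auto)
        from has_vector_derivative_change_chart[OF c(1) d _ this v] sc sd
        show ?thesis by (auto simp: velocity_def vector_derivative_at)
      qed
      then show "P x y" unfolding P_def using S(1) by blast
    qed
  qed
  then obtain S where "finite S" "\<forall>c\<in>atlas M. \<forall>t \<in> {a<..<b} \<inter> {a<..<b} - S. \<gamma> t \<in> fst c \<longrightarrow>
       (snd c \<circ> \<gamma> has_vector_derivative velocity c \<gamma> t) (at t)"
    unfolding P_def by blast
  then show ?thesis by (intro that) auto
qed

lemma velocity_transition:
  assumes "continuous_map (top_of_set {a..b}) (stop M) \<gamma>"
    "c \<in> atlas M" "d \<in> atlas M" "\<gamma> t \<in> fst c \<inter> fst d" "t \<in> {a<..<b}"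
    and D: "(snd c \<circ> \<gamma> has_vector_derivative velocity c \<gamma> t) (at t)"
  shows "velocity d \<gamma> t = deriv (transition c d) (snd c (\<gamma> t)) * velocity c \<gamma> t"
  using has_vector_derivative_change_chart[OF assms(2,3,4) _ D]
    path_eventually_in_open[OF assms(1) openin_chart[OF assms(2)] assms(5)] assms(4)
  by (auto simp: velocity_def vector_derivative_at)

lemma continuous_map_holomorphic_function:
  assumes F: "holomorphic_function M F"
  shows "continuous_map (stop M) euclidean F"
proof -
  have local: "continuous_map (subtopology (stop M) (fst c)) euclidean F" if c: "c \<in> atlas M" for c
  proof -
    have "continuous_map (subtopology (stop M) (fst c)) (top_of_set (chart_image c)) (snd c)"
      using homeomorphic_map_chart[OF c] homeomorphic_imp_continuous_map by blast
    moreover have "continuous_map (top_of_set (chart_image c)) euclidean (F \<circ> param c)"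
      using F c holomorphic_on_imp_continuous_on by (auto simp: holomorphic_function_def o_def)
    ultimately have "continuous_map (subtopology (stop M) (fst c)) euclidean ((F \<circ> param c) \<circ> snd c)"
      by (rule continuous_map_compose)
    then show ?thesis
      by (rule continuous_map_eq) (use c in auto)
  qed
  show ?thesis
  proof (rule pasting_lemma[where I="atlas M" and T=fst and f="\<lambda>_. F"])
    fix q assume "q \<in> points M"
    then show "\<exists>c. c \<in> atlas M \<and> q \<in> fst c \<and> F q = F q" using some_chart by blast
  next
    fix c assume "c \<in> atlas M" then show "openin (stop M) (fst c)" by (rule openin_chart)
  next
    fix c assume "c \<in> atlas M" then show "continuous_map (subtopology (stop M) (fst c)) euclidean F" by (rule local)
  qed (rule refl)
qed

lemma path_chain_rule:
  assumes F: "holomorphic_function M F" and "surface_path M {a..b} \<gamma>" "c \<in> atlas M"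
    "t \<in> {a<..<b}" "\<gamma> t \<in> fst c"
    and D: "(snd c \<circ> \<gamma> has_vector_derivative velocity c \<gamma> t) (at t)"
  shows "(F \<circ> \<gamma> has_vector_derivative differential F c (\<gamma> t) * velocity c \<gamma> t) (at t)"
proof -
  have cont: "continuous_map (top_of_set {a..b}) (stop M) \<gamma>"
    using assms(2) by (simp add: surface_path_def)
  obtain S where S: "open S" "t \<in> S" "\<And>s. s \<in> S \<Longrightarrow> \<gamma> s \<in> fst c"
    using path_eventually_in_open[OF cont openin_chart[OF assms(3)] assms(4,5)]
    by (auto simp: eventually_nhds)
  have "((F \<circ> param c) \<circ> (snd c \<circ> \<gamma>) has_vector_derivative
      velocity c \<gamma> t * differential F c (\<gamma> t)) (at t)"
    using has_field_derivative_differential[OF F assms(3,5)]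
    by (intro field_vector_diff_chain_at D) auto
  then have "(F \<circ> \<gamma> has_vector_derivative velocity c \<gamma> t * differential F c (\<gamma> t)) (at t)"
    by (rule has_vector_derivative_transform_within_open[OF _ S(1,2)])
       (use assms(3) S(3) in auto)
  then show ?thesis by (simp only: mult.commute)
qed

lemma continuous_on_along_path:
  assumes "holomorphic_function M F" "surface_path M I \<gamma>"
  shows "continuous_on I (F \<circ> \<gamma>)"
proof -
  have "continuous_map (top_of_set I) euclidean (F \<circ> \<gamma>)"
    using assms(2) unfolding surface_path_def
    by (intro continuous_map_compose[OF _ continuous_map_holomorphic_function[OF assms(1)]]) blast
  then show ?thesis by simp
qed

lemma form_integral_cong:
  assumes "surface_path M {0..1} \<gamma>" "\<And>c q. c \<in> atlas M \<Longrightarrow> q \<in> fst c \<Longrightarrow> \<omega> c q = \<omega>' c q"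
  shows "form_integral M \<omega> \<gamma> = form_integral M \<omega>' \<gamma>"
  unfolding form_integral_def
proof (rule integral_cong)
  fix t :: real assume "t \<in> {0..1}"
  then have "\<gamma> t \<in> points M" by (rule surface_path_in[OF assms(1)])
  then show "(let c = some_chart M (\<gamma> t) in \<omega> c (\<gamma> t) * velocity c \<gamma> t) =
      (let c = some_chart M (\<gamma> t) in \<omega>' c (\<gamma> t) * velocity c \<gamma> t)"
    using some_chart assms(2) by (simp add: Let_def)
qed

text \<open>The fundamental theorem of calculus tolerates the finitely many times at which a piecewise
  smooth path has no velocity, even if the velocity is unbounded near them.\<close>

lemma form_integral_differential:
  assumes F: "holomorphic_function M F" and \<gamma>: "surface_path M {0..1} \<gamma>"
  shows "form_integral M (differential F) \<gamma> = F (\<gamma> 1) - F (\<gamma> 0)"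
proof -
  obtain S where S: "finite S" "\<And>c t. c \<in> atlas M \<Longrightarrow> t \<in> {0<..<1} - S \<Longrightarrow> \<gamma> t \<in> fst c \<Longrightarrow>
       (snd c \<circ> \<gamma> has_vector_derivative velocity c \<gamma> t) (at t)"
    using path_differentiable[OF \<gamma>] by auto
  have "((\<lambda>t. let c = some_chart M (\<gamma> t) in differential F c (\<gamma> t) * velocity c \<gamma> t)
      has_integral ((F \<circ> \<gamma>) 1 - (F \<circ> \<gamma>) 0)) {0..1}"
  proof (rule fundamental_theorem_of_calculus_interior_strong[OF S(1)])
    fix t :: real assume t: "t \<in> {0<..<1} - S"
    then have "\<gamma> t \<in> points M" using surface_path_in[OF \<gamma>, of t] by auto
    from some_chart[OF this] t
    show "(F \<circ> \<gamma> has_vector_derivative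
        (let c = some_chart M (\<gamma> t) in differential F c (\<gamma> t) * velocity c \<gamma> t)) (at t)"
      unfolding Let_def by (intro path_chain_rule[OF F \<gamma>] S(2)) auto
  qed (use continuous_on_along_path[OF F \<gamma>] in auto)
  then show ?thesis unfolding form_integral_def by (simp add: integral_unique)
qed

end

section \<open>Lengths of paths\<close>

definition speed :: "'a surface \<Rightarrow> 'a tensor2 \<Rightarrow> (real \<Rightarrow> 'a) \<Rightarrow> real \<Rightarrow> real" where
  "speed M h \<gamma> t = sqrt (h (some_chart M (\<gamma> t)) (\<gamma> t)
     (velocity (some_chart M (\<gamma> t)) \<gamma> t) (velocity (some_chart M (\<gamma> t)) \<gamma> t))"

lemma path_length_speed: "path_length M h I \<gamma> = (\<integral>\<^sup>+t\<in>I. ennreal (speed M h \<gamma> t) \<partial>lborel)"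
  by (simp add: path_length_def speed_def Let_def)

lemma path_length_mono: "I \<subseteq> J \<Longrightarrow> path_length M h I \<gamma> \<le> path_length M h J \<gamma>"
  unfolding path_length_speed by (intro nn_integral_mono) (auto simp: indicator_def)

lemma velocity_cong:
  assumes "\<forall>\<^sub>F s in nhds t. \<gamma> s = \<gamma>' s"
  shows "velocity c \<gamma> t = velocity c \<gamma>' t"
proof -
  have "(snd c \<circ> \<gamma> has_vector_derivative v) (at t) \<longleftrightarrow> (snd c \<circ> \<gamma>' has_vector_derivative v) (at t)" for v
    by (rule has_vector_derivative_cong_ev)
       (use assms eventually_nhds_x_imp_x[OF assms] in \<open>auto elim: eventually_mono\<close>)
  then show ?thesis by (simp add: velocity_def vector_derivative_def)
qed

context riemann_surface
begin

text \<open>Away from the finitely many times without a velocity, the transformation law of the tensor matches the chain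
  rule, so the speed can be computed in any chart.\<close>

lemma speed_in_chart:
  assumes h: "symmetric_2_tensor M h" and \<gamma>: "surface_path M {a..b} \<gamma>" and "c \<in> atlas M"
    "t \<in> {a<..<b}" "\<gamma> t \<in> fst c"
    and D: "\<And>c. c \<in> atlas M \<Longrightarrow> \<gamma> t \<in> fst c \<Longrightarrow> (snd c \<circ> \<gamma> has_vector_derivative velocity c \<gamma> t) (at t)"
  shows "speed M h \<gamma> t = sqrt (h c (\<gamma> t) (velocity c \<gamma> t) (velocity c \<gamma> t))"
proof -
  define d where "d = some_chart M (\<gamma> t)"
  have "\<gamma> t \<in> points M" using surface_path_in[OF \<gamma>, of t] assms(4) by auto
  then have d: "d \<in> atlas M" "\<gamma> t \<in> fst d" by (auto simp: d_def some_chart)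
  have "velocity c \<gamma> t = deriv (transition d c) (snd d (\<gamma> t)) * velocity d \<gamma> t"
    using \<gamma> assms d by (intro velocity_transition D) (auto simp: surface_path_def)
  moreover have "h d (\<gamma> t) v v = h c (\<gamma> t) (deriv (transition d c) (snd d (\<gamma> t)) * v)
      (deriv (transition d c) (snd d (\<gamma> t)) * v)" for v
    using h assms(3,5) d unfolding symmetric_2_tensor_def by blast
  ultimately show ?thesis by (simp add: speed_def d_def)
qed

text \<open>Lengths are bounded below by the increments of functions that the metric makes Lipschitz. The same bound holds for a
  coordinate as long as the path stays in its chart.\<close>

lemma increment_le_path_length:
  assumes h: "symmetric_2_tensor M h" and \<gamma>: "surface_path M {a..b} \<gamma>" "a \<le> b" and "m \<ge> 0"
    and F: "holomorphic_function M F"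
    and le: "\<And>c t v. c \<in> atlas M \<Longrightarrow> t \<in> {a..b} \<Longrightarrow> \<gamma> t \<in> fst c \<Longrightarrow>
      m * (norm (differential F c (\<gamma> t)) * norm v) \<le> sqrt (h c (\<gamma> t) v v)"
  shows "ennreal (m * norm (F (\<gamma> b) - F (\<gamma> a))) \<le> path_length M h {a..b} \<gamma>"
proof -
  obtain S where S: "finite S" "\<And>c t. c \<in> atlas M \<Longrightarrow> t \<in> {a<..<b} - S \<Longrightarrow> \<gamma> t \<in> fst c \<Longrightarrow>
       (snd c \<circ> \<gamma> has_vector_derivative velocity c \<gamma> t) (at t)"
    using path_differentiable[OF \<gamma>] by auto
  let ?d = "\<lambda>t. differential F (some_chart M (\<gamma> t)) (\<gamma> t) * velocity (some_chart M (\<gamma> t)) \<gamma> t"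
  have "ennreal (norm (m *\<^sub>R F (\<gamma> b) - m *\<^sub>R F (\<gamma> a))) \<le> path_length M h {a..b} \<gamma>"
    unfolding path_length_speed
  proof (rule norm_increment_le_nn_integral[OF S(1) \<gamma>(2)])
    show "continuous_on {a..b} (\<lambda>t. m *\<^sub>R F (\<gamma> t))"
      using continuous_on_along_path[OF F \<gamma>(1)] by (auto simp: o_def intro!: continuous_intros)
  next
    fix t assume t: "t \<in> {a<..<b} - S"
    then have "\<gamma> t \<in> points M" using surface_path_in[OF \<gamma>(1), of t] by auto
    note c = some_chart[OF this]
    have "(F \<circ> \<gamma> has_vector_derivative ?d t) (at t)"
      using t c by (intro path_chain_rule[OF F \<gamma>(1)] S(2)) auto
    then show "((\<lambda>t. m *\<^sub>R F (\<gamma> t)) has_vector_derivative m *\<^sub>R ?d t) (at t)"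
      by (auto simp: o_def intro!: derivative_eq_intros)
    show "ennreal (norm (m *\<^sub>R ?d t)) \<le> ennreal (speed M h \<gamma> t)"
      using le[OF c(1) _ c(2)] t \<open>m \<ge> 0\<close> by (auto simp: speed_def norm_mult intro!: ennreal_leI)
  qed
  then show ?thesis
    using \<open>m \<ge> 0\<close> by (simp flip: scaleR_diff_right)
qed

lemma chart_increment_le_path_length:
  assumes h: "symmetric_2_tensor M h" and \<gamma>: "surface_path M {a..b} \<gamma>" "a \<le> b" and "m \<ge> 0"
    and c: "c \<in> atlas M" "\<gamma> ` {a..b} \<subseteq> fst c"
    and le: "\<And>t v. t \<in> {a..b} \<Longrightarrow> m * norm v \<le> sqrt (h c (\<gamma> t) v v)"
  shows "ennreal (m * norm (snd c (\<gamma> b) - snd c (\<gamma> a))) \<le> path_length M h {a..b} \<gamma>"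
proof -
  obtain S where S: "finite S" "\<And>c t. c \<in> atlas M \<Longrightarrow> t \<in> {a<..<b} - S \<Longrightarrow> \<gamma> t \<in> fst c \<Longrightarrow>
       (snd c \<circ> \<gamma> has_vector_derivative velocity c \<gamma> t) (at t)"
    using path_differentiable[OF \<gamma>] by auto
  have "(snd c \<circ> \<gamma>) piecewise_C1_differentiable_on {a..b}"
    using \<gamma> c unfolding surface_path_def by auto
  then have cont: "continuous_on {a..b} (snd c \<circ> \<gamma>)"
    by (simp add: piecewise_C1_differentiable_on_def)
  have "ennreal (norm (m *\<^sub>R snd c (\<gamma> b) - m *\<^sub>R snd c (\<gamma> a))) \<le> path_length M h {a..b} \<gamma>"
    unfolding path_length_speed
  proof (rule norm_increment_le_nn_integral[OF S(1) \<gamma>(2)])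
    show "continuous_on {a..b} (\<lambda>t. m *\<^sub>R snd c (\<gamma> t))"
      using cont by (auto simp: o_def intro!: continuous_intros)
  next
    fix t assume t: "t \<in> {a<..<b} - S"
    then have tc: "\<gamma> t \<in> fst c" using c by auto
    show "((\<lambda>t. m *\<^sub>R snd c (\<gamma> t)) has_vector_derivative m *\<^sub>R velocity c \<gamma> t) (at t)"
      using S(2)[OF c(1) t tc] by (auto simp: o_def intro!: derivative_eq_intros)
    have "speed M h \<gamma> t = sqrt (h c (\<gamma> t) (velocity c \<gamma> t) (velocity c \<gamma> t))"
      using t tc S(2) by (intro speed_in_chart[OF h \<gamma>(1) c(1)]) auto
    then show "ennreal (norm (m *\<^sub>R velocity c \<gamma> t)) \<le> ennreal (speed M h \<gamma> t)"
      using le[of t "velocity c \<gamma> t"] t \<open>m \<ge> 0\<close> by (auto intro!: ennreal_leI)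
  qed
  then show ?thesis
    using \<open>m \<ge> 0\<close> by (simp flip: scaleR_diff_right)
qed

subsection \<open>Operations on paths\<close>

lemma has_vector_derivative_affine: "((\<lambda>t. l + k * t) has_vector_derivative k) (at (t::real))"
  unfolding has_real_derivative_iff_has_vector_derivative[symmetric]
  by (auto intro!: derivative_eq_intros)

lemma surface_path_affine:
  assumes \<gamma>: "surface_path M {a..b} \<gamma>" and "k \<noteq> 0" and im: "(\<lambda>t. l + k * t) ` {c..d} \<subseteq> {a..b}"
  shows "surface_path M {c..d} (\<lambda>t. \<gamma> (l + k * t))"
  unfolding surface_path_def
proof (intro conjI ballI allI impI)
  have "continuous_map (top_of_set {c..d}) (top_of_set {a..b}) (\<lambda>t. l + k * t)"
    using im by (auto intro!: continuous_intros)
  then have "continuous_map (top_of_set {c..d}) (stop M) (\<gamma> \<circ> (\<lambda>t. l + k * t))"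
    using \<gamma> by (intro continuous_map_compose) (auto simp: surface_path_def)
  then show "continuous_map (top_of_set {c..d}) (stop M) (\<lambda>t. \<gamma> (l + k * t))"
    by (simp add: o_def)
next
  fix e x y assume e: "e \<in> atlas M"
    and xy: "x \<le> y \<and> {x..y} \<subseteq> {c..d} \<and> (\<lambda>t. \<gamma> (l + k * t)) ` {x..y} \<subseteq> fst e"
  obtain x' y' where img: "(\<lambda>t. l + k * t) ` {x..y} = {x'..y'}" "x' \<le> y'"
  proof (cases "k > 0")
    case True
    then have "(\<lambda>t. l + k * t) ` {x..y} = {k * x + l..k * y + l}" "k * x + l \<le> k * y + l"
      using xy image_affinity_atLeastAtMost[of k l x y] by (auto simp: add.commute)
    then show ?thesis using that by blast
  next
    case False
    then have "(\<lambda>t. l + k * t) ` {x..y} = {k * y + l..k * x + l}" "k * y + l \<le> k * x + l"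
      using xy image_affinity_atLeastAtMost[of k l x y] by (auto simp: add.commute mult_le_cancel_left)
    then show ?thesis using that by blast
  qed
  have sub: "{x'..y'} \<subseteq> {a..b}" using im xy img by blast
  have "\<gamma> ` {x'..y'} \<subseteq> fst e" using xy unfolding img(1)[symmetric] by (auto simp: image_image)
  then have "(snd e \<circ> \<gamma>) piecewise_C1_differentiable_on {x'..y'}"
    using \<gamma> e sub img(2) unfolding surface_path_def by blast
  then have "(snd e \<circ> \<gamma>) piecewise_C1_differentiable_on (\<lambda>t. l + k * t) ` {x..y}"
    by (simp add: img)
  moreover have "(\<lambda>t. l + k * t) piecewise_C1_differentiable_on {x..y}"
    by (rule C1_differentiable_imp_piecewise, unfold C1_differentiable_on_def, rule exI[of _ "\<lambda>_. k"])
       (simp add: has_vector_derivative_affine)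
  moreover have "finite ({x..y} \<inter> (\<lambda>t. l + k * t) -` {s})" for s
    by (rule finite_subset[of _ "{(s - l) / k}"]) (use \<open>k \<noteq> 0\<close> in auto)
  ultimately have "((snd e \<circ> \<gamma>) \<circ> (\<lambda>t. l + k * t)) piecewise_C1_differentiable_on {x..y}"
    by (intro piecewise_C1_differentiable_compose)
  then show "(snd e \<circ> (\<lambda>t. \<gamma> (l + k * t))) piecewise_C1_differentiable_on {x..y}"
    by (simp add: o_def)
qed

text \<open>The substitution multiplies the speed by \<open>|k|\<close>. It serves to reverse paths and to shrink them before they are
  joined.\<close>

lemma path_length_affine_le:
  assumes h: "symmetric_2_tensor M h"
    and \<gamma>: "surface_path M {a..b} \<gamma>" "a \<le> b" and "k \<noteq> 0" and im: "(\<lambda>t. l + k * t) ` {c..d} \<subseteq> {a..b}"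
  shows "path_length M h {c..d} (\<lambda>t. \<gamma> (l + k * t)) \<le> path_length M h {a..b} \<gamma>"
proof -
  obtain S where S: "finite S" "\<And>c t. c \<in> atlas M \<Longrightarrow> t \<in> {a<..<b} - S \<Longrightarrow> \<gamma> t \<in> fst c \<Longrightarrow>
       (snd c \<circ> \<gamma> has_vector_derivative velocity c \<gamma> t) (at t)"
    using path_differentiable[OF \<gamma>] by auto
  let ?\<sigma> = "\<lambda>t. l + k * t"
  let ?f = "\<lambda>s. ennreal (speed M h \<gamma> s) * indicator {a..b} s"
  define S' where "S' = (\<lambda>s. (s - l) / k) ` (S \<union> {a,b})"
  have ae: "AE t in lborel. t \<notin> S'"
    by (rule AE_lborel_not_in_finite) (use S(1) in \<open>auto simp: S'_def\<close>)
  have "path_length M h {c..d} (\<lambda>t. \<gamma> (?\<sigma> t)) \<le> (\<integral>\<^sup>+t. ennreal \<bar>k\<bar> * ?f (?\<sigma> t) \<partial>lborel)"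
    unfolding path_length_speed
  proof (rule nn_integral_mono_AE)
    show "AE t in lborel. ennreal (speed M h (\<lambda>t. \<gamma> (?\<sigma> t)) t) * indicator {c..d} t \<le> ennreal \<bar>k\<bar> * ?f (?\<sigma> t)"
      using ae
    proof eventually_elim
      fix t assume t: "t \<notin> S'"
      show "ennreal (speed M h (\<lambda>t. \<gamma> (?\<sigma> t)) t) * indicator {c..d} t \<le> ennreal \<bar>k\<bar> * ?f (?\<sigma> t)"
      proof (cases "t \<in> {c..d}")
        case True
        have "?\<sigma> t \<notin> S \<union> {a,b}"
        proof
          assume "?\<sigma> t \<in> S \<union> {a,b}"
          then have "(?\<sigma> t - l) / k \<in> S'" unfolding S'_def by (rule imageI)
          then show False using t \<open>k \<noteq> 0\<close> by simp
        qed
        moreover have "?\<sigma> t \<in> {a..b}" using im True by blast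
        ultimately have s: "?\<sigma> t \<in> {a<..<b} - S" by auto
        then have "\<gamma> (?\<sigma> t) \<in> points M" using surface_path_in[OF \<gamma>(1), of "?\<sigma> t"] by auto
        note e = some_chart[OF this]
        let ?e = "some_chart M (\<gamma> (?\<sigma> t))"
        have "((\<lambda>t. l + k * t) has_vector_derivative k) (at t)"
          by (rule has_vector_derivative_affine)
        then have "((snd ?e \<circ> \<gamma>) \<circ> (\<lambda>t. l + k * t) has_vector_derivative k *\<^sub>R velocity ?e \<gamma> (?\<sigma> t)) (at t)"
          by (rule vector_diff_chain_at) (rule S(2)[OF e(1) s e(2)])
        then have v: "velocity ?e (\<lambda>t. \<gamma> (?\<sigma> t)) t = k *\<^sub>R velocity ?e \<gamma> (?\<sigma> t)"
          unfolding velocity_def by (intro vector_derivative_at) (simp add: o_def)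
        have "bilinear (h ?e (\<gamma> (?\<sigma> t)))" using h e unfolding symmetric_2_tensor_def by blast
        then have "speed M h (\<lambda>t. \<gamma> (?\<sigma> t)) t = \<bar>k\<bar> * speed M h \<gamma> (?\<sigma> t)"
          by (simp add: speed_def v bilinear_lmul bilinear_rmul real_sqrt_mult flip: mult.assoc)
        then show ?thesis using True s by (simp add: ennreal_mult')
      qed simp
    qed
  qed
  also have "\<dots> \<le> path_length M h {a..b} \<gamma>"
    unfolding path_length_speed by (rule nn_integral_affine_le[OF \<open>k \<noteq> 0\<close>])
  finally show ?thesis .
qed

text \<open>The derivatives are two-sided even at the end points, where nothing is known outside the interval. Counting the end
  points among the exceptional times removes the difference.\<close>

lemma piecewise_C1_differentiable_on_cong:
  fixes f g :: "real \<Rightarrow> complex"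
  assumes "f piecewise_C1_differentiable_on {a..b}" "\<And>t. t \<in> {a..b} \<Longrightarrow> f t = g t"
  shows "g piecewise_C1_differentiable_on {a..b}"
proof -
  obtain S D where S: "finite S" "\<And>t. t \<in> {a..b} - S \<Longrightarrow> (f has_vector_derivative D t) (at t)"
      "continuous_on ({a..b} - S) D" and c: "continuous_on {a..b} f"
    using assms(1) unfolding piecewise_C1_differentiable_on_def C1_differentiable_on_def by blast
  have "(g has_vector_derivative D t) (at t)" if t: "t \<in> {a..b} - (S \<union> {a,b})" for t
    by (rule has_vector_derivative_transform_within_open[of f _ _ "{a<..<b}"]) (use t S(2) assms(2) in auto)
  moreover have "continuous_on ({a..b} - (S \<union> {a,b})) D" by (rule continuous_on_subset[OF S(3)]) auto
  ultimately have "g C1_differentiable_on ({a..b} - (S \<union> {a,b}))"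
    unfolding C1_differentiable_on_def by blast
  moreover have "continuous_on {a..b} g" using continuous_on_eq[OF c] assms(2) by blast
  ultimately show ?thesis
    unfolding piecewise_C1_differentiable_on_def
    by (intro conjI exI[of _ "S \<union> {a, b}"]) (use S(1) in auto)
qed

lemma surface_path_join:
  assumes f: "surface_path M {a..m} f" and g: "surface_path M {m..b} g" and eq: "f m = g m"
    and m: "a \<le> m" "m \<le> b"
  shows "surface_path M {a..b} (\<lambda>t. if t \<le> m then f t else g t)"
  unfolding surface_path_def
proof (intro conjI ballI allI impI)
  have sets: "{a..b} \<inter> {t. t \<in> {a..b} \<and> t \<le> m} = {a..m}" "{a..b} \<inter> {t. t \<in> {a..b} \<and> m \<le> t} = {m..b}"
    using m by auto
  show "continuous_map (top_of_set {a..b}) (stop M) (\<lambda>t. if t \<le> m then f t else g t)"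
  proof (rule continuous_map_cases_le)
    show "continuous_map (subtopology (top_of_set {a..b}) {t \<in> topspace (top_of_set {a..b}). t \<le> m}) (stop M) f"
      using f unfolding surface_path_def topspace_euclidean_subtopology subtopology_subtopology sets by blast
    show "continuous_map (subtopology (top_of_set {a..b}) {t \<in> topspace (top_of_set {a..b}). m \<le> t}) (stop M) g"
      using g unfolding surface_path_def topspace_euclidean_subtopology subtopology_subtopology sets by blast
  qed (use eq in auto)
next
  fix e x y assume e: "e \<in> atlas M"
    and xy: "x \<le> y \<and> {x..y} \<subseteq> {a..b} \<and> (\<lambda>t. if t \<le> m then f t else g t) ` {x..y} \<subseteq> fst e"
  have xy': "x \<le> y" "a \<le> x" "y \<le> b" using xy by auto
  have val: "(if t \<le> m then f t else g t) \<in> fst e" if "t \<in> {x..y}" for t using xy that by blast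
  have F: "(snd e \<circ> f) piecewise_C1_differentiable_on {x'..y'}"
    if "x \<le> x'" "x' \<le> y'" "y' \<le> y" "y' \<le> m" for x' y'
  proof -
    have "f ` {x'..y'} \<subseteq> fst e" using val that by (force split: if_splits)
    then show ?thesis using f e that xy' unfolding surface_path_def by auto
  qed
  have G: "(snd e \<circ> g) piecewise_C1_differentiable_on {x'..y'}"
    if "x \<le> x'" "x' \<le> y'" "y' \<le> y" "m \<le> x'" for x' y'
  proof -
    have "g t \<in> fst e" if "t \<in> {x'..y'}" for t
      using val[of t] \<open>x \<le> x'\<close> \<open>y' \<le> y\<close> \<open>m \<le> x'\<close> that eq by (cases "t = m") (auto split: if_splits)
    then have "g ` {x'..y'} \<subseteq> fst e" by blast
    then show ?thesis using g e that xy' unfolding surface_path_def by auto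
  qed
  show "(snd e \<circ> (\<lambda>t. if t \<le> m then f t else g t)) piecewise_C1_differentiable_on {x..y}"
  proof -
    consider "y \<le> m" | "m \<le> x" | "x < m" "m < y" by linarith
    then show ?thesis
    proof cases
      case 1
      show ?thesis
        by (rule piecewise_C1_differentiable_on_cong[OF F[of x y]]) (use 1 xy' in auto)
    next
      case 2
      show ?thesis
      proof (rule piecewise_C1_differentiable_on_cong[OF G[of x y]])
        fix t assume "t \<in> {x..y}"
        then show "(snd e \<circ> g) t = (snd e \<circ> (\<lambda>t. if t \<le> m then f t else g t)) t"
          using 2 eq by (cases "t = m") auto
      qed (use 2 xy' in auto)
    next
      case 3
      have "(\<lambda>t. if t \<le> m then (snd e \<circ> f) t else (snd e \<circ> g) t) piecewise_C1_differentiable_on {x..y}"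
        using 3 xy' eq by (intro piecewise_C1_differentiable_cases F G) auto
      then show ?thesis by (rule piecewise_C1_differentiable_on_cong) auto
    qed
  qed
qed

lemma path_length_join_le:
  assumes m: "a \<le> m" "m \<le> b"
  shows "path_length M h {a..b} (\<lambda>t. if t \<le> m then f t else g t) \<le>
    path_length M h {a..m} f + path_length M h {m..b} g"
proof -
  let ?j = "\<lambda>t. if t \<le> m then f t else g t"
  have "{a..b} = {a..m} \<union> {m..b}" using m by auto
  then have "path_length M h {a..b} ?j \<le> path_length M h {a..m} ?j + path_length M h {m..b} ?j"
    unfolding path_length_speed using nn_integral_set_Un_le[of "{a..m}" lborel "{m..b}"] by simp
  moreover have ae: "AE t in lborel. t \<notin> {m}" by (rule AE_lborel_not_in_finite) simp
  have sp: "speed M h ?j t = (if t < m then speed M h f t else speed M h g t)" if "t \<noteq> m" for t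
  proof (cases "t < m")
    case True
    have "\<forall>\<^sub>F s in nhds t. s \<in> {..<m}" using True by (intro eventually_nhds_in_open) auto
    then have "\<forall>\<^sub>F s in nhds t. ?j s = f s" by eventually_elim simp
    from velocity_cong[OF this] True show ?thesis by (simp add: speed_def)
  next
    case False
    then have "t > m" using that by simp
    have "\<forall>\<^sub>F s in nhds t. s \<in> {m<..}" using \<open>t > m\<close> by (intro eventually_nhds_in_open) auto
    then have "\<forall>\<^sub>F s in nhds t. ?j s = g s" by eventually_elim simp
    from velocity_cong[OF this] \<open>t > m\<close> show ?thesis by (simp add: speed_def)
  qed
  have "path_length M h {a..m} ?j \<le> path_length M h {a..m} f"
    unfolding path_length_speed
    by (rule nn_integral_mono_AE, use ae in eventually_elim) (auto simp: indicator_def sp)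
  moreover have "path_length M h {m..b} ?j \<le> path_length M h {m..b} g"
    unfolding path_length_speed
    by (rule nn_integral_mono_AE, use ae in eventually_elim) (auto simp: indicator_def sp)
  ultimately show ?thesis by (meson add_mono order_trans)
qed

end

section \<open>Distance and completeness\<close>

locale conformal_metric = riemann_surface M for M :: "'a surface" +
  fixes l :: "'a chart \<Rightarrow> 'a \<Rightarrow> real"
  assumes riemannian_metric: "riemannian_metric M (\<lambda>c q u v. l c q * (u \<bullet> v))"
begin

abbreviation metric :: "'a tensor2" where "metric \<equiv> \<lambda>c q u v. l c q * (u \<bullet> v)"

lemma symmetric_2_tensor_metric: "symmetric_2_tensor M metric"
  using riemannian_metric by (simp add: riemannian_metric_def)

lemma conformal_factor_pos: "c \<in> atlas M \<Longrightarrow> q \<in> fst c \<Longrightarrow> 0 < l c q"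
proof -
  assume "c \<in> atlas M" "q \<in> fst c"
  moreover have "\<forall>c\<in>atlas M. \<forall>q\<in>fst c. \<forall>u. u \<noteq> 0 \<longrightarrow> metric c q u u > 0"
    using riemannian_metric unfolding riemannian_metric_def by (rule conjunct2)
  ultimately have "metric c q 1 1 > 0" by (metis zero_neq_one)
  then show ?thesis by simp
qed

lemma continuous_conformal_factor:
  assumes "c \<in> atlas M" shows "continuous_on (chart_image c) (\<lambda>z. l c (param c z))"
proof -
  have "smooth_on (\<lambda>z. l c (param c z) * ((1::complex) \<bullet> 1)) (chart_image c)"
    using symmetric_2_tensor_metric assms unfolding symmetric_2_tensor_def by blast
  then have "Ck_on 0 (\<lambda>z. l c (param c z) * ((1::complex) \<bullet> 1)) (chart_image c)"
    unfolding smooth_on_def by blast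
  then show ?thesis by simp
qed

lemma sqrt_metric: "sqrt (metric c q v v) = sqrt (l c q) * norm v"
  by (simp add: real_sqrt_mult norm_eq_sqrt_inner)

definition connecting_paths :: "'a \<Rightarrow> 'a \<Rightarrow> (real \<Rightarrow> 'a) set" where
  "connecting_paths x y = {\<gamma>. surface_path M {0..1} \<gamma> \<and> \<gamma> 0 = x \<and> \<gamma> 1 = y}"

text \<open>The Riemannian distance before its conversion to a real number, which would turn the value \<open>\<infinity>\<close> for points that
  no path of finite length joins into 0.\<close>

definition length_distance :: "'a \<Rightarrow> 'a \<Rightarrow> ennreal" where
  "length_distance x y = (INF \<gamma>\<in>connecting_paths x y. path_length M metric {0..1} \<gamma>)"

lemma length_distance_le: "\<gamma> \<in> connecting_paths x y \<Longrightarrow> length_distance x y \<le> path_length M metric {0..1} \<gamma>"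
  unfolding length_distance_def by (rule INF_lower)

lemma length_distance_commute_le: "length_distance y x \<le> length_distance x y"
  unfolding length_distance_def[of x y]
proof (rule INF_greatest)
  fix \<gamma> assume \<gamma>: "\<gamma> \<in> connecting_paths x y"
  have im: "(\<lambda>t. 1 + (-1) * t) ` {0..1} \<subseteq> {0..1::real}" by auto
  have "(\<lambda>t. \<gamma> (1 + (-1) * t)) \<in> connecting_paths y x"
    using \<gamma> surface_path_affine[OF _ _ im, of \<gamma>] by (auto simp: connecting_paths_def)
  then have "length_distance y x \<le> path_length M metric {0..1} (\<lambda>t. \<gamma> (1 + (-1) * t))"
    by (rule length_distance_le)
  also have "\<dots> \<le> path_length M metric {0..1} \<gamma>"
    using \<gamma> by (intro path_length_affine_le[OF symmetric_2_tensor_metric _ _ _ im]) (auto simp: connecting_paths_def)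
  finally show "length_distance y x \<le> path_length M metric {0..1} \<gamma>" .
qed

lemma length_distance_commute: "length_distance x y = length_distance y x"
  by (intro antisym length_distance_commute_le)

lemma length_distance_le_add:
  assumes f: "f \<in> connecting_paths x y" and g: "g \<in> connecting_paths y z"
  shows "length_distance x z \<le> path_length M metric {0..1} f + path_length M metric {0..1} g"
proof -
  let ?f = "\<lambda>t. f (0 + 2 * t)" and ?g = "\<lambda>t. g (-1 + 2 * t)"
  let ?j = "\<lambda>t. if t \<le> 1/2 then ?f t else ?g t"
  have im: "(\<lambda>t. 0 + 2 * t) ` {0..1/2} \<subseteq> {0..1::real}" "(\<lambda>t. -1 + 2 * t) ` {1/2..1} \<subseteq> {0..1::real}" by auto
  have fg: "surface_path M {0..1} f" "surface_path M {0..1} g" "f 0 = x" "f 1 = y" "g 0 = y" "g 1 = z"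
    using f g by (auto simp: connecting_paths_def)
  have "surface_path M {0..1} ?j"
    using fg by (intro surface_path_join surface_path_affine[OF _ _ im(1)] surface_path_affine[OF _ _ im(2)]) auto
  then have "?j \<in> connecting_paths x z" using fg by (simp add: connecting_paths_def)
  then have "length_distance x z \<le> path_length M metric {0..1} ?j" by (rule length_distance_le)
  also have "\<dots> \<le> path_length M metric {0..1/2} ?f + path_length M metric {1/2..1} ?g"
    by (rule path_length_join_le) auto
  also have "\<dots> \<le> path_length M metric {0..1} f + path_length M metric {0..1} g"
    using fg by (intro add_mono path_length_affine_le[OF symmetric_2_tensor_metric _ _ _ im(1)]
        path_length_affine_le[OF symmetric_2_tensor_metric _ _ _ im(2)]) auto
  finally show ?thesis .
qed

lemma length_distance_triangle: "length_distance x z \<le> length_distance x y + length_distance y z"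
proof (rule ennreal_le_epsilon)
  fix e :: real assume fin: "length_distance x y + length_distance y z < top" and "e > 0"
  have "length_distance x y < length_distance x y + ennreal (e/2)"
       "length_distance y z < length_distance y z + ennreal (e/2)"
    using fin \<open>e > 0\<close> by (auto simp: ennreal_add_left_cancel_less[of _ 0, simplified] less_top)
  then obtain f g where f: "f \<in> connecting_paths x y" "path_length M metric {0..1} f < length_distance x y + ennreal (e/2)"
    and g: "g \<in> connecting_paths y z" "path_length M metric {0..1} g < length_distance y z + ennreal (e/2)"
    unfolding length_distance_def INF_less_iff by blast
  have "length_distance x z \<le> path_length M metric {0..1} f + path_length M metric {0..1} g"
    by (rule length_distance_le_add[OF f(1) g(1)])
  also have "\<dots> \<le> (length_distance x y + ennreal (e/2)) + (length_distance y z + ennreal (e/2))"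
    using f g by (intro add_mono) auto
  also have "\<dots> = length_distance x y + length_distance y z + (ennreal (e/2) + ennreal (e/2))"
    by (simp add: ac_simps)
  also have "ennreal (e/2) + ennreal (e/2) = ennreal e"
    using \<open>e > 0\<close> by (simp flip: ennreal_plus)
  finally show "length_distance x z \<le> length_distance x y + length_distance y z + ennreal e" .
qed

lemma segment_surface_path:
  assumes c: "c \<in> atlas M" and seg: "\<And>t. t \<in> {0..1} \<Longrightarrow> x + t *\<^sub>R (y - x) \<in> chart_image c"
  shows "surface_path M {0..1} (\<lambda>t. param c (x + t *\<^sub>R (y - x)))"
  unfolding surface_path_def
proof (intro conjI ballI allI impI)
  have "continuous_map (top_of_set {0..1}) (top_of_set (chart_image c)) (\<lambda>t. x + t *\<^sub>R (y - x))"
    using seg by (auto intro!: continuous_intros)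
  then have "continuous_map (top_of_set {0..1}) (stop M) (param c \<circ> (\<lambda>t. x + t *\<^sub>R (y - x)))"
    by (rule continuous_map_compose[OF _ continuous_map_param[OF c]])
  then show "continuous_map (top_of_set {0..1}) (stop M) (\<lambda>t. param c (x + t *\<^sub>R (y - x)))"
    by (simp add: o_def)
next
  fix d a b assume d: "d \<in> atlas M"
    and ab: "a \<le> b \<and> {a..b} \<subseteq> {0..1} \<and> (\<lambda>t. param c (x + t *\<^sub>R (y - x))) ` {a..b} \<subseteq> fst d"
  let ?line = "\<lambda>t. x + t *\<^sub>R (y - x)"
  let ?O = "snd c ` (fst c \<inter> fst d)"
  have O: "open ?O" by (rule open_chart_overlap[OF c openin_chart[OF d]])
  have line: "?line t \<in> ?O" if "t \<in> {a..b}" for t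
  proof -
    have t: "?line t \<in> chart_image c" "param c (?line t) \<in> fst d" using seg ab that by auto
    then have "?line t = snd c (param c (?line t))" "param c (?line t) \<in> fst c \<inter> fst d"
      by (auto simp: param_in_chart)
    then show ?thesis by (rule image_eqI)
  qed
  have hol: "transition c d holomorphic_on ?O" by (rule transition_holomorphic[OF c d])
  have vd: "((transition c d \<circ> ?line) has_vector_derivative (y - x) * deriv (transition c d) (?line t)) (at t)"
    if "t \<in> {a..b}" for t
  proof (rule field_vector_diff_chain_at)
    show "(?line has_vector_derivative y - x) (at t)" by (auto intro!: derivative_eq_intros)
    show "(transition c d has_field_derivative deriv (transition c d) (?line t)) (at (?line t))"
      using hol O line[OF that] by (rule holomorphic_derivI)
  qed
  have contd: "continuous_on {a..b} (\<lambda>t. (y - x) * deriv (transition c d) (?line t))"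
  proof (intro continuous_intros)
    have "continuous_on ?O (deriv (transition c d))"
      using hol O by (intro holomorphic_on_imp_continuous_on holomorphic_deriv)
    then show "continuous_on {a..b} (\<lambda>t. deriv (transition c d) (?line t))"
      by (rule continuous_on_compose2) (use line in \<open>auto intro!: continuous_intros\<close>)
  qed
  have "(transition c d \<circ> ?line) C1_differentiable_on {a..b}"
    unfolding C1_differentiable_on_def
    by (intro exI[of _ "\<lambda>t. (y - x) * deriv (transition c d) (?line t)"] conjI ballI vd contd)
  then have "(transition c d \<circ> ?line) piecewise_C1_differentiable_on {a..b}"
    by (rule C1_differentiable_imp_piecewise)
  then show "(snd d \<circ> (\<lambda>t. param c (?line t))) piecewise_C1_differentiable_on {a..b}"
    by (rule piecewise_C1_differentiable_on_cong) (simp add: transition_def)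
qed

text \<open>Inside a convex part of a chart the straight segment is a competitor for the distance.\<close>

lemma length_distance_segment:
  assumes c: "c \<in> atlas M" and S: "convex S" "S \<subseteq> chart_image c" "x \<in> S" "y \<in> S" and "K \<ge> 0"
    and K: "\<And>z. z \<in> S \<Longrightarrow> sqrt (l c (param c z)) \<le> K"
  shows "length_distance (param c x) (param c y) \<le> ennreal (K * norm (y - x))"
proof -
  let ?\<gamma> = "\<lambda>t. param c (x + t *\<^sub>R (y - x))"
  have seg: "x + t *\<^sub>R (y - x) \<in> S" if "t \<in> {0..1}" for t
    using convexD_alt[OF S(1,3,4), of t] that by (simp add: algebra_simps)
  have \<gamma>: "surface_path M {0..1} ?\<gamma>" by (rule segment_surface_path[OF c]) (use seg S(2) in blast)
  obtain T where T: "finite T" "\<And>c t. c \<in> atlas M \<Longrightarrow> t \<in> {0<..<1} - T \<Longrightarrow> ?\<gamma> t \<in> fst c \<Longrightarrow>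
       (snd c \<circ> ?\<gamma> has_vector_derivative velocity c ?\<gamma> t) (at t)"
    using path_differentiable[OF \<gamma>] by (metis zero_le_one)
  have ae: "AE t in lborel. t \<notin> T \<union> {0,1}" by (rule AE_lborel_not_in_finite) (use T in auto)
  have "?\<gamma> \<in> connecting_paths (param c x) (param c y)" using \<gamma> by (simp add: connecting_paths_def)
  then have "length_distance (param c x) (param c y) \<le> path_length M metric {0..1} ?\<gamma>"
    by (rule length_distance_le)
  also have "\<dots> \<le> (\<integral>\<^sup>+t\<in>{0..1::real}. ennreal (K * norm (y - x)) \<partial>lborel)"
    unfolding path_length_speed
  proof (rule nn_integral_mono_AE)
    have bound: "ennreal (speed M metric ?\<gamma> t) * indicator {0..1} t \<le> ennreal (K * norm (y - x)) * indicator {0..1} t"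
      if t: "t \<notin> T \<union> {0,1}" for t :: real
    proof (cases "t \<in> {0..1}")
      case True
      then have t': "t \<in> {0<..<1} - T" using t by auto
      have tc: "?\<gamma> t \<in> fst c" using seg[OF True] S(2) by (auto intro!: param_in_chart)
      have "(snd c \<circ> ?\<gamma> has_vector_derivative (y - x)) (at t)"
      proof (rule has_vector_derivative_transform_within_open[of "\<lambda>t. x + t *\<^sub>R (y - x)" _ _ "{0<..<1}"])
        show "((\<lambda>t. x + t *\<^sub>R (y - x)) has_vector_derivative y - x) (at t)"
          by (auto intro!: derivative_eq_intros)
        fix s :: real assume "s \<in> {0<..<1}"
        then have "x + s *\<^sub>R (y - x) \<in> chart_image c" using seg[of s] S(2) by auto
        then show "x + s *\<^sub>R (y - x) = (snd c \<circ> ?\<gamma>) s" by simp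
      qed (use t' in auto)
      then have v: "velocity c ?\<gamma> t = y - x" unfolding velocity_def by (rule vector_derivative_at)
      have "speed M metric ?\<gamma> t = sqrt (metric c (?\<gamma> t) (velocity c ?\<gamma> t) (velocity c ?\<gamma> t))"
        by (rule speed_in_chart[OF symmetric_2_tensor_metric \<gamma> c _ tc T(2)]) (use t' in auto)
      also have "\<dots> \<le> K * norm (y - x)"
        unfolding sqrt_metric v using K[OF seg[OF True]] by (intro mult_right_mono) auto
      finally show ?thesis by (intro mult_right_mono ennreal_leI) auto
    qed simp
    show "AE t in lborel. ennreal (speed M metric ?\<gamma> t) * indicator {0..1} t \<le>
        ennreal (K * norm (y - x)) * indicator {0..1} t"
      using ae by eventually_elim (rule bound)
  qed
  also have "\<dots> = ennreal (K * norm (y - x))" by (simp add: nn_integral_cmult_indicator)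
  finally show ?thesis .
qed

lemma chart_disc:
  assumes "x \<in> points M"
  obtains c r m K where "c \<in> atlas M" "x \<in> fst c" "0 < r" "cball (snd c x) r \<subseteq> chart_image c"
    "0 < m" "0 < K" "\<And>z. z \<in> cball (snd c x) r \<Longrightarrow> m \<le> sqrt (l c (param c z)) \<and> sqrt (l c (param c z)) \<le> K"
proof -
  define c where "c = some_chart M x"
  have c: "c \<in> atlas M" "x \<in> fst c" using some_chart[OF assms] by (auto simp: c_def)
  then obtain r where r: "r > 0" "cball (snd c x) r \<subseteq> chart_image c"
    using open_chart_image[OF c(1)] open_contains_cball[of "chart_image c"] by blast
  let ?f = "\<lambda>z. sqrt (l c (param c z))"
  have cont: "continuous_on (cball (snd c x) r) ?f"
    using continuous_on_subset[OF continuous_conformal_factor[OF c(1)] r(2)] by (intro continuous_intros)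
  have ne: "cball (snd c x) r \<noteq> {}" using r by simp
  obtain z1 where z1: "z1 \<in> cball (snd c x) r" "\<forall>z\<in>cball (snd c x) r. ?f z1 \<le> ?f z"
    using continuous_attains_inf[OF compact_cball ne cont] by blast
  obtain z2 where z2: "z2 \<in> cball (snd c x) r" "\<forall>z\<in>cball (snd c x) r. ?f z \<le> ?f z2"
    using continuous_attains_sup[OF compact_cball ne cont] by blast
  have pos: "0 < ?f z" if "z \<in> cball (snd c x) r" for z
    using conformal_factor_pos[OF c(1) param_in_chart] r(2) that by (metis real_sqrt_gt_zero subset_iff)
  show ?thesis
    using that[OF c r pos[OF z1(1)] pos[OF z2(1)]] z1(2) z2(2) by blast
qed

lemma length_distance_small_near:
  assumes "x \<in> points M" "0 < (e::real)"
  obtains U where "openin (stop M) U" "x \<in> U" "\<And>y. y \<in> U \<Longrightarrow> length_distance x y < ennreal e"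
proof -
  obtain c r m K where c: "c \<in> atlas M" "x \<in> fst c" "0 < r" "cball (snd c x) r \<subseteq> chart_image c" "0 < K"
    "\<And>z. z \<in> cball (snd c x) r \<Longrightarrow> m \<le> sqrt (l c (param c z)) \<and> sqrt (l c (param c z)) \<le> K"
    using chart_disc[OF assms(1)] by metis
  define s where "s = min r (e / K)"
  have s: "0 < s" "s \<le> r" "K * s \<le> e" using c assms(2) by (auto simp: s_def min_def field_simps)
  have sub: "ball (snd c x) s \<subseteq> cball (snd c x) r" using s by (meson ball_subset_cball order_trans subset_cball)
  show ?thesis
  proof (rule that[of "param c ` ball (snd c x) s"])
    show "openin (stop M) (param c ` ball (snd c x) s)"
      using sub c by (intro openin_param_image) auto
    show "x \<in> param c ` ball (snd c x) s"
      using c(1,2) s(1) by (metis centre_in_ball image_eqI param_chart)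
    fix y assume "y \<in> param c ` ball (snd c x) s"
    then obtain z where z: "z \<in> ball (snd c x) s" "y = param c z" by blast
    have "length_distance (param c (snd c x)) (param c z) \<le> ennreal (K * norm (z - snd c x))"
      using sub c s z by (intro length_distance_segment[where S="ball (snd c x) s"]) auto
    also have "\<dots> < ennreal e"
    proof (rule ennreal_lessI)
      have "norm (z - snd c x) < s" using z(1) by (simp add: dist_norm norm_minus_commute)
      then have "K * norm (z - snd c x) < K * s" using c(5) by simp
      then show "K * norm (z - snd c x) < e" using s(3) by simp
    qed (use assms in auto)
    finally show "length_distance x y < ennreal e" using c(1,2) z(2) by simp
  qed
qed

text \<open>The points at finite distance from \<open>x\<close> form an open and closed set.\<close>

lemma length_distance_finite:
  assumes "x \<in> points M" "y \<in> points M"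
  shows "length_distance x y < \<infinity>"
proof -
  define R where "R = {y \<in> points M. length_distance x y < \<infinity>}"
  have near: "\<exists>U. openin (stop M) U \<and> y \<in> U \<and> (\<forall>z\<in>U. length_distance y z < \<infinity>)" if "y \<in> points M" for y
    using length_distance_small_near[OF that, of 1] by (metis ennreal_less_top infinity_ennreal_def order_less_trans zero_less_one)
  have "openin (stop M) R"
  proof (subst openin_subopen, intro ballI)
    fix y assume y: "y \<in> R"
    then obtain U where U: "openin (stop M) U" "y \<in> U" "\<forall>z\<in>U. length_distance y z < \<infinity>"
      using near by (auto simp: R_def)
    have "U \<subseteq> R"
    proof
      fix z assume z: "z \<in> U"
      have "length_distance x z \<le> length_distance x y + length_distance y z" by (rule length_distance_triangle)
      also have "\<dots> < \<infinity>" using y z U by (simp add: R_def)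
      finally show "z \<in> R" using z U(1) openin_subset by (auto simp: R_def)
    qed
    then show "\<exists>T. openin (stop M) T \<and> y \<in> T \<and> T \<subseteq> R" using U by blast
  qed
  moreover have "openin (stop M) (points M - R)"
  proof (subst openin_subopen, intro ballI)
    fix y assume y: "y \<in> points M - R"
    then obtain U where U: "openin (stop M) U" "y \<in> U" "\<forall>z\<in>U. length_distance y z < \<infinity>"
      using near by auto
    have "U \<subseteq> points M - R"
    proof
      fix z assume z: "z \<in> U"
      have "length_distance x y \<le> length_distance x z + length_distance z y" by (rule length_distance_triangle)
      moreover have "length_distance x y = \<infinity>" using y by (auto simp: R_def less_top[symmetric])
      moreover have "length_distance z y < \<infinity>" using z U by (simp add: length_distance_commute[of z y])
      ultimately have "length_distance x z = \<infinity>" by (auto simp: top_unique)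
      then show "z \<in> points M - R" using z U(1) openin_subset by (auto simp: R_def)
    qed
    then show "\<exists>T. openin (stop M) T \<and> y \<in> T \<and> T \<subseteq> points M - R" using U by blast
  qed
  moreover have "R \<subseteq> points M" by (auto simp: R_def)
  ultimately have "R = {} \<or> R = points M"
    using connected_riemann_surface unfolding connected_riemann_surface_def connected_space_clopen_in closedin_def by blast
  moreover have "x \<in> R"
    using near[OF assms(1)] assms(1) by (auto simp: R_def)
  ultimately show ?thesis using assms by (auto simp: R_def)
qed

text \<open>A path that ends away from its starting point must cross an annulus in a chart, on which the
  metric is bounded below.\<close>

lemma length_distance_pos:
  assumes x: "x \<in> points M" and y: "y \<in> points M" and "x \<noteq> y"
  shows "0 < length_distance x y"
proof -
  obtain c r0 m K where c: "c \<in> atlas M" "x \<in> fst c" "0 < r0" "cball (snd c x) r0 \<subseteq> chart_image c" "0 < m"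
    "\<And>z. z \<in> cball (snd c x) r0 \<Longrightarrow> m \<le> sqrt (l c (param c z)) \<and> sqrt (l c (param c z)) \<le> K"
    using chart_disc[OF x] by metis
  \<comment> \<open>A disc that does not contain the end point, inside one on which the metric is bounded below.\<close>
  obtain r where r: "0 < r" "r \<le> r0" "y \<notin> param c ` ball (snd c x) r"
  proof (cases "y \<in> fst c")
    case True
    have ne: "snd c y \<noteq> snd c x" using True c(1,2) \<open>x \<noteq> y\<close> by (metis param_chart)
    show ?thesis
    proof (rule that[of "min r0 (dist (snd c x) (snd c y))"])
      show "y \<notin> param c ` ball (snd c x) (min r0 (dist (snd c x) (snd c y)))"
      proof
        assume "y \<in> param c ` ball (snd c x) (min r0 (dist (snd c x) (snd c y)))"
        then obtain z where z: "z \<in> ball (snd c x) (min r0 (dist (snd c x) (snd c y)))" "y = param c z" by blast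
        then have "z \<in> chart_image c" using c(4) by auto
        then have "snd c y = z" using z(2) by simp
        then show False using z(1) by simp
      qed
    qed (use c(3) ne in auto)
  next
    case False
    show ?thesis
    proof (rule that[of r0])
      show "y \<notin> param c ` ball (snd c x) r0"
        using False c(4) ball_subset_cball[of "snd c x" r0] param_in_chart[of _ c] by blast
    qed (use c(3) in auto)
  qed
  have sub: "ball (snd c x) r \<subseteq> chart_image c" "cball (snd c x) (r/2) \<subseteq> chart_image c"
    using c(4) r by (auto simp: subset_iff)
  define V where "V = param c ` ball (snd c x) r"
  define C where "C = param c ` cball (snd c x) (r/2)"
  have V: "openin (stop M) V" unfolding V_def using sub by (intro openin_param_image c) auto
  have "compactin (stop M) C"
    unfolding C_def
    by (rule image_compactin[OF _ continuous_map_param[OF c(1)]])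
       (use sub in \<open>auto simp: compactin_subtopology\<close>)
  then have C: "closedin (stop M) C"
    using connected_riemann_surface by (intro compactin_imp_closedin) (auto simp: connected_riemann_surface_def)
  have CV: "C \<subseteq> V" unfolding C_def V_def using r by (intro image_mono) auto
  have "ennreal (m * (r/2)) \<le> path_length M metric {0..1} \<gamma>" if \<gamma>: "\<gamma> \<in> connecting_paths x y" for \<gamma>
  proof (rule ccontr)
    assume "\<not> ennreal (m * (r/2)) \<le> path_length M metric {0..1} \<gamma>"
    then have short: "path_length M metric {0..1} \<gamma> < ennreal (m * (r/2))" by simp
    have path: "surface_path M {0..1} \<gamma>" and ends: "\<gamma> 0 = x" "\<gamma> 1 = y"
      using \<gamma> by (auto simp: connecting_paths_def)
    have cont: "continuous_map (top_of_set {0..1}) (stop M) \<gamma>"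
      using path by (simp add: surface_path_def)
    define T where "T = {t \<in> {0..1}. \<gamma> t \<notin> V}"
    have "openin (top_of_set {0..1}) {t \<in> topspace (top_of_set {0..1}). \<gamma> t \<in> V}"
      using cont V by (rule openin_continuous_map_preimage)
    moreover have "T = {0..1} - {t \<in> topspace (top_of_set {0..1}). \<gamma> t \<in> V}" by (auto simp: T_def)
    ultimately have "closedin (top_of_set {0..1}) T"
      by (metis closedin_diff closedin_topspace topspace_euclidean_subtopology)
    then have "compact T" by (metis closedin_compact compact_Icc)
    moreover have "1 \<in> T" using ends r(3) by (simp add: T_def V_def)
    ultimately obtain t1 where t1: "t1 \<in> T" "\<And>t. t \<in> T \<Longrightarrow> t1 \<le> t"
      using compact_attains_inf[of T] by blast
    have "x \<in> V" unfolding V_def using c(1,2) r(1) by (metis centre_in_ball image_eqI param_chart)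
    then have "t1 \<noteq> 0" using t1(1) ends by (auto simp: T_def)
    then have t1': "0 < t1" "t1 \<le> 1" using t1(1) by (auto simp: T_def)
    \<comment> \<open>Up to the first time outside the disc, a short path stays in the closed disc of half the radius, which is closed in the surface because it is compact.\<close>
    have inC: "\<gamma> t \<in> C" if t: "0 \<le> t" "t < t1" for t
    proof -
      have inV: "\<gamma> s \<in> V" if "s \<in> {0..t}" for s
        using t1(2)[of s] that t t1' by (force simp: T_def)
      have coord: "\<gamma> s \<in> fst c \<and> snd c (\<gamma> s) \<in> ball (snd c x) r" if s: "s \<in> {0..t}" for s
      proof -
        obtain z where z: "z \<in> ball (snd c x) r" "\<gamma> s = param c z" using inV[OF s] unfolding V_def by blast
        then have "z \<in> chart_image c" using sub(1) by blast
        then show ?thesis using z by (simp add: param_in_chart)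
      qed
      have "ennreal (m * norm (snd c (\<gamma> t) - snd c (\<gamma> 0))) \<le> path_length M metric {0..t} \<gamma>"
      proof (rule chart_increment_le_path_length[OF symmetric_2_tensor_metric _ _ _ c(1)])
        show "surface_path M {0..t} \<gamma>" by (rule surface_path_subset[OF path]) (use t t1' in auto)
        fix s v assume "s \<in> {0..t}"
        note s = coord[OF this]
        then have "snd c (\<gamma> s) \<in> cball (snd c x) r0" using r(2) by auto
        from c(6)[OF this] s c(1) have "m \<le> sqrt (l c (\<gamma> s))" by simp
        then show "m * norm v \<le> sqrt (metric c (\<gamma> s) v v)"
          unfolding sqrt_metric by (intro mult_right_mono) auto
      qed (use t c(5) coord in auto)
      also have "\<dots> \<le> path_length M metric {0..1} \<gamma>" by (rule path_length_mono) (use t t1' in auto)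
      also note short
      finally have "m * norm (snd c (\<gamma> t) - snd c (\<gamma> 0)) < m * (r/2)"
        using c(5) by (simp add: ennreal_less_iff)
      then have "snd c (\<gamma> t) \<in> cball (snd c x) (r/2)"
        using c(5) ends by (simp add: dist_norm norm_minus_commute)
      moreover have "\<gamma> t = param c (snd c (\<gamma> t))" using coord[of t] t c(1) by simp
      ultimately show ?thesis unfolding C_def by blast
    qed
    have "closedin (top_of_set {0..1}) {t \<in> topspace (top_of_set {0..1}). \<gamma> t \<in> C}"
      using cont C by (rule closedin_continuous_map_preimage)
    then have "closed {t \<in> {0..1}. \<gamma> t \<in> C}" by (auto intro: closedin_closed_trans)
    moreover have "{0..<t1} \<subseteq> {t \<in> {0..1}. \<gamma> t \<in> C}" using inC t1' by auto
    ultimately have "closure {0..<t1} \<subseteq> {t \<in> {0..1}. \<gamma> t \<in> C}" by (simp add: closure_minimal)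
    moreover have "t1 \<in> closure {0..<t1}" using t1' by (simp add: closure_atLeastLessThan)
    ultimately have "\<gamma> t1 \<in> V" using CV by blast
    then show False using t1(1) by (simp add: T_def)
  qed
  then have "ennreal (m * (r/2)) \<le> length_distance x y"
    unfolding length_distance_def by (rule INF_greatest)
  moreover have "0 < ennreal (m * (r/2))" using c(5) r(1) by simp
  ultimately show ?thesis by (rule order_less_le_trans[rotated])
qed

lemma length_distance_self: "x \<in> points M \<Longrightarrow> length_distance x x = 0"
proof (rule ccontr)
  assume x: "x \<in> points M" and "length_distance x x \<noteq> 0"
  then have "0 < length_distance x x" by (simp add: zero_less_iff_neq_zero)
  moreover have "length_distance x x < \<infinity>" using length_distance_finite x by blast
  ultimately obtain e where e: "0 < e" "length_distance x x = ennreal e"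
    by (cases "length_distance x x") auto
  obtain U where "x \<in> U" "\<And>y. y \<in> U \<Longrightarrow> length_distance x y < ennreal e"
    using length_distance_small_near[OF x e(1)] by metis
  then show False using e by force
qed

lemma riemannian_distance_eq: "riemannian_distance M metric x y = enn2real (length_distance x y)"
  by (simp add: riemannian_distance_def length_distance_def connecting_paths_def)

lemma Metric_space_riemannian_distance: "Metric_space (points M) (riemannian_distance M metric)"
proof
  fix x y show "0 \<le> riemannian_distance M metric x y" by (simp add: riemannian_distance_eq)
  show "riemannian_distance M metric x y = riemannian_distance M metric y x"
    by (simp add: riemannian_distance_eq length_distance_commute)
next
  fix x y assume xy: "x \<in> points M" "y \<in> points M"
  show "(riemannian_distance M metric x y = 0) = (x = y)"
  proof (cases "x = y")
    case True
    then show ?thesis using length_distance_self[OF xy(1)] by (simp add: riemannian_distance_eq)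
  next
    case False
    then have "enn2real (length_distance x y) \<noteq> 0"
      using length_distance_pos[OF xy] length_distance_finite[OF xy] by (auto simp: enn2real_eq_0_iff)
    then show ?thesis using False by (simp add: riemannian_distance_eq)
  qed
next
  fix x y z assume xyz: "x \<in> points M" "y \<in> points M" "z \<in> points M"
  have fin: "length_distance x y < top" "length_distance y z < top"
    using length_distance_finite xyz by auto
  have "enn2real (length_distance x z) \<le> enn2real (length_distance x y + length_distance y z)"
    by (rule enn2real_mono[OF length_distance_triangle]) (use fin in simp)
  also have "\<dots> = enn2real (length_distance x y) + enn2real (length_distance y z)"
    by (rule enn2real_plus) (use fin in auto)
  finally show "riemannian_distance M metric x z \<le> riemannian_distance M metric x y + riemannian_distance M metric y z"
    by (simp add: riemannian_distance_eq)
qed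

lemma riemannian_distance_small_near:
  assumes "x \<in> points M" "0 < (e::real)"
  obtains U where "openin (stop M) U" "x \<in> U" "\<And>y. y \<in> U \<Longrightarrow> riemannian_distance M metric x y < e"
proof -
  obtain U where U: "openin (stop M) U" "x \<in> U" "\<And>y. y \<in> U \<Longrightarrow> length_distance x y < ennreal e"
    using length_distance_small_near[OF assms] by metis
  have "riemannian_distance M metric x y < e" if "y \<in> U" for y
    using U(3)[OF that] assms(2) unfolding riemannian_distance_eq
    by (cases "length_distance x y") (auto simp: ennreal_less_iff)
  with U show ?thesis by (intro that) auto
qed

lemma increment_le_riemannian_distance:
  assumes G: "holomorphic_function M G" and "0 \<le> m"
    and le: "\<And>c q. c \<in> atlas M \<Longrightarrow> q \<in> fst c \<Longrightarrow> m * norm (differential G c q) \<le> sqrt (l c q)"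
    and xy: "x \<in> points M" "y \<in> points M"
  shows "m * norm (G x - G y) \<le> riemannian_distance M metric x y"
proof -
  have "ennreal (m * norm (G x - G y)) \<le> length_distance x y"
    unfolding length_distance_def
  proof (rule INF_greatest)
    fix \<gamma> assume "\<gamma> \<in> connecting_paths x y"
    then have \<gamma>: "surface_path M {0..1} \<gamma>" "\<gamma> 0 = x" "\<gamma> 1 = y" by (auto simp: connecting_paths_def)
    have "ennreal (m * norm (G (\<gamma> 1) - G (\<gamma> 0))) \<le> path_length M metric {0..1} \<gamma>"
    proof (rule increment_le_path_length[OF symmetric_2_tensor_metric \<gamma>(1) _ \<open>0 \<le> m\<close> G])
      fix c t v assume "c \<in> atlas M" "\<gamma> t \<in> fst c"
      from mult_right_mono[OF le[OF this], of "norm (v::complex)"]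
      show "m * (norm (differential G c (\<gamma> t)) * norm v) \<le> sqrt (metric c (\<gamma> t) v v)"
        unfolding sqrt_metric by (simp add: mult.assoc)
    qed simp
    then show "ennreal (m * norm (G x - G y)) \<le> path_length M metric {0..1} \<gamma>"
      using \<gamma> by (simp add: norm_minus_commute)
  qed
  then have "enn2real (ennreal (m * norm (G x - G y))) \<le> enn2real (length_distance x y)"
    by (rule enn2real_mono) (use length_distance_finite[OF xy] in simp)
  then show ?thesis using \<open>0 \<le> m\<close> by (simp add: riemannian_distance_eq)
qed

text \<open>A Cauchy sequence stays in a sublevel set of \<open>|G|\<close>, since \<open>G\<close> is Lipschitz. By compactness it
  accumulates at some point, and a Cauchy sequence converges to its accumulation points.\<close>

theorem complete_if_proper_lipschitz_function:
  assumes G: "holomorphic_function M G" and "0 < m"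
    and le: "\<And>c q. c \<in> atlas M \<Longrightarrow> q \<in> fst c \<Longrightarrow> m * norm (differential G c q) \<le> sqrt (l c q)"
    and proper: "\<And>R. compactin (stop M) {q \<in> points M. norm (G q) \<le> R}"
  shows "complete_riemannian_metric M metric"
  unfolding complete_riemannian_metric_def
proof (intro conjI riemannian_metric)
  let ?d = "riemannian_distance M metric"
  interpret D: Metric_space "points M" ?d by (rule Metric_space_riemannian_distance)
  show "D.mcomplete"
    unfolding D.mcomplete_def
  proof (intro allI impI)
    fix \<sigma> assume "D.MCauchy \<sigma>"
    then have \<sigma>: "\<And>n. \<sigma> n \<in> points M"
      and cauchy: "\<And>e. e > 0 \<Longrightarrow> \<exists>N. \<forall>n n'. N \<le> n \<longrightarrow> N \<le> n' \<longrightarrow> ?d (\<sigma> n) (\<sigma> n') < e"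
      unfolding D.MCauchy_def by auto
    obtain N where N: "\<And>n. N \<le> n \<Longrightarrow> ?d (\<sigma> n) (\<sigma> N) < 1" using cauchy[of 1] by auto
    \<comment> \<open>From the index \<open>N\<close> on, the sequence is within distance 1 of \<open>\<sigma> N\<close>, and \<open>G\<close> has Lipschitz constant \<open>1/m\<close>.\<close>
    define R where "R = norm (G (\<sigma> N)) + 1 / m"
    define K where "K = {q \<in> points M. norm (G q) \<le> R}"
    have inK: "\<sigma> n \<in> K" if "N \<le> n" for n
    proof -
      have "m * norm (G (\<sigma> n) - G (\<sigma> N)) \<le> ?d (\<sigma> n) (\<sigma> N)"
        using \<open>0 < m\<close> by (intro increment_le_riemannian_distance[OF G _ le]) (auto simp: \<sigma>)
      then have "m * norm (G (\<sigma> n) - G (\<sigma> N)) \<le> 1" using N[OF that] by simp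
      then have "norm (G (\<sigma> n) - G (\<sigma> N)) \<le> 1 / m" using \<open>0 < m\<close> by (simp add: field_simps)
      then have "norm (G (\<sigma> n)) \<le> R" unfolding R_def using norm_triangle_sub[of "G (\<sigma> n)" "G (\<sigma> N)"] by simp
      then show ?thesis using \<sigma> by (simp add: K_def)
    qed
    have "\<exists>x\<in>K. \<forall>U. openin (stop M) U \<and> x \<in> U \<longrightarrow> (\<forall>k. \<exists>n\<ge>k. \<sigma> n \<in> U)"
    proof (rule ccontr)
      assume neg: "\<not> (\<exists>x\<in>K. \<forall>U. openin (stop M) U \<and> x \<in> U \<longrightarrow> (\<forall>k. \<exists>n\<ge>k. \<sigma> n \<in> U))"
      have "\<forall>x\<in>K. \<exists>p. openin (stop M) (fst p) \<and> x \<in> fst p \<and> (\<forall>n\<ge>snd p. \<sigma> n \<notin> fst p)"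
        using neg by simp
      from bchoice[OF this] obtain f where f: "\<forall>x\<in>K. openin (stop M) (fst (f x)) \<and> x \<in> fst (f x) \<and>
          (\<forall>n\<ge>snd (f x). \<sigma> n \<notin> fst (f x))" ..
      define U k where "U x = fst (f x)" and "k x = snd (f x)" for x
      have U: "\<And>x. x \<in> K \<Longrightarrow> openin (stop M) (U x)" "\<And>x. x \<in> K \<Longrightarrow> x \<in> U x"
        "\<And>x n. x \<in> K \<Longrightarrow> k x \<le> n \<Longrightarrow> \<sigma> n \<notin> U x" using f by (auto simp: U_def k_def)
      have "compactin (stop M) K" unfolding K_def by (rule proper)
      then obtain \<F> where \<F>: "finite \<F>" "\<F> \<subseteq> U ` K" "K \<subseteq> \<Union>\<F>"
      proof (rule exE[OF compactinD[of "stop M" K "U ` K"]])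
        show "K \<subseteq> \<Union> (U ` K)" using U(2) by blast
      qed (use U(1) in auto)
      then obtain X where X: "finite X" "X \<subseteq> K" "\<F> = U ` X" by (meson finite_subset_image)
      define n where "n = Max (insert N (k ` X))"
      have "N \<le> n" "\<And>x. x \<in> X \<Longrightarrow> k x \<le> n" using X(1) by (auto simp: n_def)
      moreover obtain x where "x \<in> X" "\<sigma> n \<in> U x" using inK[OF \<open>N \<le> n\<close>] \<F>(3) X(3) by auto
      ultimately show False using U(3) X(2) by blast
    qed
    then obtain x where x: "x \<in> K" "\<And>U k. openin (stop M) U \<Longrightarrow> x \<in> U \<Longrightarrow> \<exists>n\<ge>k. \<sigma> n \<in> U" by blast
    have xM: "x \<in> points M" using x(1) by (simp add: K_def)
    have "limitin D.mtopology \<sigma> x sequentially"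
      unfolding D.limitin_metric
    proof (intro conjI xM allI impI)
      fix e :: real assume "e > 0"
      obtain k where k: "\<And>n n'. k \<le> n \<Longrightarrow> k \<le> n' \<Longrightarrow> ?d (\<sigma> n) (\<sigma> n') < e / 2"
        using cauchy[of "e/2"] \<open>e > 0\<close> by auto
      obtain U where U: "openin (stop M) U" "x \<in> U" "\<And>y. y \<in> U \<Longrightarrow> ?d x y < e / 2"
        using riemannian_distance_small_near[OF xM, of "e/2"] \<open>e > 0\<close> by (metis half_gt_zero)
      obtain n where n: "k \<le> n" "\<sigma> n \<in> U" using x(2)[OF U(1,2)] by blast
      have "\<sigma> j \<in> points M \<and> ?d (\<sigma> j) x < e" if "k \<le> j" for j
      proof -
        have "?d (\<sigma> j) x \<le> ?d (\<sigma> j) (\<sigma> n) + ?d (\<sigma> n) x" by (intro D.triangle \<sigma> xM)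
        then show ?thesis using k[OF that n(1)] U(3)[OF n(2)] \<sigma> by (simp add: D.commute[of x])
      qed
      then show "\<forall>\<^sub>F j in sequentially. \<sigma> j \<in> points M \<and> ?d (\<sigma> j) x < e"
        by (auto simp: eventually_sequentially)
    qed
    then show "\<exists>x. limitin D.mtopology \<sigma> x sequentially" by blast
  qed
qed

end

section \<open>Smooth functions and cutoffs\<close>

lemma Ck_on_cong:
  assumes "open S" "\<And>z. z \<in> S \<Longrightarrow> f z = g z"
  shows "Ck_on k f S \<longleftrightarrow> Ck_on k g S"
  using assms(2)
proof (induction k arbitrary: f g)
  case 0
  then show ?case by (simp cong: continuous_on_cong)
next
  case (Suc k)
  have D: "(f has_derivative f') (at z) \<longleftrightarrow> (g has_derivative f') (at z)" if "z \<in> S" for z f'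
    using Suc.prems that has_derivative_transform_within_open[OF _ assms(1)] by metis
  then have d: "f differentiable (at z) \<longleftrightarrow> g differentiable (at z)" if "z \<in> S" for z
    using that unfolding differentiable_def by blast
  have "frechet_derivative f (at z) = frechet_derivative g (at z)" if "z \<in> S" for z
    using D[OF that] unfolding frechet_derivative_def by simp
  then have "Ck_on k (\<lambda>z. frechet_derivative f (at z) v) S \<longleftrightarrow> Ck_on k (\<lambda>z. frechet_derivative g (at z) v) S" for v
    by (intro Suc.IH) simp
  then show ?case using d by simp
qed

lemma Ck_on_SucI:
  assumes "open S" "\<And>z. z \<in> S \<Longrightarrow> (f has_derivative f' z) (at z)" "\<And>v. Ck_on k (\<lambda>z. f' z v) S"
  shows "Ck_on (Suc k) f S"
proof -
  have "Ck_on k (\<lambda>z. frechet_derivative f (at z) v) S" for v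
    using assms(3)[of v] by (rule Ck_on_cong[OF assms(1), THEN iffD1, rotated]) (use assms(2) frechet_derivative_at in metis)
  then show ?thesis using assms(2) by (auto simp: differentiable_def)
qed

lemma Ck_on_SucD:
  assumes "Ck_on (Suc k) f S"
  shows "Ck_on k f S"
  using assms
proof (induction k arbitrary: f)
  case 0
  then show ?case by (auto simp: continuous_at_imp_continuous_on differentiable_imp_continuous_within)
next
  case (Suc k)
  then show ?case by (metis Ck_on.simps(2))
qed

lemma Ck_on_Suc_has_derivative:
  "Ck_on (Suc k) f S \<Longrightarrow> z \<in> S \<Longrightarrow> (f has_derivative frechet_derivative f (at z)) (at z)"
  using frechet_derivative_works by auto

lemma Ck_on_frechet_derivative: "Ck_on (Suc k) f S \<Longrightarrow> Ck_on k (\<lambda>z. frechet_derivative f (at z) v) S"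
  by simp

lemma Ck_on_const: "Ck_on k (\<lambda>z. a) S"
  by (induction k arbitrary: a) (auto simp: frechet_derivative_const)

lemma Ck_on_add:
  assumes "open S" "Ck_on k f S" "Ck_on k g S"
  shows "Ck_on k (\<lambda>z. f z + g z) S"
  using assms(2,3)
proof (induction k arbitrary: f g)
  case 0
  then show ?case by (auto intro: continuous_intros)
next
  case (Suc k)
  define f' where "f' z = frechet_derivative f (at z)" for z
  have f: "\<And>z. z \<in> S \<Longrightarrow> (f has_derivative f' z) (at z)" "\<And>v. Ck_on k (\<lambda>z. f' z v) S"
    unfolding f'_def by (fact Ck_on_Suc_has_derivative[OF Suc.prems(1)], fact Ck_on_frechet_derivative[OF Suc.prems(1)])
  define g' where "g' z = frechet_derivative g (at z)" for z
  have g: "\<And>z. z \<in> S \<Longrightarrow> (g has_derivative g' z) (at z)" "\<And>v. Ck_on k (\<lambda>z. g' z v) S"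
    unfolding g'_def by (fact Ck_on_Suc_has_derivative[OF Suc.prems(2)], fact Ck_on_frechet_derivative[OF Suc.prems(2)])
  show ?case
    by (rule Ck_on_SucI[OF assms(1), where f'="\<lambda>z v. f' z v + g' z v"])
       (use f g in \<open>auto intro!: has_derivative_add Suc.IH\<close>)
qed

lemma Ck_on_mult:
  assumes "open S" "Ck_on k f S" "Ck_on k g S"
  shows "Ck_on k (\<lambda>z. f z * g z) S"
  using assms(2,3)
proof (induction k arbitrary: f g)
  case 0
  then show ?case by (auto intro: continuous_intros)
next
  case (Suc k)
  define f' where "f' z = frechet_derivative f (at z)" for z
  have f: "\<And>z. z \<in> S \<Longrightarrow> (f has_derivative f' z) (at z)" "\<And>v. Ck_on k (\<lambda>z. f' z v) S"
    unfolding f'_def by (fact Ck_on_Suc_has_derivative[OF Suc.prems(1)], fact Ck_on_frechet_derivative[OF Suc.prems(1)])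
  define g' where "g' z = frechet_derivative g (at z)" for z
  have g: "\<And>z. z \<in> S \<Longrightarrow> (g has_derivative g' z) (at z)" "\<And>v. Ck_on k (\<lambda>z. g' z v) S"
    unfolding g'_def by (fact Ck_on_Suc_has_derivative[OF Suc.prems(2)], fact Ck_on_frechet_derivative[OF Suc.prems(2)])
  have "Ck_on k (\<lambda>z. f z * g' z v + f' z v * g z) S" for v
    using f g Suc.prems by (intro Ck_on_add[OF assms(1)] Suc.IH Ck_on_SucD[of k f] Ck_on_SucD[of k g])
  then show ?case
    by (intro Ck_on_SucI[OF assms(1), where f'="\<lambda>z v. f z * g' z v + f' z v * g z"])
       (use f g in \<open>auto intro!: has_derivative_mult\<close>)
qed

lemma Ck_on_Re_holomorphic:
  assumes "open S" "f holomorphic_on S"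
  shows "Ck_on k (\<lambda>z. Re (f z)) S"
  using assms(2)
proof (induction k arbitrary: f)
  case 0
  then show ?case by (auto intro!: continuous_intros holomorphic_on_imp_continuous_on)
next
  case (Suc k)
  show ?case
  proof (rule Ck_on_SucI[OF assms(1)])
    fix z assume "z \<in> S"
    then have "(f has_derivative (\<lambda>v. deriv f z * v)) (at z)"
      using holomorphic_derivI[OF Suc.prems assms(1)] by (auto simp: has_field_derivative_def)
    then show "((\<lambda>z. Re (f z)) has_derivative (\<lambda>v. Re (deriv f z * v))) (at z)"
      by (rule has_derivative_Re)
  next
    show "Ck_on k (\<lambda>z. Re (deriv f z * v)) S" for v
      using Suc.prems assms(1) by (intro Suc.IH holomorphic_intros)
  qed
qed

lemma Ck_on_cmod_square:
  assumes "open S" "f holomorphic_on S"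
  shows "Ck_on k (\<lambda>z. (norm (f z))\<^sup>2) S"
proof -
  have "Ck_on k (\<lambda>z. Re (f z) * Re (f z) + Re (\<i> * f z) * Re (\<i> * f z)) S"
    using assms by (intro Ck_on_add Ck_on_mult Ck_on_Re_holomorphic holomorphic_intros)
  then show ?thesis unfolding cmod_power2 by (simp add: power2_eq_square)
qed

text \<open>A smooth function of one real variable is represented by a family that contains it together with all its
  derivatives.\<close>

lemma Ck_on_compose:
  assumes "open S" and \<D>: "\<And>\<psi>. \<psi> \<in> \<D> \<Longrightarrow> \<exists>\<psi>'\<in>\<D>. \<forall>x. (\<psi> has_real_derivative \<psi>' x) (at x)"
    and "\<psi> \<in> \<D>" "Ck_on k f S"
  shows "Ck_on k (\<lambda>z. \<psi> (f z)) S"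
  using assms(3,4)
proof (induction k arbitrary: \<psi>)
  case 0
  obtain \<psi>' where "\<forall>x. (\<psi> has_real_derivative \<psi>' x) (at x)" using \<D>[OF 0(1)] by blast
  then have "continuous_on UNIV \<psi>" using DERIV_isCont continuous_at_imp_continuous_on by blast
  then show ?case using 0(2) continuous_on_compose2[of UNIV \<psi> S f] by simp
next
  case (Suc k)
  obtain \<psi>' where \<psi>': "\<psi>' \<in> \<D>" "\<forall>x. (\<psi> has_real_derivative \<psi>' x) (at x)" using \<D>[OF Suc.prems(1)] by blast
  define f' where "f' z = frechet_derivative f (at z)" for z
  have f: "\<And>z. z \<in> S \<Longrightarrow> (f has_derivative f' z) (at z)" "\<And>v. Ck_on k (\<lambda>z. f' z v) S"
    unfolding f'_def by (fact Ck_on_Suc_has_derivative[OF Suc.prems(2)], fact Ck_on_frechet_derivative[OF Suc.prems(2)])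
  show ?case
  proof (rule Ck_on_SucI[OF assms(1)])
    fix z assume "z \<in> S"
    from f(1)[OF this]
    show "((\<lambda>z. \<psi> (f z)) has_derivative (\<lambda>v. \<psi>' (f z) * f' z v)) (at z)"
      using \<psi>'(2) has_derivative_compose[of f "f' z" z UNIV \<psi>] by (auto simp: has_field_derivative_def)
  next
    show "Ck_on k (\<lambda>z. \<psi>' (f z) * f' z v) S" for v
      by (rule Ck_on_mult[OF assms(1) Suc.IH[OF \<psi>'(1) Ck_on_SucD[OF Suc.prems(2)]] f(2)])
  qed
qed

text \<open>The functions \<open>P(1/x) e\<^sup>-\<^sup>1\<^sup>/\<^sup>x\<close> for \<open>x > 0\<close>, continued by 0.\<close>

definition flat :: "real poly \<Rightarrow> real \<Rightarrow> real" where
  "flat P x = (if x > 0 then poly P (1 / x) * exp (- (1 / x)) else 0)"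

lemma poly_times_exp_minus_tendsto_0: "((\<lambda>t. poly P t * exp (- t)) \<longlongrightarrow> 0) (at_top :: real filter)"
proof -
  have "((\<lambda>t. \<Sum>i\<le>degree P. coeff P i * (t ^ i / exp t)) \<longlongrightarrow> (\<Sum>i\<le>degree P. coeff P i * 0)) at_top"
    by (intro tendsto_sum tendsto_mult tendsto_const tendsto_power_div_exp_0)
  then show ?thesis
    by (simp add: poly_altdef sum_distrib_right exp_minus divide_inverse mult.assoc)
qed

text \<open>With \<open>t = 1/x\<close> the chain rule gives \<open>(P(t) e\<^sup>-\<^sup>t)' = t\<^sup>2 (P(t) - P'(t)) e\<^sup>-\<^sup>t\<close>, so the family is
  closed under differentiation, and all its members vanish to infinite order at 0.\<close>

lemma has_real_derivative_flat:
  "(flat P has_real_derivative flat (monom 1 2 * (P - pderiv P)) x) (at x)"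
proof -
  let ?Q = "monom 1 2 * (P - pderiv P)"
  consider "x > 0" | "x < 0" | "x = 0" by linarith
  then show ?thesis
  proof cases
    case 1
    have "((\<lambda>x. poly P (1 / x) * exp (- (1 / x))) has_real_derivative
        (poly (pderiv P) (1/x) * (- (1 / x\<^sup>2)) * exp (- (1/x)) + poly P (1/x) * (exp (- (1/x)) * (1 / x\<^sup>2)))) (at x)"
      using 1 by (auto intro!: derivative_eq_intros DERIV_chain2[OF poly_DERIV] simp: power2_eq_square field_simps)
    then have "((\<lambda>x. poly P (1 / x) * exp (- (1 / x))) has_real_derivative flat ?Q x) (at x)"
      by (rule back_subst[of "\<lambda>d. (_ has_real_derivative d) (at x)"])
         (use 1 in \<open>simp add: flat_def poly_monom power_one_over algebra_simps\<close>)
    then show ?thesis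
      by (rule has_field_derivative_transform_within_open[of _ _ _ "{0<..}"]) (use 1 in \<open>auto simp: flat_def\<close>)
  next
    case 2
    have "((\<lambda>x. 0) has_real_derivative flat ?Q x) (at x)" using 2 by (simp add: flat_def)
    then show ?thesis
      by (rule has_field_derivative_transform_within_open[of _ _ _ "{..<0}"]) (use 2 in \<open>auto simp: flat_def\<close>)
  next
    case 3
    have "((\<lambda>h. flat P h / h) \<longlongrightarrow> 0) (at_right 0)"
    proof (rule Lim_transform_eventually)
      have "((\<lambda>h. poly (pCons 0 P) (inverse h) * exp (- inverse h)) \<longlongrightarrow> 0) (at_right (0::real))"
        by (rule filterlim_compose[OF poly_times_exp_minus_tendsto_0 filterlim_inverse_at_top_right])
      then show "((\<lambda>h. poly (pCons 0 P) (inverse h) * exp (- inverse h)) \<longlongrightarrow> 0) (at_right (0::real))" .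
      show "\<forall>\<^sub>F h in at_right 0. poly (pCons 0 P) (inverse h) * exp (- inverse h) = flat P h / h"
        using eventually_at_right_less[of 0] by eventually_elim (simp add: flat_def field_simps)
    qed
    moreover have "((\<lambda>h. flat P h / h) \<longlongrightarrow> 0) (at_left 0)"
    proof (rule Lim_transform_eventually)
      show "\<forall>\<^sub>F h in at_left 0. 0 = flat P h / h"
        by (auto simp: eventually_at_filter flat_def)
    qed simp
    ultimately have "((\<lambda>h. flat P h / h) \<longlongrightarrow> 0) (at 0)" by (simp add: filterlim_split_at)
    then show ?thesis using 3 by (simp add: DERIV_def flat_def)
  qed
qed

lemma Ck_on_flat:
  assumes "open S" "Ck_on k f S"
  shows "Ck_on k (\<lambda>z. flat P (f z)) S"
  by (rule Ck_on_compose[OF assms(1), of "range flat"])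
     (use has_real_derivative_flat assms(2) in auto)

section \<open>Removing finitely many points\<close>

context riemann_surface
begin

text \<open>A punctured disc around \<open>e\<close> is connected, so it lies on one side of any separation of \<open>A - {e}\<close>. Adding \<open>e\<close> to that
  side gives a separation of \<open>A\<close>.\<close>

lemma connectedin_remove_point:
  assumes A: "openin (stop M) A" "connectedin (stop M) A" and "e \<in> A"
  shows "connectedin (stop M) (A - {e})"
proof -
  have e: "e \<in> points M" using assms openin_subset by blast
  define c where "c = some_chart M e"
  have c: "c \<in> atlas M" "e \<in> fst c" using some_chart[OF e] by (auto simp: c_def)
  have "open (snd c ` (fst c \<inter> A))" by (rule open_chart_overlap[OF c(1) A(1)])
  then obtain r where r: "0 < r" "ball (snd c e) r \<subseteq> snd c ` (fst c \<inter> A)"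
    using c \<open>e \<in> A\<close> open_contains_ball by (metis IntI image_eqI)
  have sub: "ball (snd c e) r \<subseteq> chart_image c" using r(2) by blast
  define V where "V = param c ` ball (snd c e) r"
  have V: "openin (stop M) V" unfolding V_def by (rule openin_param_image[OF c(1) _ sub]) simp
  have "e \<in> V" unfolding V_def using c r(1) by (metis centre_in_ball image_eqI param_chart)
  have VA: "V \<subseteq> A" unfolding V_def using r(2) c(1) by (force simp: subset_iff)
  have Ve: "V - {e} = param c ` (ball (snd c e) r - {snd c e})"
  proof
    show "V - {e} \<subseteq> param c ` (ball (snd c e) r - {snd c e})"
      unfolding V_def using c by auto
    show "param c ` (ball (snd c e) r - {snd c e}) \<subseteq> V - {e}"
    proof
      fix q assume "q \<in> param c ` (ball (snd c e) r - {snd c e})"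
      then obtain z where z: "z \<in> ball (snd c e) r" "z \<noteq> snd c e" "q = param c z" by blast
      then have "snd c q = z" using sub by auto
      then show "q \<in> V - {e}" using z unfolding V_def by blast
    qed
  qed
  have "connectedin (top_of_set (chart_image c)) (ball (snd c e) r - {snd c e})"
    using sub connected_punctured_ball[of "snd c e" r] by (auto simp: connectedin_subtopology)
  then have conn: "connectedin (stop M) (V - {e})"
    unfolding Ve by (rule connectedin_continuous_map_image[OF continuous_map_param[OF c(1)]])
  show ?thesis
    unfolding connectedin
  proof (intro conjI notI)
    show "A - {e} \<subseteq> points M" using openin_subset[OF A(1)] by blast
    assume "\<exists>P Q. openin (stop M) P \<and> openin (stop M) Q \<and> A - {e} \<subseteq> P \<union> Q \<and>
        P \<inter> Q \<inter> (A - {e}) = {} \<and> P \<inter> (A - {e}) \<noteq> {} \<and> Q \<inter> (A - {e}) \<noteq> {}"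
    then obtain P Q where PQ: "openin (stop M) P" "openin (stop M) Q" "A - {e} \<subseteq> P \<union> Q"
        "P \<inter> Q \<inter> (A - {e}) = {}" "P \<inter> (A - {e}) \<noteq> {}" "Q \<inter> (A - {e}) \<noteq> {}" by blast
    have Ae: "openin (stop M) (A - {e})"
      using connected_riemann_surface A(1)
      by (intro open_in_Hausdorff_delete) (auto simp: connected_riemann_surface_def)
    have absurd: False if P: "openin (stop M) P" "openin (stop M) Q" "A - {e} \<subseteq> P \<union> Q"
        "P \<inter> Q \<inter> (A - {e}) = {}" "P \<inter> (A - {e}) \<noteq> {}" "Q \<inter> (A - {e}) \<noteq> {}"
        and VP: "Q \<inter> (V - {e}) = {}" for P Q
    proof -
      have "openin (stop M) (P \<inter> (A - {e}) \<union> V)" "openin (stop M) (Q \<inter> (A - {e}))"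
        using P(1,2) Ae V by auto
      moreover have "A \<subseteq> (P \<inter> (A - {e}) \<union> V) \<union> Q \<inter> (A - {e})" using P(3) \<open>e \<in> V\<close> by blast
      moreover have "(P \<inter> (A - {e}) \<union> V) \<inter> (Q \<inter> (A - {e})) \<inter> A = {}" using P(4) VP by blast
      ultimately show False using P(5,6) A(2) unfolding connectedin by blast
    qed
    have "P \<inter> (V - {e}) = {} \<or> Q \<inter> (V - {e}) = {}"
    proof (rule ccontr)
      assume "\<not> (P \<inter> (V - {e}) = {} \<or> Q \<inter> (V - {e}) = {})"
      moreover have "V - {e} \<subseteq> P \<union> Q" "P \<inter> Q \<inter> (V - {e}) = {}" using PQ(3,4) VA by blast+
      ultimately show False using conn PQ(1,2) unfolding connectedin by blast
    qed
    then show False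
    proof
      assume "P \<inter> (V - {e}) = {}"
      then show False using absurd[of Q P] PQ by (auto simp: Un_commute Int_commute)
    next
      assume "Q \<inter> (V - {e}) = {}"
      then show False using absurd[of P Q] PQ by auto
    qed
  qed
qed

lemma openin_remove_finite:
  assumes "finite E" shows "openin (stop M) (points M - E)"
proof -
  have "closedin (stop M) (points M \<inter> E)"
    using connected_riemann_surface assms
    by (intro closedin_Hausdorff_finite) (auto simp: connected_riemann_surface_def)
  then have "openin (stop M) (points M - points M \<inter> E)" by (rule openin_diff[OF openin_topspace])
  then show ?thesis by (simp add: Diff_Int_distrib Diff_Int)
qed

lemma connectedin_remove_finite:
  assumes "finite E" shows "connectedin (stop M) (points M - E)"
  using assms
proof (induction E rule: finite_induct)
  case empty
  then show ?case
    using connected_riemann_surface by (simp add: connected_riemann_surface_def connectedin_topspace)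
next
  case (insert e E)
  show ?case
  proof (cases "e \<in> points M")
    case True
    have "connectedin (stop M) ((points M - E) - {e})"
      using insert True by (intro connectedin_remove_point openin_remove_finite) auto
    then show ?thesis by (metis Diff_insert)
  next
    case False
    then have "points M - insert e E = points M - E" by blast
    then show ?thesis using insert.IH by simp
  qed
qed

lemma puncture_nonempty:
  assumes "finite E" shows "points M - E \<noteq> {}"
proof
  assume "points M - E = {}"
  then have fin: "finite (points M)" using assms by (metis Diff_eq_empty_iff finite_subset)
  obtain q where q: "q \<in> points M"
    using connected_riemann_surface unfolding connected_riemann_surface_def by blast
  have "finite (chart_image (some_chart M q))"
    using some_chart[OF q] chart_subset fin by (meson finite_imageI finite_subset)
  then show False
    using open_chart_image some_chart[OF q] by (metis empty_iff finite_imp_not_open imageI)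
qed

lemma param_subchart:
  assumes "c \<in> atlas M" "fst c' \<subseteq> fst c" "snd c' = snd c" "z \<in> chart_image c'"
  shows "param c' z = param c z"
proof -
  obtain q where q: "q \<in> fst c'" "z = snd c q" using assms by auto
  have "inj_on (snd c) (fst c')" using chart_inj[OF assms(1)] assms(2) inj_on_subset by blast
  then have "param c' z = q" using q assms(3) by simp
  then show ?thesis using q assms(1,2) by auto
qed

lemma connected_riemann_surface_puncture:
  assumes "finite E"
  shows "connected_riemann_surface (puncture M E)"
  unfolding connected_riemann_surface_def
proof (intro conjI ballI)
  have top: "points (puncture M E) = points M - E"
    by (auto simp: puncture_def)
  show "points (puncture M E) \<noteq> {}" using puncture_nonempty[OF assms] top by simp
  show "connected_space (stop (puncture M E))"
    using connectedin_remove_finite[OF assms] by (simp add: puncture_def connectedin_def)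
  show "Hausdorff_space (stop (puncture M E))"
    using connected_riemann_surface
    by (simp add: puncture_def connected_riemann_surface_def Hausdorff_space_subtopology)
  show "\<Union> (fst ` atlas (puncture M E)) = points (puncture M E)"
    using connected_riemann_surface unfolding top
    by (auto simp: puncture_def connected_riemann_surface_def)
  have sub: "openin (stop M) (fst c - E)" if "c \<in> atlas M" for c
  proof -
    have "fst c - E = fst c \<inter> (points M - E)" using chart_subset[OF that] by blast
    then show ?thesis using openin_chart[OF that] openin_remove_finite[OF assms] by auto
  qed
  show "is_chart (stop (puncture M E)) c'" if c': "c' \<in> atlas (puncture M E)" for c'
  proof -
    obtain c where c: "c \<in> atlas M" "fst c' = fst c - E" "snd c' = snd c"
      using c' by (auto simp: puncture_def)
    have "openin (stop (puncture M E)) (fst c')"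
      using sub[OF c(1)] chart_subset[OF c(1)]
      by (auto simp: puncture_def c openin_subtopology intro!: exI[of _ "fst c - E"])
    moreover have "open (chart_image c')"
      using open_chart_overlap[OF c(1) sub[OF c(1)]] by (simp add: c Int_absorb1 Diff_subset)
    moreover have "homeomorphic_map (subtopology (stop (puncture M E)) (fst c')) (top_of_set (chart_image c')) (snd c')"
    proof -
      have "subtopology (stop (puncture M E)) (fst c') = subtopology (subtopology (stop M) (fst c)) (fst c')"
      proof -
        have "(points M - E) \<inter> (fst c - E) = fst c - E" "fst c \<inter> (fst c - E) = fst c - E"
          using chart_subset[OF c(1)] by blast+
        then show ?thesis by (simp only: puncture_def surface.select_convs subtopology_subtopology c(2))
      qed
      moreover have "top_of_set (chart_image c') = subtopology (top_of_set (chart_image c)) (chart_image c')"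
      proof -
        have "chart_image c \<inter> chart_image c' = chart_image c'" using c by auto
        then show ?thesis by (simp only: subtopology_subtopology)
      qed
      moreover have "homeomorphic_map (subtopology (subtopology (stop M) (fst c)) (fst c'))
          (subtopology (top_of_set (chart_image c)) (chart_image c')) (snd c)"
      proof (rule homeomorphic_map_subtopologies[OF homeomorphic_map_chart[OF c(1)]])
        have "topspace (subtopology (stop M) (fst c)) \<inter> fst c' = fst c'"
          using chart_subset[OF c(1)] c(2) by auto
        moreover have "topspace (top_of_set (chart_image c)) \<inter> chart_image c' = chart_image c'"
          using c by auto
        ultimately show "snd c ` (topspace (subtopology (stop M) (fst c)) \<inter> fst c') =
            topspace (top_of_set (chart_image c)) \<inter> chart_image c'" by (simp only: c(3))
      qed
      ultimately show ?thesis by (simp add: c(3))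
    qed
    ultimately show ?thesis by (simp add: is_chart_def)
  qed
  show "transition c' d' holomorphic_on snd c' ` (fst c' \<inter> fst d')"
    if c': "c' \<in> atlas (puncture M E)" and d': "d' \<in> atlas (puncture M E)" for c' d'
  proof -
    obtain c where c: "c \<in> atlas M" "fst c' = fst c - E" "snd c' = snd c"
      using c' by (auto simp: puncture_def)
    obtain d where d: "d \<in> atlas M" "fst d' = fst d - E" "snd d' = snd d"
      using d' by (auto simp: puncture_def)
    have "transition c d holomorphic_on snd c' ` (fst c' \<inter> fst d')"
      by (rule holomorphic_on_subset[OF transition_holomorphic[OF c(1) d(1)]]) (use c d in auto)
    then show ?thesis
    proof (rule holomorphic_transform)
      fix z assume "z \<in> snd c' ` (fst c' \<inter> fst d')"
      then show "transition c d z = transition c' d' z"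
        using param_subchart[OF c(1), of c' z] c d by (auto simp: transition_def)
    qed
  qed
qed

end

section \<open>Enneper's maximal surface along a holomorphic function\<close>

lemma holomorphic_form_cong:
  assumes "\<And>c q. c \<in> atlas M \<Longrightarrow> q \<in> fst c \<Longrightarrow> \<omega> c q = \<omega>' c q"
  shows "holomorphic_form M \<omega> \<longleftrightarrow> holomorphic_form M \<omega>'"
proof -
  have hol: "(\<omega> c \<circ> param c) holomorphic_on chart_image c \<longleftrightarrow> (\<omega>' c \<circ> param c) holomorphic_on chart_image c"
    if "c \<in> atlas M" for c
    by (rule holomorphic_cong) (use assms[OF that] inv_into_into[of _ "snd c" "fst c"] in auto)
  have "(\<forall>c\<in>atlas M. \<forall>d\<in>atlas M. \<forall>q \<in> fst c \<inter> fst d. \<omega> c q = \<omega> d q * deriv (transition c d) (snd c q))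
      \<longleftrightarrow> (\<forall>c\<in>atlas M. \<forall>d\<in>atlas M. \<forall>q \<in> fst c \<inter> fst d. \<omega>' c q = \<omega>' d q * deriv (transition c d) (snd c q))"
    by (intro ball_cong refl) (use assms in auto)
  then show ?thesis unfolding holomorphic_form_def using hol by simp
qed

lemma inner_mult_left_complex: "(a * u) \<bullet> (a * v) = (norm a)\<^sup>2 * (u \<bullet> (v :: complex))"
  by (simp add: inner_complex_def cmod_power2) (simp add: power2_eq_square algebra_simps)

text \<open>A multiple of the inner product is a tensor when its factor scales with the square of the derivative of the
  coordinate change, since complex multiplication by \<open>a\<close> is \<open>|a|\<close> times an isometry.\<close>

lemma conformal_symmetric_2_tensor:
  assumes open_image: "\<And>c. c \<in> atlas M \<Longrightarrow> open (chart_image c)"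
    and T: "\<And>c q u v. c \<in> atlas M \<Longrightarrow> q \<in> fst c \<Longrightarrow> T c q u v = l c q * (u \<bullet> v)"
    and smooth: "\<And>c k. c \<in> atlas M \<Longrightarrow> Ck_on k (\<lambda>z. l c (param c z)) (chart_image c)"
    and transform: "\<And>c d q. c \<in> atlas M \<Longrightarrow> d \<in> atlas M \<Longrightarrow> q \<in> fst c \<inter> fst d \<Longrightarrow>
      l c q = l d q * (norm (deriv (transition c d) (snd c q)))\<^sup>2"
  shows "symmetric_2_tensor M T"
  unfolding symmetric_2_tensor_def
proof (intro conjI ballI allI)
  fix c q assume cq: "c \<in> atlas M" "q \<in> fst c"
  have "T c q = (\<lambda>u v. l c q * (u \<bullet> v))" using T[OF cq] by blast
  then show "bilinear (T c q)"
    by (auto simp: bilinear_def algebra_simps inner_simps intro!: linearI)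
  show "T c q u v = T c q v u" for u v by (simp add: T[OF cq] inner_commute)
next
  fix c and u v :: complex assume c: "c \<in> atlas M"
  have "Ck_on k (\<lambda>z. l c (param c z) * (u \<bullet> v)) (chart_image c)" for k
    by (rule Ck_on_mult[OF open_image[OF c] smooth[OF c] Ck_on_const])
  moreover have "Ck_on k (\<lambda>z. l c (param c z) * (u \<bullet> v)) (chart_image c) \<longleftrightarrow>
      Ck_on k (\<lambda>z. T c (param c z) u v) (chart_image c)" for k
    by (rule Ck_on_cong[OF open_image[OF c]]) (simp add: T[OF c inv_into_into])
  ultimately show "smooth_on (\<lambda>z. T c (param c z) u v) (chart_image c)" by (simp add: smooth_on_def)
next
  fix c d q u v assume *: "c \<in> atlas M" "d \<in> atlas M" "q \<in> fst c \<inter> fst d"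
  then show "T c q u v = T d q (deriv (transition c d) (snd c q) * u) (deriv (transition c d) (snd c q) * v)"
    using transform[OF *] by (simp add: T inner_mult_left_complex)
qed

text \<open>Enneper's maximal surface, the real part of the integral of \<open>((1 + z\<^sup>2)/2, i(1 - z\<^sup>2)/2, z) dz\<close>.\<close>

definition enneper :: "complex \<Rightarrow> real^3" where
  "enneper z = vector [Re (1/2 * (z + z ^ 3 / 3)), Re (\<i>/2 * (z - z ^ 3 / 3)), Re (z\<^sup>2 / 2)]"

context riemann_surface
begin

lemma form_mult_eq:
  assumes "c \<in> atlas M" "q \<in> fst c" "(\<eta> c \<circ> param c) holomorphic_on chart_image c"
    and "\<forall>\<^sub>F z in at (snd c q). f (param c z) * \<omega> c (param c z) = \<eta> c (param c z)"
  shows "form_mult f \<omega> c q = \<eta> c q"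
proof -
  have "(\<eta> c \<circ> param c) analytic_on {snd c q}"
    unfolding analytic_at
    by (intro exI[of _ "chart_image c"] conjI open_chart_image assms(1,3)) (use assms(2) in auto)
  then have "remove_sings (\<lambda>z. \<eta> c (param c z)) (snd c q) = \<eta> c (param c (snd c q))"
    by (simp add: o_def)
  moreover have "form_mult f \<omega> c q = remove_sings (\<lambda>z. \<eta> c (param c z)) (snd c q)"
    unfolding form_mult_def using assms(4) by (rule remove_sings_cong) simp
  ultimately show ?thesis using assms by simp
qed

lemma eventually_param_notin_finite:
  assumes "c \<in> atlas M" "q \<in> fst c" "finite Z"
  shows "\<forall>\<^sub>F z in at (snd c q). param c z \<in> fst c - Z"
proof -
  have fin: "finite (snd c ` (Z \<inter> fst c))" using assms by simp
  have "\<forall>\<^sub>F z in at (snd c q). z \<in> chart_image c"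
    using assms open_chart_image by (intro eventually_at_in_open') auto
  moreover have "\<forall>\<^sub>F z in at (snd c q). z \<in> - (snd c ` (Z \<inter> fst c) - {snd c q}) - {snd c q}"
    using fin by (intro eventually_at_in_open open_Compl finite_imp_closed) auto
  ultimately show ?thesis
  proof eventually_elim
    case (elim z)
    then have "snd c (param c z) = z" "param c z \<in> fst c" by (auto simp: param_in_chart)
    then show ?case using elim by (metis Compl_iff Diff_iff IntI image_eqI)
  qed
qed

lemma differential_compose:
  assumes G: "holomorphic_function M G" and c: "c \<in> atlas M" "q \<in> fst c"
    and f: "\<And>z. (f has_field_derivative f' z) (at z)"
  shows "differential (\<lambda>q. f (G q)) c q = f' (G q) * differential G c q"
proof -
  have "((f \<circ> (G \<circ> param c)) has_field_derivative f' ((G \<circ> param c) (snd c q)) * differential G c q) (at (snd c q))"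
    by (rule DERIV_chain[OF f has_field_derivative_differential[OF G c]])
  then show ?thesis unfolding differential_def using c by (intro DERIV_imp_deriv) (simp add: o_def)
qed

lemma holomorphic_function_compose:
  assumes G: "holomorphic_function M G" and f: "\<And>z. (f has_field_derivative f' z) (at z)"
  shows "holomorphic_function M (\<lambda>q. f (G q))"
proof -
  have f: "f holomorphic_on UNIV" using f by (auto simp: holomorphic_on_def field_differentiable_def intro: has_field_derivative_at_within)
  show ?thesis
    unfolding holomorphic_function_def
  proof
    fix c assume "c \<in> atlas M"
    then have "f \<circ> (G \<circ> param c) holomorphic_on chart_image c"
      using G f by (intro holomorphic_on_compose_gen[of _ _ f UNIV]) (auto simp: holomorphic_function_def)
    then show "((\<lambda>q. f (G q)) \<circ> param c) holomorphic_on chart_image c" by (simp add: o_def)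
  qed
qed

end

text \<open>For \<open>G\<close> holomorphic on all of \<open>M\<close>, the condition on the zeros makes \<open>1/G\<close> meaningful off a discrete set. A
  point with \<open>|G|\<close> different from 0 and 1 rules out \<open>G = 0\<close> and \<open>|G| = 1\<close> as identities.\<close>

locale enneper_data = riemann_surface M for M :: "'a surface" +
  fixes G :: "'a \<Rightarrow> complex"
  assumes G: "holomorphic_function M G" and finite_zeros: "finite {q \<in> points M. G q = 0}"
    and nonconstant: "\<exists>q\<in>points M. G q \<noteq> 0 \<and> norm (G q) \<noteq> 1"
begin

definition \<Omega> :: "'a form" where "\<Omega> c q = G q * differential G c q"

lemma differential_polynomials:
  assumes "c \<in> atlas M" "q \<in> fst c"
  shows "differential (\<lambda>q. (G q) ^ 3 / 3) c q = (G q)\<^sup>2 * differential G c q"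
    and "differential (\<lambda>q. (G q)\<^sup>2 / 2) c q = G q * differential G c q"
    and "differential (\<lambda>q. 1/2 * (G q + (G q) ^ 3 / 3)) c q = 1/2 * (differential G c q + (G q)\<^sup>2 * differential G c q)"
    and "differential (\<lambda>q. \<i>/2 * (G q - (G q) ^ 3 / 3)) c q = \<i>/2 * (differential G c q - (G q)\<^sup>2 * differential G c q)"
proof -
  show "differential (\<lambda>q. (G q) ^ 3 / 3) c q = (G q)\<^sup>2 * differential G c q"
    by (rule differential_compose[OF G assms, where f="\<lambda>z. z ^ 3 / 3" and f'="\<lambda>z. z\<^sup>2"]) (auto intro!: derivative_eq_intros)
  show "differential (\<lambda>q. (G q)\<^sup>2 / 2) c q = G q * differential G c q"
    by (rule differential_compose[OF G assms, where f="\<lambda>z. z\<^sup>2 / 2" and f'="\<lambda>z. z"]) (auto intro!: derivative_eq_intros)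
  have "differential (\<lambda>q. 1/2 * (G q + (G q) ^ 3 / 3)) c q = (1/2 * (1 + (G q)\<^sup>2)) * differential G c q"
    by (rule differential_compose[OF G assms, where f="\<lambda>z. 1/2 * (z + z ^ 3 / 3)" and f'="\<lambda>z. 1/2 * (1 + z\<^sup>2)"])
       (auto intro!: derivative_eq_intros)
  then show "differential (\<lambda>q. 1/2 * (G q + (G q) ^ 3 / 3)) c q = 1/2 * (differential G c q + (G q)\<^sup>2 * differential G c q)"
    by (simp add: algebra_simps)
  have "differential (\<lambda>q. \<i>/2 * (G q - (G q) ^ 3 / 3)) c q = (\<i>/2 * (1 - (G q)\<^sup>2)) * differential G c q"
    by (rule differential_compose[OF G assms, where f="\<lambda>z. \<i>/2 * (z - z ^ 3 / 3)" and f'="\<lambda>z. \<i>/2 * (1 - z\<^sup>2)"])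
       (auto intro!: derivative_eq_intros)
  then show "differential (\<lambda>q. \<i>/2 * (G q - (G q) ^ 3 / 3)) c q = \<i>/2 * (differential G c q - (G q)\<^sup>2 * differential G c q)"
    by (simp add: algebra_simps)
qed

lemma holomorphic_polynomials:
  "holomorphic_function M (\<lambda>q. (G q) ^ 3 / 3)" "holomorphic_function M (\<lambda>q. (G q)\<^sup>2 / 2)"
  "holomorphic_function M (\<lambda>q. 1/2 * (G q + (G q) ^ 3 / 3))" "holomorphic_function M (\<lambda>q. \<i>/2 * (G q - (G q) ^ 3 / 3))"
  by (rule holomorphic_function_compose[OF G, where f="\<lambda>z. z ^ 3 / 3" and f'="\<lambda>z. z\<^sup>2"]
      holomorphic_function_compose[OF G, where f="\<lambda>z. z\<^sup>2 / 2" and f'="\<lambda>z. z"]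
      holomorphic_function_compose[OF G, where f="\<lambda>z. 1/2 * (z + z ^ 3 / 3)" and f'="\<lambda>z. 1/2 * (1 + z\<^sup>2)"]
      holomorphic_function_compose[OF G, where f="\<lambda>z. \<i>/2 * (z - z ^ 3 / 3)" and f'="\<lambda>z. \<i>/2 * (1 - z\<^sup>2)"];
      (auto intro!: derivative_eq_intros)[])+

lemma g_form_eq:
  assumes "c \<in> atlas M" "q \<in> fst c" shows "g_form G \<Omega> c q = differential (\<lambda>q. (G q) ^ 3 / 3) c q"
proof (rule form_mult_eq[OF assms])
  show "(differential (\<lambda>q. (G q) ^ 3 / 3) c \<circ> param c) holomorphic_on chart_image c"
    using holomorphic_form_differential[OF holomorphic_polynomials(1)] assms by (auto simp: holomorphic_form_def)
  show "\<forall>\<^sub>F z in at (snd c q). G (param c z) * \<Omega> c (param c z) = differential (\<lambda>q. G q ^ 3 / 3) c (param c z)"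
    using eventually_param_notin_finite[OF assms finite.emptyI]
    by eventually_elim (use assms(1) in \<open>simp add: differential_polynomials \<Omega>_def power2_eq_square\<close>)
qed

text \<open>At a zero of \<open>G\<close> the quotient \<open>\<Omega>/G = dG\<close> has to be extended across a removable singularity.\<close>

lemma ginv_form_eq:
  assumes "c \<in> atlas M" "q \<in> fst c" shows "ginv_form G \<Omega> c q = differential G c q"
proof (rule form_mult_eq[OF assms])
  show "(differential G c \<circ> param c) holomorphic_on chart_image c"
    using holomorphic_form_differential[OF G] assms by (auto simp: holomorphic_form_def)
  show "\<forall>\<^sub>F z in at (snd c q). inverse (G (param c z)) * \<Omega> c (param c z) = differential G c (param c z)"
    using eventually_param_notin_finite[OF assms finite_zeros]
  proof eventually_elim
    case (elim z)
    then have "G (param c z) \<noteq> 0" using chart_subset[OF assms(1)] by auto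
    then show ?case by (simp add: \<Omega>_def)
  qed
qed

lemma \<Omega>_eq: "c \<in> atlas M \<Longrightarrow> q \<in> fst c \<Longrightarrow> \<Omega> c q = differential (\<lambda>q. (G q)\<^sup>2 / 2) c q"
  by (simp add: differential_polynomials \<Omega>_def)

lemma weierstrass_data: "weierstrass_data M G \<Omega>"
  unfolding weierstrass_data_def
proof (intro conjI allI impI connected_riemann_surface)
  show "meromorphic_function M G"
    unfolding meromorphic_function_def
  proof
    fix c assume c: "c \<in> atlas M"
    then have "(G \<circ> param c) analytic_on chart_image c"
      using G open_chart_image by (auto simp: holomorphic_function_def analytic_on_open)
    then show "(G \<circ> param c) nicely_meromorphic_on chart_image c"
      by (rule analytic_on_imp_nicely_meromorphic_on)
  qed
  show "\<exists>q\<in>points M. G q \<noteq> 0" "\<exists>q\<in>points M. norm (G q) \<noteq> 1" using nonconstant by auto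
  show "holomorphic_form M \<Omega>"
    using holomorphic_form_differential[OF holomorphic_polynomials(2)] \<Omega>_eq by (subst holomorphic_form_cong) auto
  show "holomorphic_form M (g_form G \<Omega>)"
    using holomorphic_form_differential[OF holomorphic_polynomials(1)] g_form_eq by (subst holomorphic_form_cong) auto
  show "holomorphic_form M (ginv_form G \<Omega>)"
    using holomorphic_form_differential[OF G] ginv_form_eq by (subst holomorphic_form_cong) auto
  fix \<gamma> assume "closed_loop M \<gamma>"
  then have \<gamma>: "surface_path M {0..1} \<gamma>" "\<gamma> 0 = \<gamma> 1" by (auto simp: closed_loop_def)
  have "form_integral M (g_form G \<Omega>) \<gamma> = 0"
    using form_integral_differential[OF holomorphic_polynomials(1) \<gamma>(1)]
      form_integral_cong[OF \<gamma>(1) g_form_eq] \<gamma>(2) by simp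
  moreover have "form_integral M (ginv_form G \<Omega>) \<gamma> = 0"
    using form_integral_differential[OF G \<gamma>(1)] form_integral_cong[OF \<gamma>(1) ginv_form_eq] \<gamma>(2) by simp
  ultimately show "form_integral M (g_form G \<Omega>) \<gamma> + cnj (form_integral M (ginv_form G \<Omega>) \<gamma>) = 0" by simp
  have "form_integral M \<Omega> \<gamma> = 0"
    using form_integral_differential[OF holomorphic_polynomials(2) \<gamma>(1)] form_integral_cong[OF \<gamma>(1) \<Omega>_eq] \<gamma>(2) by simp
  then show "Re (form_integral M \<Omega> \<gamma>) = 0" by simp
qed

lemma is_maximal_map: 
  assumes "z0 \<in> points M"
  shows "is_maximal_map M G \<Omega> (\<lambda>q. enneper (G q) - enneper (G z0))"
  unfolding is_maximal_map_def
proof (intro conjI weierstrass_data bexI[OF _ assms] allI impI)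
  fix \<gamma> assume "surface_path M {0..1} \<gamma> \<and> \<gamma> 0 = z0"
  then have \<gamma>: "surface_path M {0..1} \<gamma>" "\<gamma> 0 = z0" by auto
  have 1: "form_integral M (\<lambda>c q. 1/2 * (ginv_form G \<Omega> c q + g_form G \<Omega> c q)) \<gamma> =
      form_integral M (differential (\<lambda>q. 1/2 * (G q + (G q) ^ 3 / 3))) \<gamma>"
    by (rule form_integral_cong[OF \<gamma>(1)]) (simp only: differential_polynomials g_form_eq ginv_form_eq)
  have 2: "form_integral M (\<lambda>c q. \<i>/2 * (ginv_form G \<Omega> c q - g_form G \<Omega> c q)) \<gamma> =
      form_integral M (differential (\<lambda>q. \<i>/2 * (G q - (G q) ^ 3 / 3))) \<gamma>"
    by (rule form_integral_cong[OF \<gamma>(1)]) (simp only: differential_polynomials g_form_eq ginv_form_eq)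
  have 3: "form_integral M \<Omega> \<gamma> = form_integral M (differential (\<lambda>q. (G q)\<^sup>2 / 2)) \<gamma>"
    by (rule form_integral_cong[OF \<gamma>(1) \<Omega>_eq])
  show "enneper (G (\<gamma> 1)) - enneper (G z0) = vector
      [Re (form_integral M (\<lambda>c q. 1/2 * (ginv_form G \<Omega> c q + g_form G \<Omega> c q)) \<gamma>),
       Re (form_integral M (\<lambda>c q. \<i>/2 * (ginv_form G \<Omega> c q - g_form G \<Omega> c q)) \<gamma>),
       Re (form_integral M \<Omega> \<gamma>)]"
    unfolding 1 2 3 form_integral_differential[OF holomorphic_polynomials(2) \<gamma>(1)]
      form_integral_differential[OF holomorphic_polynomials(3) \<gamma>(1)]
      form_integral_differential[OF holomorphic_polynomials(4) \<gamma>(1)] \<gamma>(2) enneper_def vec_eq_iff forall_3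
    by (simp only: vector_3 vector_minus_component minus_complex.sel)
qed

lemma induced_metric_eq:
  assumes "c \<in> atlas M" "q \<in> fst c"
  shows "induced_metric G \<Omega> c q u v = 1/4 * (1 - (norm (G q))\<^sup>2)\<^sup>2 * (norm (differential G c q))\<^sup>2 * (u \<bullet> v)"
proof -
  have "norm (differential G c q) - norm ((G q)\<^sup>2 * differential G c q) =
      (1 - (norm (G q))\<^sup>2) * norm (differential G c q)"
    by (simp add: norm_mult norm_power algebra_simps)
  then show ?thesis
    unfolding induced_metric_def ginv_form_eq[OF assms] g_form_eq[OF assms] differential_polynomials(1)[OF assms]
    by (simp add: power_mult_distrib)
qed

lemma holomorphic_form_norm_transform:
  assumes "holomorphic_form M \<omega>" "c \<in> atlas M" "d \<in> atlas M" "q \<in> fst c \<inter> fst d"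
  shows "(norm (\<omega> c q))\<^sup>2 = (norm (\<omega> d q))\<^sup>2 * (norm (deriv (transition c d) (snd c q)))\<^sup>2"
proof -
  have "\<omega> c q = \<omega> d q * deriv (transition c d) (snd c q)" using assms unfolding holomorphic_form_def by blast
  then show ?thesis by (simp add: norm_mult power_mult_distrib)
qed

lemma Ck_on_norm_form:
  assumes "holomorphic_form M \<omega>" "c \<in> atlas M"
  shows "Ck_on k (\<lambda>z. (norm (\<omega> c (param c z)))\<^sup>2) (chart_image c)"
proof -
  have "(\<omega> c \<circ> param c) holomorphic_on chart_image c" using assms by (auto simp: holomorphic_form_def)
  from Ck_on_cmod_square[OF open_chart_image[OF assms(2)] this] show ?thesis by simp
qed

lemma Ck_on_norm_G:
  assumes "c \<in> atlas M"
  shows "Ck_on k (\<lambda>z. (norm (G (param c z)))\<^sup>2) (chart_image c)"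
proof -
  have "(G \<circ> param c) holomorphic_on chart_image c" using G assms by (auto simp: holomorphic_function_def)
  from Ck_on_cmod_square[OF open_chart_image[OF assms] this] show ?thesis by simp
qed

lemma Ck_on_induced_factor:
  assumes c: "c \<in> atlas M"
  shows "Ck_on k (\<lambda>z. 1/4 * (1 - (norm (G (param c z)))\<^sup>2)\<^sup>2 * (norm (differential G c (param c z)))\<^sup>2) (chart_image c)"
proof -
  note mult = Ck_on_mult[OF open_chart_image[OF c]] and add = Ck_on_add[OF open_chart_image[OF c]]
  have "Ck_on k (\<lambda>z. 1 + (-1) * (norm (G (param c z)))\<^sup>2) (chart_image c)"
    by (intro add mult Ck_on_const Ck_on_norm_G c)
  then have s: "Ck_on k (\<lambda>z. 1 - (norm (G (param c z)))\<^sup>2) (chart_image c)" by simp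
  show ?thesis
    unfolding power2_eq_square[of "1 - _"]
    by (intro mult Ck_on_const s Ck_on_norm_form[OF holomorphic_form_differential[OF G] c])
qed

lemma symmetric_2_tensor_induced_metric: "symmetric_2_tensor M (induced_metric G \<Omega>)"
proof (rule conformal_symmetric_2_tensor[OF open_chart_image induced_metric_eq Ck_on_induced_factor])
  fix c d q assume *: "c \<in> atlas M" "d \<in> atlas M" "q \<in> fst c \<inter> fst d"
  show "1/4 * (1 - (norm (G q))\<^sup>2)\<^sup>2 * (norm (differential G c q))\<^sup>2 =
    1/4 * (1 - (norm (G q))\<^sup>2)\<^sup>2 * (norm (differential G d q))\<^sup>2 * (norm (deriv (transition c d) (snd c q)))\<^sup>2"
    using holomorphic_form_norm_transform[OF holomorphic_form_differential[OF G] *] by simp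
qed

text \<open>The cutoff vanishes for \<open>s \<ge> 2\<close>. It is positive for \<open>s < 2\<close>, in particular where the factor \<open>(1 - s)\<^sup>2\<close> of the induced
  metric vanishes, and there it keeps the coefficient of \<open>|dG|\<^sup>2\<close> bounded below.\<close>

definition cutoff :: "real \<Rightarrow> real" where "cutoff s = flat 1 (2 - s)"

lemma cutoff_nonneg: "0 \<le> cutoff s" by (simp add: cutoff_def flat_def)

lemma cutoff_pos: "s < 2 \<Longrightarrow> 0 < cutoff s" by (simp add: cutoff_def flat_def)

lemma cutoff_eq_0: "2 \<le> s \<Longrightarrow> cutoff s = 0" by (simp add: cutoff_def flat_def)

text \<open>For \<open>s\<close> outside \<open>[1/2, 3/2]\<close> the first summand is at least \<open>1/16\<close>. Inside, the cutoff is at least \<open>e\<^sup>-\<^sup>2 \<ge> 1/9\<close>.\<close>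

lemma cutoff_lower_bound: "1/16 \<le> 1/4 * (1 - s)\<^sup>2 + cutoff s"
proof (cases "1/2 \<le> s \<and> s \<le> 3/2")
  case True
  have "exp (2::real) = exp 1 * exp 1" by (simp flip: exp_add)
  also have "\<dots> \<le> 3 * 3" using exp_le by (intro mult_mono) auto
  finally have "1/16 \<le> exp (- 2 :: real)" by (simp add: exp_minus field_simps)
  also have "\<dots> \<le> cutoff s" using True by (simp add: cutoff_def flat_def divide_simps)
  also have "\<dots> \<le> 1/4 * (1 - s)\<^sup>2 + cutoff s" by simp
  finally show ?thesis .
next
  case False
  then have "1/2 \<le> \<bar>1 - s\<bar>" by auto
  then have "(1/2)\<^sup>2 \<le> (\<bar>1 - s\<bar>)\<^sup>2" by (intro power_mono) auto
  then have "1/16 \<le> 1/4 * (1 - s)\<^sup>2" by (simp add: power2_eq_square)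
  then show ?thesis using cutoff_nonneg[of s] by simp
qed

text \<open>The metric is corrected on the compact set \<open>|G| \<le> 2\<close>, where \<open>\<eta>\<^sub>1\<close> and \<open>\<eta>\<^sub>2\<close>, two forms without
  a common zero, supply positivity. The extra summand \<open>|dG|\<^sup>2\<close> makes \<open>G\<close> Lipschitz everywhere,
  also near the curve \<open>|G| = 1\<close> on which the induced metric vanishes.\<close>

theorem complete_maximal_map:
  assumes "z0 \<in> points M" and proper: "\<And>R. compactin (stop M) {q \<in> points M. norm (G q) \<le> R}"
    and \<eta>1: "holomorphic_form M \<eta>1" and \<eta>2: "holomorphic_form M \<eta>2"
    and no_common_zero: "\<And>c q. c \<in> atlas M \<Longrightarrow> q \<in> fst c \<Longrightarrow> \<eta>1 c q \<noteq> 0 \<or> \<eta>2 c q \<noteq> 0"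
    and critical: "\<And>c q. c \<in> atlas M \<Longrightarrow> q \<in> fst c \<Longrightarrow> differential G c q = 0 \<Longrightarrow> norm (G q) \<le> 1"
  shows "complete_maximal_map M G \<Omega> (\<lambda>q. enneper (G q) - enneper (G z0))"
proof -
  define b where "b c q = cutoff ((norm (G q))\<^sup>2) *
    ((norm (\<eta>1 c q))\<^sup>2 + (norm (\<eta>2 c q))\<^sup>2 + (norm (differential G c q))\<^sup>2)" for c q
  define l where "l c q = 1/4 * (1 - (norm (G q))\<^sup>2)\<^sup>2 * (norm (differential G c q))\<^sup>2 + b c q" for c q
  \<comment> \<open>On chart domains this is the conformal tensor with factor \<open>b\<close>. Defined as a difference, it makes the sum with the induced metric equal to \<open>l\<close> times the inner product everywhere.\<close>
  define T where "T c q u v = l c q * (u \<bullet> v) - induced_metric G \<Omega> c q u v" for c q u v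
  have T: "T c q u v = b c q * (u \<bullet> v)" if "c \<in> atlas M" "q \<in> fst c" for c q u v
    unfolding T_def induced_metric_eq[OF that] l_def by (simp add: algebra_simps)
  note dG = holomorphic_form_differential[OF G]
  have b_smooth: "Ck_on k (\<lambda>z. b c (param c z)) (chart_image c)" if c: "c \<in> atlas M" for c k
  proof -
    note mult = Ck_on_mult[OF open_chart_image[OF c]] and add = Ck_on_add[OF open_chart_image[OF c]]
    have "Ck_on k (\<lambda>z. 2 + (-1) * (norm (G (param c z)))\<^sup>2) (chart_image c)"
      by (intro add mult Ck_on_const Ck_on_norm_G c)
    then have "Ck_on k (\<lambda>z. 2 - (norm (G (param c z)))\<^sup>2) (chart_image c)" by simp
    from Ck_on_flat[OF open_chart_image[OF c] this]
    have "Ck_on k (\<lambda>z. cutoff ((norm (G (param c z)))\<^sup>2)) (chart_image c)" unfolding cutoff_def .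
    then show ?thesis
      unfolding b_def by (intro add mult Ck_on_norm_form[OF _ c] \<eta>1 \<eta>2 dG)
  qed
  have b_transform: "b c q = b d q * (norm (deriv (transition c d) (snd c q)))\<^sup>2"
    if *: "c \<in> atlas M" "d \<in> atlas M" "q \<in> fst c \<inter> fst d" for c d q
    unfolding b_def holomorphic_form_norm_transform[OF \<eta>1 *] holomorphic_form_norm_transform[OF \<eta>2 *]
      holomorphic_form_norm_transform[OF dG *] by (simp add: algebra_simps)
  have T_tensor: "symmetric_2_tensor M T"
    by (rule conformal_symmetric_2_tensor[OF open_chart_image T b_smooth b_transform])
  have b_nonneg: "0 \<le> b c q" for c q unfolding b_def by (intro mult_nonneg_nonneg cutoff_nonneg) auto
  have pos: "0 < l c q" if cq: "c \<in> atlas M" "q \<in> fst c" for c q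
  proof (cases "(norm (G q))\<^sup>2 < 2")
    case True
    have "0 < (norm (\<eta>1 c q))\<^sup>2 + (norm (\<eta>2 c q))\<^sup>2"
      using no_common_zero[OF cq] by (auto intro: add_pos_nonneg add_nonneg_pos)
    then have "0 < (norm (\<eta>1 c q))\<^sup>2 + (norm (\<eta>2 c q))\<^sup>2 + (norm (differential G c q))\<^sup>2"
      by (rule add_pos_nonneg) simp
    then have "0 < b c q" unfolding b_def by (rule mult_pos_pos[OF cutoff_pos[OF True]])
    then show ?thesis unfolding l_def by (intro add_nonneg_pos) auto
  next
    case False
    have "differential G c q \<noteq> 0"
    proof
      assume "differential G c q = 0"
      from critical[OF cq this] have "(norm (G q))\<^sup>2 \<le> 1\<^sup>2" by (intro power_mono) auto
      then show False using False by simp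
    qed
    moreover have "0 < (1 - (norm (G q))\<^sup>2)\<^sup>2" using False by (intro zero_less_power2[THEN iffD2]) auto
    ultimately show ?thesis unfolding l_def using b_nonneg[of c q] by (intro add_pos_nonneg mult_pos_pos) auto
  qed
  have "symmetric_2_tensor M (\<lambda>c q u v. l c q * (u \<bullet> v))"
  proof (rule conformal_symmetric_2_tensor[OF open_chart_image refl])
    show "Ck_on k (\<lambda>z. l c (param c z)) (chart_image c)" if c: "c \<in> atlas M" for c k
      unfolding l_def by (intro Ck_on_add[OF open_chart_image[OF c]] Ck_on_induced_factor b_smooth c)
    show "l c q = l d q * (norm (deriv (transition c d) (snd c q)))\<^sup>2"
      if *: "c \<in> atlas M" "d \<in> atlas M" "q \<in> fst c \<inter> fst d" for c d q
      unfolding l_def b_transform[OF *] holomorphic_form_norm_transform[OF dG *] by (simp add: algebra_simps)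
  qed
  then have "riemannian_metric M (\<lambda>c q u v. l c q * (u \<bullet> v))"
    unfolding riemannian_metric_def using pos by auto
  then interpret L: conformal_metric M l by unfold_locales
  have complete: "complete_riemannian_metric M (\<lambda>c q u v. l c q * (u \<bullet> v))"
  proof (rule L.complete_if_proper_lipschitz_function[OF G _ _ proper])
    fix c q assume "c \<in> atlas M" "q \<in> fst c"
    have "1/16 * (norm (differential G c q))\<^sup>2 \<le>
        (1/4 * (1 - (norm (G q))\<^sup>2)\<^sup>2 + cutoff ((norm (G q))\<^sup>2)) * (norm (differential G c q))\<^sup>2"
      by (intro mult_right_mono cutoff_lower_bound) simp
    also have "\<dots> \<le> l c q"
      unfolding l_def b_def using cutoff_nonneg by (simp add: algebra_simps)
    finally have "(1/4 * norm (differential G c q))\<^sup>2 \<le> l c q" by (simp add: power_mult_distrib power2_eq_square)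
    then show "1/4 * norm (differential G c q) \<le> sqrt (l c q)" by (rule real_le_rsqrt)
  qed simp
  show ?thesis
    unfolding complete_maximal_map_def
  proof (intro conjI is_maximal_map assms(1) exI)
    show "compactin (stop M) {q \<in> points M. norm (G q) \<le> 2}" by (rule proper)
    show "symmetric_2_tensor M T" by (rule T_tensor)
    show "\<forall>c\<in>atlas M. \<forall>q\<in>fst c - {q \<in> points M. norm (G q) \<le> 2}. \<forall>u v. T c q u v = 0"
    proof (intro ballI allI)
      fix c q u v assume c: "c \<in> atlas M" and q: "q \<in> fst c - {q \<in> points M. norm (G q) \<le> 2}"
      then have "2 < norm (G q)" using chart_subset[OF c] by auto
      then have "2\<^sup>2 \<le> (norm (G q))\<^sup>2" by (intro power_mono) auto
      then have "cutoff ((norm (G q))\<^sup>2) = 0" by (intro cutoff_eq_0) simp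
      then show "T c q u v = 0" using T[OF c, of q u v] q by (simp add: b_def)
    qed
    show "complete_riemannian_metric M (\<lambda>c q u v. induced_metric G \<Omega> c q u v + T c q u v)"
      using complete by (simp add: T_def)
  qed
qed

text \<open>Where \<open>|G| \<ge> 2\<close> the induced metric dominates \<open>|dG|\<^sup>2/4\<close>, so a path on which \<open>G\<close> tends to
  infinity is infinitely long.\<close>

lemma complete_end:
  assumes M: "M = puncture Mbar E" and "e \<in> E"
    and pole: "\<And>R. \<exists>U. openin (stop Mbar) U \<and> e \<in> U \<and> (\<forall>q\<in>U \<inter> points M. R < norm (G q))"
  shows "complete_end Mbar E G \<Omega> e"
  unfolding complete_end_def M[symmetric]
proof (intro conjI allI impI assms(2))
  fix \<gamma> assume "surface_path M {0..<1} \<gamma> \<and> limitin (stop Mbar) \<gamma> e (at_left 1)"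
  then have \<gamma>: "surface_path M {0..<1} \<gamma>" and lim: "limitin (stop Mbar) \<gamma> e (at_left (1::real))" by auto
  have late: "\<exists>t0\<in>{0..<1}. \<forall>t\<in>{t0..<1}. R < norm (G (\<gamma> t))" for R
  proof -
    obtain U where U: "openin (stop Mbar) U" "e \<in> U" "\<forall>q\<in>U \<inter> points M. R < norm (G q)" using pole by blast
    have "\<forall>\<^sub>F t in at_left 1. \<gamma> t \<in> U" using lim U(1,2) by (auto simp: limitin_def)
    then obtain b where b: "b < 1" "\<And>t. b < t \<Longrightarrow> t < 1 \<Longrightarrow> \<gamma> t \<in> U"
      unfolding eventually_at_left_field by blast
    define t0 where "t0 = max 0 ((b + 1) / 2)"
    have "t0 \<in> {0..<1}" "b < t0" using b(1) by (auto simp: t0_def max_def field_simps)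
    moreover have "R < norm (G (\<gamma> t))" if "t \<in> {t0..<1}" for t
      using that calculation b(2)[of t] U(3) surface_path_in[OF \<gamma>, of t] by auto
    ultimately show ?thesis by blast
  qed
  have long: "ennreal r \<le> path_length M (induced_metric G \<Omega>) {0..<1} \<gamma>" if "0 \<le> r" for r
  proof -
    obtain t0 where t0: "t0 \<in> {0..<1}" "\<forall>t\<in>{t0..<1}. 2 < norm (G (\<gamma> t))" using late[of 2] by auto
    obtain t1 where t1: "t1 \<in> {0..<1}" "\<forall>t\<in>{t1..<1}. norm (G (\<gamma> t0)) + 2 * r < norm (G (\<gamma> t))"
      using late[of "norm (G (\<gamma> t0)) + 2 * r"] by auto
    define t where "t = max t0 t1"
    have t: "t0 \<le> t" "t < 1" "norm (G (\<gamma> t0)) + 2 * r < norm (G (\<gamma> t))" using t0 t1 by (auto simp: t_def)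
    have "r \<le> 1/2 * norm (G (\<gamma> t) - G (\<gamma> t0))" using t(3) norm_triangle_ineq2[of "G (\<gamma> t)" "G (\<gamma> t0)"] by simp
    then have "ennreal r \<le> ennreal (1/2 * norm (G (\<gamma> t) - G (\<gamma> t0)))" by (rule ennreal_leI)
    also have "\<dots> \<le> path_length M (induced_metric G \<Omega>) {t0..t} \<gamma>"
    proof (rule increment_le_path_length[OF symmetric_2_tensor_induced_metric _ t(1) _ G])
      show "surface_path M {t0..t} \<gamma>" by (rule surface_path_subset[OF \<gamma>]) (use t0 t in auto)
      fix c s and v :: complex assume c: "c \<in> atlas M" "s \<in> {t0..t}" "\<gamma> s \<in> fst c"
      then have "2 < norm (G (\<gamma> s))" using t0 t by auto
      then have "2\<^sup>2 \<le> (norm (G (\<gamma> s)))\<^sup>2" by (intro power_mono) auto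
      then have "1\<^sup>2 \<le> ((norm (G (\<gamma> s)))\<^sup>2 - 1)\<^sup>2" by (intro power_mono) auto
      then have "1 \<le> (1 - (norm (G (\<gamma> s)))\<^sup>2)\<^sup>2" by (simp add: power2_commute)
      then have "1/4 * 1 * ((norm (differential G c (\<gamma> s)))\<^sup>2 * (norm v)\<^sup>2) \<le>
          1/4 * (1 - (norm (G (\<gamma> s)))\<^sup>2)\<^sup>2 * ((norm (differential G c (\<gamma> s)))\<^sup>2 * (norm v)\<^sup>2)"
        by (intro mult_right_mono mult_left_mono) auto
      then have "(1/2 * (norm (differential G c (\<gamma> s)) * norm v))\<^sup>2 \<le> induced_metric G \<Omega> c (\<gamma> s) v v"
        unfolding induced_metric_eq[OF c(1,3)] dot_square_norm
        by (simp add: power_mult_distrib power_divide mult.assoc)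
      then show "1/2 * (norm (differential G c (\<gamma> s)) * norm v) \<le> sqrt (induced_metric G \<Omega> c (\<gamma> s) v v)"
        by (rule real_le_rsqrt)
    qed simp
    also have "\<dots> \<le> path_length M (induced_metric G \<Omega>) {0..<1} \<gamma>"
      by (rule path_length_mono) (use t0 t in auto)
    finally show ?thesis .
  qed
  show "path_length M (induced_metric G \<Omega>) {0..<1} \<gamma> = \<infinity>"
  proof (rule ccontr)
    assume "path_length M (induced_metric G \<Omega>) {0..<1} \<gamma> \<noteq> \<infinity>"
    then obtain r where "0 \<le> r" "path_length M (induced_metric G \<Omega>) {0..<1} \<gamma> = ennreal r"
      by (cases "path_length M (induced_metric G \<Omega>) {0..<1} \<gamma>") auto
    then show False using long[of "r + 1"] by simp
  qed
qed

end

section \<open>The hyperelliptic curve\<close>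

locale hyperelliptic =
  fixes m :: nat
  assumes m: "2 \<le> m"
begin

abbreviation n :: nat where "n \<equiv> 2 * m"

definition affine_part :: "surface_point set" where
  "affine_part = {q. (snd q)\<^sup>2 = 1 + fst q ^ n}"

text \<open>The points at infinity are encoded by two points over \<open>z = 0\<close> that are not on the affine curve.\<close>

definition infinite_points :: "surface_point set" where
  "infinite_points = {(0, 2), (0, -2)}"

definition curve :: "surface_point set" where
  "curve = affine_part \<union> infinite_points"

definition far_part :: "surface_point set" where
  "far_part = {q \<in> curve. q \<in> infinite_points \<or> fst q \<noteq> 0}"

definition u_coord :: "surface_point \<Rightarrow> complex" where
  "u_coord q = (if q \<in> infinite_points then 0 else 1 / fst q)"

definition v_coord :: "surface_point \<Rightarrow> complex" where
  "v_coord q = (if q \<in> infinite_points then snd q / 2 else snd q / fst q ^ m)"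

definition from_uv :: "complex \<Rightarrow> complex \<Rightarrow> surface_point" where
  "from_uv u v = (if u = 0 then (0, 2 * v) else (1 / u, v / u ^ m))"

text \<open>The curve lies in the line bundle of degree \<open>m\<close> over the Riemann sphere. In the coordinates \<open>(z, w)\<close> and
  \<open>(u, v) = (1/z, w/z\<^sup>m)\<close> the following formulas describe one bounded injective map, which extends continuously over
  the points at infinity. The first two components are a stereographic projection of \<open>z\<close>, and the other two are \<open>w\<close>
  and \<open>v\<close> with factors that make them bounded. The topology of the curve is pulled back along this map.\<close>

definition embed_zw :: "complex \<Rightarrow> complex \<Rightarrow> complex \<times> complex \<times> complex \<times> complex" where
  "embed_zw z w = (let s = 1 + z * cnj z in (z / s, 1 / s, w / s ^ m, w * cnj z ^ m / s ^ m))"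

definition embed_uv :: "complex \<Rightarrow> complex \<Rightarrow> complex \<times> complex \<times> complex \<times> complex" where
  "embed_uv u v = (let s = 1 + u * cnj u in (cnj u / s, u * cnj u / s, v * cnj u ^ m / s ^ m, v / s ^ m))"

definition embed :: "surface_point \<Rightarrow> complex \<times> complex \<times> complex \<times> complex" where
  "embed q = (if q \<in> affine_part then embed_zw (fst q) (snd q) else embed_uv (u_coord q) (v_coord q))"

definition curve_topology :: "surface_point topology" where
  "curve_topology = pullback_topology curve embed euclidean"

lemma m_nonzero [simp]: "m \<noteq> 0" "0 < m" and zero_power_n [simp]: "(0::complex) ^ n = 0"
  using m by (auto simp: power_0_left)

lemma one_plus_norm_nonzero: "1 + z * cnj z \<noteq> 0"
proof
  assume "1 + z * cnj z = 0"
  then have "Re (1 + z * cnj z) = 0" by simp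
  moreover have "Re (1 + z * cnj z) = 1 + (Re z)\<^sup>2 + (Im z)\<^sup>2" by (simp add: power2_eq_square)
  moreover have "0 \<le> (Re z)\<^sup>2" "0 \<le> (Im z)\<^sup>2" by simp_all
  ultimately show False by linarith
qed

lemma not_affine_infinite: "q \<in> infinite_points \<Longrightarrow> q \<notin> affine_part"
  using m by (auto simp: affine_part_def infinite_points_def)

lemma uv_relation: "q \<in> far_part \<Longrightarrow> (v_coord q)\<^sup>2 = 1 + u_coord q ^ n"
proof (cases "q \<in> infinite_points")
  case True
  then show ?thesis using m by (auto simp: v_coord_def u_coord_def infinite_points_def power_divide)
next
  case False
  assume "q \<in> far_part"
  then have q: "fst q \<noteq> 0" "(snd q)\<^sup>2 = 1 + fst q ^ n" using False by (auto simp: far_part_def curve_def affine_part_def)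
  have "(v_coord q)\<^sup>2 = (snd q)\<^sup>2 / fst q ^ n" using False by (simp add: v_coord_def power_divide power_mult mult.commute flip: power_mult)
  also have "\<dots> = 1 + u_coord q ^ n" using q False by (simp add: u_coord_def power_divide add_divide_distrib)
  finally show ?thesis .
qed

lemma from_uv_far:
  assumes "v\<^sup>2 = 1 + u ^ n"
  shows "from_uv u v \<in> far_part" "u_coord (from_uv u v) = u" "v_coord (from_uv u v) = v"
proof -
  have "v = 1 \<or> v = -1" if "u = 0" using assms that m by (simp add: power2_eq_1_iff)
  then have inf: "from_uv u v \<in> infinite_points \<longleftrightarrow> u = 0" by (auto simp: from_uv_def infinite_points_def)
  have aff: "from_uv u v \<in> affine_part" if "u \<noteq> 0"
  proof -
    have "(v / u ^ m)\<^sup>2 = v\<^sup>2 / u ^ n" by (simp add: power_divide mult.commute flip: power_mult)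
    also have "\<dots> = 1 + (1 / u) ^ n" using that assms by (simp add: add_divide_distrib power_divide)
    finally show ?thesis using that by (simp add: from_uv_def affine_part_def)
  qed
  show "from_uv u v \<in> far_part" using inf aff by (auto simp: far_part_def curve_def from_uv_def)
  show "u_coord (from_uv u v) = u" unfolding u_coord_def inf by (simp add: from_uv_def)
  show "v_coord (from_uv u v) = v" unfolding v_coord_def inf by (simp add: from_uv_def power_divide)
qed

lemma from_uv_coords: "q \<in> far_part \<Longrightarrow> from_uv (u_coord q) (v_coord q) = q"
  by (cases q) (auto simp: from_uv_def u_coord_def v_coord_def far_part_def power_divide infinite_points_def)

lemma embed_eq_uv:
  assumes "q \<in> far_part"
  shows "embed q = embed_uv (u_coord q) (v_coord q)"
proof (cases "q \<in> affine_part")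
  case False then show ?thesis by (simp add: embed_def)
next
  case True
  obtain z w where q: "q = (z, w)" by (cases q)
  have nin: "q \<notin> infinite_points" using True not_affine_infinite by blast
  then have z: "z \<noteq> 0" using assms q by (auto simp: far_part_def)
  define s where "s = 1 + z * cnj z"
  have s: "s \<noteq> 0" unfolding s_def by (rule one_plus_norm_nonzero)
  have t: "1 + 1 / z * cnj (1 / z) = s / (z * cnj z)" using z by (simp add: s_def field_simps)
  have "embed_uv (1 / z) (w / z ^ m) = (z / s, 1 / s, w / s ^ m, w * cnj z ^ m / s ^ m)"
    unfolding embed_uv_def Let_def t using z s
    by (simp add: field_simps power_divide power_mult_distrib)
  then show ?thesis
    using True nin by (simp add: embed_def embed_zw_def Let_def q u_coord_def v_coord_def flip: s_def)
qed

lemma embed_coordinates: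
  shows "q \<in> affine_part \<Longrightarrow> fst (snd (embed q)) \<noteq> 0"
    and "q \<in> affine_part \<Longrightarrow> fst (embed q) / fst (snd (embed q)) = fst q"
    and "q \<in> affine_part \<Longrightarrow> fst (snd (snd (embed q))) / fst (snd (embed q)) ^ m = snd q"
    and "q \<in> far_part \<Longrightarrow> fst (snd (embed q)) \<noteq> 1"
    and "q \<in> far_part \<Longrightarrow> cnj (fst (embed q) / (1 - fst (snd (embed q)))) = u_coord q"
    and "q \<in> far_part \<Longrightarrow> snd (snd (snd (embed q))) / (1 - fst (snd (embed q))) ^ m = v_coord q"
    and "q \<in> curve \<Longrightarrow> fst (snd (embed q)) \<noteq> 0 \<Longrightarrow> q \<in> affine_part"
    and "q \<in> curve \<Longrightarrow> fst (snd (embed q)) \<noteq> 1 \<Longrightarrow> q \<in> far_part"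
proof -
  have s: "1 + z * cnj z \<noteq> 0" for z :: complex by (rule one_plus_norm_nonzero)
  have d: "1 - u * cnj u / (1 + u * cnj u) = 1 / (1 + u * cnj u)" for u :: complex
    using s[of u] by (simp add: field_simps)
  show "q \<in> affine_part \<Longrightarrow> fst (snd (embed q)) \<noteq> 0"
    "q \<in> affine_part \<Longrightarrow> fst (embed q) / fst (snd (embed q)) = fst q"
    "q \<in> affine_part \<Longrightarrow> fst (snd (snd (embed q))) / fst (snd (embed q)) ^ m = snd q"
    using s by (auto simp: embed_def embed_zw_def Let_def power_divide)
  show far1: "q \<in> far_part \<Longrightarrow> fst (snd (embed q)) \<noteq> 1"
    using s[of "u_coord q"] by (simp add: embed_eq_uv embed_uv_def Let_def divide_eq_1_iff)
  show "q \<in> far_part \<Longrightarrow> cnj (fst (embed q) / (1 - fst (snd (embed q)))) = u_coord q"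
    using s[of "u_coord q"] s[of "cnj (u_coord q)"]
    by (simp add: embed_eq_uv embed_uv_def Let_def d mult.commute)
  show "q \<in> far_part \<Longrightarrow> snd (snd (snd (embed q))) / (1 - fst (snd (embed q))) ^ m = v_coord q"
    using s[of "u_coord q"] by (simp add: embed_eq_uv embed_uv_def Let_def d power_divide)
  show "q \<in> curve \<Longrightarrow> fst (snd (embed q)) \<noteq> 0 \<Longrightarrow> q \<in> affine_part"
    by (rule ccontr) (auto simp: curve_def embed_def embed_uv_def Let_def u_coord_def)
  show "q \<in> curve \<Longrightarrow> fst (snd (embed q)) \<noteq> 1 \<Longrightarrow> q \<in> far_part"
    by (cases "q \<in> affine_part") (auto simp: far_part_def curve_def embed_def embed_zw_def Let_def)
qed

lemma inj_on_embed: "inj_on embed curve"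
proof (rule inj_onI)
  fix q q' assume q: "q \<in> curve" "q' \<in> curve" and eq: "embed q = embed q'"
  show "q = q'"
  proof (cases "fst (snd (embed q)) = 0")
    case False
    then have "q \<in> affine_part" "q' \<in> affine_part" using q eq embed_coordinates(7) by auto
    then have "fst q = fst q'" "snd q = snd q'" using embed_coordinates(2,3) eq by metis+
    then show ?thesis by (simp add: prod_eq_iff)
  next
    case True
    then have "q \<in> far_part" "q' \<in> far_part" using q eq embed_coordinates(8) by auto
    moreover from this have "u_coord q = u_coord q'" "v_coord q = v_coord q'"
      using embed_coordinates(5,6) eq by metis+
    ultimately show ?thesis using from_uv_coords by metis
  qed
qed

lemma topspace_curve [simp]: "topspace curve_topology = curve"
  by (simp add: curve_topology_def topspace_pullback_topology)

lemma affine_subset: "affine_part \<subseteq> curve" and far_subset: "far_part \<subseteq> curve"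
  by (auto simp: curve_def far_part_def)

lemma continuous_map_embed: "continuous_map curve_topology euclidean embed"
  using continuous_map_pullback[OF continuous_map_id, of curve embed euclidean]
  by (simp add: curve_topology_def o_def)

lemma openin_affine: "openin curve_topology affine_part"
proof -
  have o: "open {x :: complex \<times> complex \<times> complex \<times> complex. fst (snd x) \<noteq> 0}"
    by (intro open_Collect_neq continuous_intros)
  have e: "affine_part = embed -` {x. fst (snd x) \<noteq> 0} \<inter> curve"
    using embed_coordinates(1,7) affine_subset by blast
  show ?thesis
    unfolding curve_topology_def openin_pullback_topology
    by (rule exI, rule conjI, rule iffD1[OF open_openin o], rule e)
qed

lemma openin_far: "openin curve_topology far_part"
proof -
  have o: "open {x :: complex \<times> complex \<times> complex \<times> complex. fst (snd x) \<noteq> 1}"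
    by (intro open_Collect_neq continuous_intros)
  have e: "far_part = embed -` {x. fst (snd x) \<noteq> 1} \<inter> curve"
    using embed_coordinates(4,8) far_subset by blast
  show ?thesis
    unfolding curve_topology_def openin_pullback_topology
    by (rule exI, rule conjI, rule iffD1[OF open_openin o], rule e)
qed

lemma continuous_map_affine_coords:
  "continuous_map (subtopology curve_topology affine_part) euclidean (\<lambda>q. q)"
proof -
  let ?S = "{x :: complex \<times> complex \<times> complex \<times> complex. fst (snd x) \<noteq> 0}"
  have 1: "continuous_map (subtopology curve_topology affine_part) (top_of_set ?S) embed"
    using continuous_map_embed embed_coordinates(1)
    by (auto simp: continuous_map_in_subtopology continuous_map_from_subtopology)
  have 2: "continuous_map (top_of_set ?S) euclidean
      (\<lambda>x. (fst x / fst (snd x), fst (snd (snd x)) / fst (snd x) ^ m))"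
    by (auto intro!: continuous_intros)
  have "continuous_map (subtopology curve_topology affine_part) euclidean
     ((\<lambda>x. (fst x / fst (snd x), fst (snd (snd x)) / fst (snd x) ^ m)) \<circ> embed)"
    by (rule continuous_map_compose[OF 1 2])
  then show ?thesis
    by (rule continuous_map_eq) (use embed_coordinates(2,3) in auto)
qed

lemma continuous_map_uv_coords:
  "continuous_map (subtopology curve_topology far_part) euclidean (\<lambda>q. (u_coord q, v_coord q))"
proof -
  let ?S = "{x :: complex \<times> complex \<times> complex \<times> complex. fst (snd x) \<noteq> 1}"
  have 1: "continuous_map (subtopology curve_topology far_part) (top_of_set ?S) embed"
    using continuous_map_embed embed_coordinates(4)
    by (auto simp: continuous_map_in_subtopology continuous_map_from_subtopology)
  have 2: "continuous_map (top_of_set ?S) euclidean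
      (\<lambda>x. (cnj (fst x / (1 - fst (snd x))), snd (snd (snd x)) / (1 - fst (snd x)) ^ m))"
    by (auto intro!: continuous_intros)
  have "continuous_map (subtopology curve_topology far_part) euclidean
     ((\<lambda>x. (cnj (fst x / (1 - fst (snd x))), snd (snd (snd x)) / (1 - fst (snd x)) ^ m)) \<circ> embed)"
    by (rule continuous_map_compose[OF 1 2])
  then show ?thesis
    by (rule continuous_map_eq) (use embed_coordinates(5,6) in auto)
qed

lemma openin_affine_preimage:
  assumes "open V" shows "openin curve_topology {q \<in> affine_part. q \<in> V}"
proof -
  have "openin (subtopology curve_topology affine_part) {q \<in> topspace (subtopology curve_topology affine_part). q \<in> V}"
    using continuous_map_affine_coords assms by (intro openin_continuous_map_preimage) auto
  then show ?thesis
    using openin_affine affine_subset by (simp add: openin_open_subtopology Int_absorb1)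
qed

lemma openin_far_preimage:
  assumes "open V" shows "openin curve_topology {q \<in> far_part. (u_coord q, v_coord q) \<in> V}"
proof -
  have "openin (subtopology curve_topology far_part)
     {q \<in> topspace (subtopology curve_topology far_part). (u_coord q, v_coord q) \<in> V}"
    using continuous_map_uv_coords assms by (intro openin_continuous_map_preimage) auto
  then show ?thesis
    using openin_far far_subset by (simp add: openin_open_subtopology Int_absorb1)
qed

lemma continuous_map_zw:
  assumes "continuous_on T f" "continuous_on T g" "\<And>t. t \<in> T \<Longrightarrow> (g t)\<^sup>2 = 1 + f t ^ n"
  shows "continuous_map (top_of_set T) curve_topology (\<lambda>t. (f t, g t))"
  unfolding curve_topology_def
proof (rule continuous_map_pullback')
  have aff: "(f t, g t) \<in> affine_part" if "t \<in> T" for t using assms(3)[OF that] by (simp add: affine_part_def)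
  have s: "1 + f t * cnj (f t) \<noteq> 0" for t by (rule one_plus_norm_nonzero)
  have "continuous_on T (\<lambda>t. embed_zw (f t) (g t))"
    unfolding embed_zw_def Let_def using s by (intro continuous_intros assms) auto
  then have "continuous_on T (embed \<circ> (\<lambda>t. (f t, g t)))"
    by (rule continuous_on_eq) (use aff in \<open>simp add: embed_def\<close>)
  then show "continuous_map (top_of_set T) euclidean (embed \<circ> (\<lambda>t. (f t, g t)))" by simp
  show "topspace (top_of_set T) \<subseteq> (\<lambda>t. (f t, g t)) -` curve"
    using aff affine_subset by auto
qed

lemma continuous_map_uv:
  assumes "continuous_on T f" "continuous_on T g" "\<And>t. t \<in> T \<Longrightarrow> (g t)\<^sup>2 = 1 + f t ^ n"
  shows "continuous_map (top_of_set T) curve_topology (\<lambda>t. from_uv (f t) (g t))"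
  unfolding curve_topology_def
proof (rule continuous_map_pullback')
  have s: "1 + f t * cnj (f t) \<noteq> 0" for t by (rule one_plus_norm_nonzero)
  have "continuous_on T (\<lambda>t. embed_uv (f t) (g t))"
    unfolding embed_uv_def Let_def using s by (intro continuous_intros assms) auto
  then have "continuous_on T (embed \<circ> (\<lambda>t. from_uv (f t) (g t)))"
    by (rule continuous_on_eq) (simp add: embed_eq_uv from_uv_far assms(3))
  then show "continuous_map (top_of_set T) euclidean (embed \<circ> (\<lambda>t. from_uv (f t) (g t)))" by simp
  show "topspace (top_of_set T) \<subseteq> (\<lambda>t. from_uv (f t) (g t)) -` curve"
    by (auto intro!: subsetD[OF far_subset] from_uv_far(1) assms(3))
qed

lemma Hausdorff_curve: "Hausdorff_space curve_topology"
  by (rule Hausdorff_space_injective_preimage[OF Hausdorff_space_euclidean continuous_map_embed])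
     (simp add: inj_on_embed)

text \<open>The curve is the union of the parts over the closed unit discs of \<open>z\<close> and of \<open>u\<close>, each a continuous image of
  the compact set of points \<open>(z, w)\<close> with \<open>w\<^sup>2 = 1 + z\<^sup>n\<close> and \<open>|z| \<le> 1\<close>.\<close>

lemma compact_curve: "compact_space curve_topology"
proof -
  let ?K = "{q :: complex \<times> complex. (snd q)\<^sup>2 = 1 + fst q ^ n \<and> norm (fst q) \<le> 1}"
  have bound: "?K \<subseteq> cball 0 1 \<times> cball 0 2"
  proof
    fix q :: "complex \<times> complex" assume q: "q \<in> ?K"
    have "(norm (snd q))\<^sup>2 = norm (1 + fst q ^ n)" using q by (metis (mono_tags) mem_Collect_eq norm_power)
    also have "\<dots> \<le> 1 + norm (fst q) ^ n" by (metis norm_one norm_power norm_triangle_ineq)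
    also have "\<dots> \<le> 1 + 1" using q by (intro add_left_mono power_le_one) auto
    finally have "(norm (snd q))\<^sup>2 \<le> 2\<^sup>2" by simp
    then have "norm (snd q) \<le> 2" by (rule power2_le_imp_le) simp
    then show "q \<in> cball 0 1 \<times> cball 0 2" using q by (cases q) auto
  qed
  have "compact (cball (0::complex) 1 \<times> cball (0::complex) 2)" by (intro compact_Times compact_cball)
  moreover have "closed ?K"
    by (intro closed_Collect_conj closed_Collect_eq closed_Collect_le continuous_intros)
  ultimately have K: "compact ?K" using bound compact_Int_closed[of "cball 0 1 \<times> cball 0 2" ?K] by (simp add: Int_absorb1)
  have 1: "compactin curve_topology ((\<lambda>q. (fst q, snd q)) ` ?K)"
    using K by (intro image_compactin[OF _ continuous_map_zw[of ?K]]) (auto simp: compactin_subtopology intro!: continuous_intros)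
  have 2: "compactin curve_topology ((\<lambda>q. from_uv (fst q) (snd q)) ` ?K)"
    using K by (intro image_compactin[OF _ continuous_map_uv[of ?K]]) (auto simp: compactin_subtopology intro!: continuous_intros)
  have "curve = (\<lambda>q. (fst q, snd q)) ` ?K \<union> (\<lambda>q. from_uv (fst q) (snd q)) ` ?K"
  proof
    show "(\<lambda>q. (fst q, snd q)) ` ?K \<union> (\<lambda>q. from_uv (fst q) (snd q)) ` ?K \<subseteq> curve"
      using compactin_subset_topspace[OF 1] compactin_subset_topspace[OF 2] by simp
    show "curve \<subseteq> (\<lambda>q. (fst q, snd q)) ` ?K \<union> (\<lambda>q. from_uv (fst q) (snd q)) ` ?K"
    proof
      fix q assume q: "q \<in> curve"
      show "q \<in> (\<lambda>q. (fst q, snd q)) ` ?K \<union> (\<lambda>q. from_uv (fst q) (snd q)) ` ?K"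
      proof (cases "q \<in> affine_part \<and> norm (fst q) \<le> 1")
        case True
        then show ?thesis by (auto simp: affine_part_def image_iff)
      next
        case False
        then have far: "q \<in> far_part" and u: "norm (u_coord q) \<le> 1"
          using q by (auto simp: far_part_def curve_def u_coord_def norm_divide divide_le_eq_1)
        have "(u_coord q, v_coord q) \<in> ?K" using uv_relation[OF far] u by simp
        moreover have "q = from_uv (fst (u_coord q, v_coord q)) (snd (u_coord q, v_coord q))"
          using from_uv_coords[OF far] by simp
        ultimately show ?thesis by blast
      qed
    qed
  qed
  then show ?thesis using compactin_Un[OF 1 2] by (simp add: compact_space_def)
qed

subsection \<open>Charts\<close>

text \<open>Over the slit plane \<open>\<plusminus>csqrt (1 + z\<^sup>n)\<close> are two analytic branches of \<open>w\<close>, told apart by the sign of their real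
  parts. The slits run from the branch points radially to infinity. The coordinate \<open>u = 1/z\<close> has slits that run
  from the branch points to \<open>z = 0\<close>, so together the two kinds of patches miss only the branch points, and there
  \<open>w\<close> is a coordinate.\<close>

definition slit :: "complex set" where
  "slit = {z. 1 + z ^ n \<notin> \<real>\<^sub>\<le>\<^sub>0}"

definition branch_points :: "complex set" where
  "branch_points = {\<zeta>. \<zeta> ^ n = -1}"

definition branch_root :: "complex \<Rightarrow> complex" where
  "branch_root w = exp (Ln (1 - w\<^sup>2) / of_nat n)"

definition z_patch :: "complex \<Rightarrow> surface_point set" where
  "z_patch \<sigma> = {q \<in> affine_part. 0 < Re (\<sigma> * snd q)}"

definition u_patch :: "complex \<Rightarrow> surface_point set" where
  "u_patch \<sigma> = {q \<in> far_part. 0 < Re (\<sigma> * v_coord q)}"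

definition w_patch :: "complex \<Rightarrow> surface_point set" where
  "w_patch \<zeta> = {q \<in> affine_part. norm (snd q) < 1 \<and> fst q = \<zeta> * branch_root (snd q)}"

definition z_param :: "complex \<Rightarrow> complex \<Rightarrow> surface_point" where
  "z_param \<sigma> z = (z, \<sigma> * csqrt (1 + z ^ n))"

definition u_param :: "complex \<Rightarrow> complex \<Rightarrow> surface_point" where
  "u_param \<sigma> u = from_uv u (\<sigma> * csqrt (1 + u ^ n))"

definition w_param :: "complex \<Rightarrow> complex \<Rightarrow> surface_point" where
  "w_param \<zeta> w = (\<zeta> * branch_root w, w)"

lemma open_slit: "open slit"
proof -
  have "open ((\<lambda>z::complex. 1 + z ^ n) -` (- \<real>\<^sub>\<le>\<^sub>0))"
    by (intro continuous_open_vimage continuous_intros) auto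
  then show ?thesis by (simp add: slit_def vimage_def)
qed

lemma slit_0: "0 \<in> slit" using m by (simp add: slit_def)

text \<open>The slit plane is starlike about 0: if \<open>1 + t\<^sup>n z\<^sup>n \<le> 0\<close> with \<open>0 < t \<le> 1\<close>, then \<open>z\<^sup>n\<close> is real and at most \<open>-1\<close>.\<close>

lemma connected_slit: "connected slit"
proof -
  have "starlike slit"
    unfolding starlike_def
  proof (intro bexI[of _ 0] ballI slit_0 subsetI)
    fix z y assume z: "z \<in> slit" and "y \<in> closed_segment 0 z"
    then obtain t where t: "0 \<le> t" "t \<le> 1" "y = t *\<^sub>R z" by (auto simp: in_segment)
    show "y \<in> slit"
    proof (rule ccontr)
      assume "y \<notin> slit"
      then have "1 + of_real (t ^ n) * z ^ n \<in> \<real>\<^sub>\<le>\<^sub>0"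
        by (simp add: slit_def t scaleR_conv_of_real power_mult_distrib)
      then obtain r where r: "r \<le> 0" "1 + of_real (t ^ n) * z ^ n = of_real r" by (auto simp: nonpos_Reals_def)
      have tn: "0 < t ^ n" "t ^ n \<le> 1"
      proof -
        have "t \<noteq> 0" using r m by (auto simp: complex_eq_iff power_0_left)
        then show "0 < t ^ n" using t(1) by simp
        show "t ^ n \<le> 1" using t by (intro power_le_one)
      qed
      have "of_real (t ^ n) * z ^ n = of_real (r - 1)" using r(2) by (simp add: algebra_simps)
      then have zn: "z ^ n = of_real ((r - 1) / t ^ n)"
      proof -
        have a: "complex_of_real (t ^ n) \<noteq> 0" using tn(1) by (simp only: of_real_eq_0_iff)
        have "z ^ n = (of_real (t ^ n) * z ^ n) / of_real (t ^ n)" by (rule nonzero_mult_div_cancel_left[OF a, symmetric])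
        also note \<open>of_real (t ^ n) * z ^ n = of_real (r - 1)\<close>
        finally show ?thesis by (simp only: of_real_divide)
      qed
      have "(r - 1) / t ^ n \<le> -1" using tn r(1) by (simp add: divide_le_eq)
      then have "1 + (r - 1) / t ^ n \<le> 0" by simp
      then have "of_real (1 + (r - 1) / t ^ n) \<in> \<real>\<^sub>\<le>\<^sub>0" by (simp only: nonpos_Reals_of_real_iff)
      then have "1 + z ^ n \<in> \<real>\<^sub>\<le>\<^sub>0" unfolding zn by (simp only: of_real_add of_real_1)
      then show False using z by (simp add: slit_def)
    qed
  qed
  then show ?thesis by (rule starlike_imp_connected)
qed

lemma Re_csqrt_pos: "x \<notin> \<real>\<^sub>\<le>\<^sub>0 \<Longrightarrow> 0 < Re (csqrt x)"
proof (rule ccontr)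
  assume x: "x \<notin> \<real>\<^sub>\<le>\<^sub>0" and "\<not> 0 < Re (csqrt x)"
  then have Re: "Re (csqrt x) = 0" using Re_csqrt[of x] by linarith
  obtain s where s: "s\<^sup>2 = x" "Re s = 0" using Re power2_csqrt by blast
  have "Re (s\<^sup>2) = (Re s)\<^sup>2 - (Im s)\<^sup>2" "Im (s\<^sup>2) = 2 * Re s * Im s" by (rule Re_power2, rule Im_power2)
  then show False using x s by (simp add: complex_nonpos_Reals_iff)
qed

definition is_patch :: "surface_point set \<Rightarrow> (surface_point \<Rightarrow> complex) \<Rightarrow> (complex \<Rightarrow> surface_point) \<Rightarrow> bool" where
  "is_patch U \<phi> \<rho> \<longleftrightarrow>
     (\<exists>\<sigma>\<in>{1,-1}. U = z_patch \<sigma> \<and> \<phi> = fst \<and> \<rho> = z_param \<sigma>) \<or>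
     (\<exists>\<sigma>\<in>{1,-1}. U = u_patch \<sigma> \<and> \<phi> = u_coord \<and> \<rho> = u_param \<sigma>) \<or>
     (\<exists>\<zeta>\<in>branch_points. U = w_patch \<zeta> \<and> \<phi> = snd \<and> \<rho> = w_param \<zeta>)"

lemma is_patch_cases [consumes 1, case_names z u w]:
  assumes "is_patch U \<phi> \<rho>"
  obtains \<sigma> where "\<sigma> = 1 \<or> \<sigma> = -1" "U = z_patch \<sigma>" "\<phi> = fst" "\<rho> = z_param \<sigma>"
    | \<sigma> where "\<sigma> = 1 \<or> \<sigma> = -1" "U = u_patch \<sigma>" "\<phi> = u_coord" "\<rho> = u_param \<sigma>"
    | \<zeta> where "\<zeta> \<in> branch_points" "U = w_patch \<zeta>" "\<phi> = snd" "\<rho> = w_param \<zeta>"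
  using assms unfolding is_patch_def by blast

lemma sign_square: "\<sigma> = 1 \<or> \<sigma> = -1 \<Longrightarrow> \<sigma>\<^sup>2 = (1::complex)" by auto

lemma signed_csqrt:
  assumes \<sigma>: "\<sigma> = 1 \<or> \<sigma> = (-1::complex)" and "0 < Re (\<sigma> * w)"
  shows "w\<^sup>2 \<notin> \<real>\<^sub>\<le>\<^sub>0" "\<sigma> * csqrt (w\<^sup>2) = w"
proof -
  have Re: "Re w \<noteq> 0" using assms by auto
  have sq: "Re (w\<^sup>2) = (Re w)\<^sup>2 - (Im w)\<^sup>2" "Im (w\<^sup>2) = 2 * Re w * Im w" by (rule Re_power2, rule Im_power2)
  show "w\<^sup>2 \<notin> \<real>\<^sub>\<le>\<^sub>0"
  proof
    assume "w\<^sup>2 \<in> \<real>\<^sub>\<le>\<^sub>0"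
    then have "Re (w\<^sup>2) \<le> 0" "Im w = 0" using sq Re by (auto simp: complex_nonpos_Reals_iff)
    then show False using sq Re by simp
  qed
  have "csqrt ((\<sigma> * w)\<^sup>2) = \<sigma> * w" using assms(2) by (intro csqrt_square) simp
  then have "csqrt (w\<^sup>2) = \<sigma> * w" using \<sigma> by auto
  then show "\<sigma> * csqrt (w\<^sup>2) = w" using \<sigma> by auto
qed

lemma z_param_slit:
  assumes \<sigma>: "\<sigma> = 1 \<or> \<sigma> = -1" and "z \<in> slit"
  shows "z_param \<sigma> z \<in> z_patch \<sigma>"
proof -
  have "0 < Re (csqrt (1 + z ^ n))" using assms(2) by (intro Re_csqrt_pos) (simp add: slit_def)
  then show ?thesis using \<sigma> by (auto simp: z_patch_def z_param_def affine_part_def)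
qed

lemma z_patch_coord:
  assumes \<sigma>: "\<sigma> = 1 \<or> \<sigma> = -1" and q: "q \<in> z_patch \<sigma>"
  shows "fst q \<in> slit" "z_param \<sigma> (fst q) = q"
proof -
  have "(snd q)\<^sup>2 = 1 + fst q ^ n" "0 < Re (\<sigma> * snd q)" using q by (auto simp: z_patch_def affine_part_def)
  with signed_csqrt[OF \<sigma> this(2)] show "fst q \<in> slit" "z_param \<sigma> (fst q) = q"
    by (auto simp: slit_def z_param_def)
qed

lemma fst_z_patch:
  assumes \<sigma>: "\<sigma> = 1 \<or> \<sigma> = -1" shows "fst ` z_patch \<sigma> = slit"
proof
  show "fst ` z_patch \<sigma> \<subseteq> slit" using z_patch_coord(1)[OF \<sigma>] by blast
  show "slit \<subseteq> fst ` z_patch \<sigma>"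
  proof
    fix z assume "z \<in> slit"
    then have "z_param \<sigma> z \<in> z_patch \<sigma>" by (rule z_param_slit[OF \<sigma>])
    moreover have "z = fst (z_param \<sigma> z)" by (simp add: z_param_def)
    ultimately show "z \<in> fst ` z_patch \<sigma>" by blast
  qed
qed

lemma u_param_slit:
  assumes \<sigma>: "\<sigma> = 1 \<or> \<sigma> = -1" and "u \<in> slit"
  shows "u_param \<sigma> u \<in> u_patch \<sigma>" "u_coord (u_param \<sigma> u) = u" "v_coord (u_param \<sigma> u) = \<sigma> * csqrt (1 + u ^ n)"
proof -
  have Re: "0 < Re (csqrt (1 + u ^ n))" using assms(2) by (intro Re_csqrt_pos) (simp add: slit_def)
  have rel: "(\<sigma> * csqrt (1 + u ^ n))\<^sup>2 = 1 + u ^ n" using \<sigma> by auto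
  note far = from_uv_far[OF rel]
  show "u_param \<sigma> u \<in> u_patch \<sigma>" "u_coord (u_param \<sigma> u) = u" "v_coord (u_param \<sigma> u) = \<sigma> * csqrt (1 + u ^ n)"
    using far Re \<sigma> by (auto simp: u_patch_def u_param_def)
qed

lemma u_patch_coord:
  assumes \<sigma>: "\<sigma> = 1 \<or> \<sigma> = -1" and q: "q \<in> u_patch \<sigma>"
  shows "u_coord q \<in> slit" "u_param \<sigma> (u_coord q) = q" "v_coord q = \<sigma> * csqrt (1 + u_coord q ^ n)"
proof -
  have far: "q \<in> far_part" and "0 < Re (\<sigma> * v_coord q)" using q by (auto simp: u_patch_def)
  note v = signed_csqrt[OF \<sigma> this(2)] uv_relation[OF far]
  show "u_coord q \<in> slit" using v by (simp add: slit_def)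
  show "v_coord q = \<sigma> * csqrt (1 + u_coord q ^ n)" using v by simp
  then show "u_param \<sigma> (u_coord q) = q" using from_uv_coords[OF far] by (simp add: u_param_def)
qed

lemma u_coord_u_patch:
  assumes \<sigma>: "\<sigma> = 1 \<or> \<sigma> = -1" shows "u_coord ` u_patch \<sigma> = slit"
proof
  show "u_coord ` u_patch \<sigma> \<subseteq> slit" using u_patch_coord(1)[OF \<sigma>] by blast
  show "slit \<subseteq> u_coord ` u_patch \<sigma>"
    using u_param_slit(1,2)[OF \<sigma>] by (metis image_eqI subsetI)
qed

lemma holomorphic_csqrt_slit: "(\<lambda>z. csqrt (1 + z ^ n)) holomorphic_on slit"
  by (intro holomorphic_intros) (auto simp: slit_def)

lemma one_minus_square_notin_nonpos: "norm (w::complex) < 1 \<Longrightarrow> 1 - w\<^sup>2 \<notin> \<real>\<^sub>\<le>\<^sub>0"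
proof
  assume w: "norm w < 1" and "1 - w\<^sup>2 \<in> \<real>\<^sub>\<le>\<^sub>0"
  then have "1 \<le> Re (w\<^sup>2)" by (simp add: complex_nonpos_Reals_iff)
  also have "\<dots> \<le> norm (w\<^sup>2)" by (rule complex_Re_le_cmod)
  also have "\<dots> < 1" using w by (simp add: norm_power power_less_one_iff)
  finally show False by simp
qed

lemma holomorphic_branch_root: "branch_root holomorphic_on ball 0 1"
  unfolding branch_root_def
  by (intro holomorphic_intros) (auto simp: one_minus_square_notin_nonpos)

lemma branch_root_power: "norm w < 1 \<Longrightarrow> branch_root w ^ n = 1 - w\<^sup>2"
proof -
  assume "norm w < 1"
  then have "1 - w\<^sup>2 \<noteq> 0" using one_minus_square_notin_nonpos by (metis nonpos_Reals_zero_I)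
  moreover have "branch_root w ^ n = exp (of_nat n * (Ln (1 - w\<^sup>2) / of_nat n))"
    unfolding branch_root_def by (rule exp_of_nat_mult[symmetric])
  moreover have "of_nat n * (Ln (1 - w\<^sup>2) / of_nat n) = Ln (1 - w\<^sup>2)" using m_nonzero by simp
  ultimately show ?thesis by simp
qed

lemma branch_root_nonzero: "branch_root w \<noteq> 0"
  by (simp add: branch_root_def)

lemma branch_point_nonzero: "\<zeta> \<in> branch_points \<Longrightarrow> \<zeta> \<noteq> 0"
  by (auto simp: branch_points_def)

lemma finite_branch_points: "finite branch_points" and card_branch_points: "card branch_points = n"
proof -
  have "(-1::complex) \<noteq> 0" "0 < n" by auto
  then show c: "card branch_points = n" unfolding branch_points_def by (rule card_nth_roots)
  then show "finite branch_points" by (metis card.infinite m_nonzero(1) mult_eq_0_iff zero_neq_numeral)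
qed

lemma w_param_patch:
  assumes "\<zeta> \<in> branch_points" "norm w < 1"
  shows "w_param \<zeta> w \<in> w_patch \<zeta>"
  using assms branch_root_power[OF assms(2)]
  by (auto simp: w_patch_def w_param_def affine_part_def power_mult_distrib branch_points_def)

lemma snd_w_patch: "\<zeta> \<in> branch_points \<Longrightarrow> snd ` w_patch \<zeta> = ball 0 1"
proof
  show "snd ` w_patch \<zeta> \<subseteq> ball 0 1" by (auto simp: w_patch_def)
  assume \<zeta>: "\<zeta> \<in> branch_points"
  show "ball 0 1 \<subseteq> snd ` w_patch \<zeta>"
  proof
    fix w :: complex assume "w \<in> ball 0 1"
    then have "w_param \<zeta> w \<in> w_patch \<zeta>" using w_param_patch[OF \<zeta>] by simp
    moreover have "w = snd (w_param \<zeta> w)" by (simp add: w_param_def)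
    ultimately show "w \<in> snd ` w_patch \<zeta>" by blast
  qed
qed

text \<open>Over \<open>w\<close> the curve has the points \<open>z = \<zeta> (1 - w\<^sup>2)\<^sup>1\<^sup>/\<^sup>n\<close>, one for each branch point \<open>\<zeta>\<close>. They stay
  apart, so each sheet is open.\<close>

lemma openin_w_patch:
  assumes \<zeta>: "\<zeta> \<in> branch_points" shows "openin curve_topology (w_patch \<zeta>)"
proof -
  let ?f = "\<lambda>q::surface_point. \<Prod>\<xi>\<in>branch_points - {\<zeta>}. (fst q - \<xi> * branch_root (snd q))"
  define V where "V = {q::surface_point. snd q \<in> ball 0 1 \<and> ?f q \<noteq> 0}"
  have "open V"
  proof -
    have "continuous_on (UNIV \<times> ball 0 1) ?f"
      by (intro continuous_intros continuous_on_compose2[OF holomorphic_on_imp_continuous_on[OF holomorphic_branch_root]]) auto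
    moreover have "open (UNIV \<times> ball 0 1 :: surface_point set)" by (intro open_Times) auto
    ultimately have "open ((UNIV \<times> ball 0 1) \<inter> ?f -` (- {0}))" by (intro continuous_open_preimage) auto
    moreover have "(UNIV \<times> ball 0 1) \<inter> ?f -` (- {0}) = V" by (auto simp: V_def)
    ultimately show ?thesis by simp
  qed
  moreover have "w_patch \<zeta> = {q \<in> affine_part. q \<in> V}"
  proof (intro equalityI subsetI)
    fix q assume q: "q \<in> w_patch \<zeta>"
    then have "fst q - \<xi> * branch_root (snd q) = (\<zeta> - \<xi>) * branch_root (snd q)" for \<xi>
      by (simp add: w_patch_def algebra_simps)
    then have "?f q \<noteq> 0" using finite_branch_points branch_root_nonzero by simp
    then show "q \<in> {q \<in> affine_part. q \<in> V}" using q by (simp add: w_patch_def V_def)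
  next
    fix q assume "q \<in> {q \<in> affine_part. q \<in> V}"
    then have q: "(snd q)\<^sup>2 = 1 + fst q ^ n" "norm (snd q) < 1" "?f q \<noteq> 0" "q \<in> affine_part"
      by (auto simp: V_def affine_part_def)
    define \<xi> where "\<xi> = fst q / branch_root (snd q)"
    have "fst q ^ n = - (1 - (snd q)\<^sup>2)" using q(1) by simp
    then have "\<xi> ^ n = - 1"
      unfolding \<xi>_def power_divide branch_root_power[OF q(2)]
      using one_minus_square_notin_nonpos[OF q(2)] by (metis divide_minus_left divide_self nonpos_Reals_zero_I)
    then have "\<xi> \<in> branch_points" by (simp add: branch_points_def)
    moreover have fq: "fst q = \<xi> * branch_root (snd q)" by (simp add: \<xi>_def branch_root_nonzero)
    moreover have "fst q - \<xi>' * branch_root (snd q) \<noteq> 0" if "\<xi>' \<in> branch_points - {\<zeta>}" for \<xi>'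
      using q(3) that finite_branch_points by simp
    ultimately have "\<xi> = \<zeta>" by (metis DiffI right_minus_eq singletonD)
    then show "q \<in> w_patch \<zeta>" using q fq by (simp add: w_patch_def)
  qed
  ultimately show ?thesis using openin_affine_preimage by simp
qed

lemma openin_z_patch: "openin curve_topology (z_patch \<sigma>)"
proof -
  have "open {q::surface_point. 0 < Re (\<sigma> * snd q)}" by (intro open_Collect_less continuous_intros)
  from openin_affine_preimage[OF this] show ?thesis by (simp add: z_patch_def)
qed

lemma openin_u_patch: "openin curve_topology (u_patch \<sigma>)"
proof -
  have "open {q::surface_point. 0 < Re (\<sigma> * snd q)}" by (intro open_Collect_less continuous_intros)
  from openin_far_preimage[OF this] show ?thesis by (simp add: u_patch_def)
qed

lemma continuous_map_z_param: "\<sigma> = 1 \<or> \<sigma> = -1 \<Longrightarrow> continuous_map (top_of_set slit) curve_topology (z_param \<sigma>)"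
  unfolding z_param_def
  using holomorphic_on_imp_continuous_on[OF holomorphic_csqrt_slit]
  by (intro continuous_map_zw continuous_intros) auto

lemma continuous_map_u_param: "\<sigma> = 1 \<or> \<sigma> = -1 \<Longrightarrow> continuous_map (top_of_set slit) curve_topology (u_param \<sigma>)"
  unfolding u_param_def
  using holomorphic_on_imp_continuous_on[OF holomorphic_csqrt_slit]
  by (intro continuous_map_uv continuous_intros) auto

lemma continuous_map_w_param:
  assumes "\<zeta> \<in> branch_points"
  shows "continuous_map (top_of_set (ball 0 1)) curve_topology (w_param \<zeta>)"
  unfolding w_param_def
proof (rule continuous_map_zw)
  show "continuous_on (ball 0 1) (\<lambda>w. \<zeta> * branch_root w)"
    using holomorphic_on_imp_continuous_on[OF holomorphic_branch_root] by (intro continuous_intros)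
  show "w\<^sup>2 = 1 + (\<zeta> * branch_root w) ^ n" if "w \<in> ball 0 1" for w
    using w_param_patch[OF assms, of w] that by (simp add: w_param_def w_patch_def affine_part_def)
qed (intro continuous_intros)

lemma is_patch_properties:
  assumes "is_patch U \<phi> \<rho>"
  shows openin_patch: "openin curve_topology U"
    and open_patch_image: "open (\<phi> ` U)"
    and continuous_map_patch_param: "continuous_map (top_of_set (\<phi> ` U)) curve_topology \<rho>"
    and continuous_map_patch_coord: "continuous_map (subtopology curve_topology U) euclidean \<phi>"
    and patch_param_coord: "\<And>q. q \<in> U \<Longrightarrow> \<rho> (\<phi> q) = q"
proof -
  have proj: "continuous_map euclidean euclidean (fst :: surface_point \<Rightarrow> complex)"
    "continuous_map euclidean euclidean (snd :: surface_point \<Rightarrow> complex)"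
    by (auto intro: continuous_on_fst continuous_on_snd continuous_on_id)
  have fst: "continuous_map (subtopology curve_topology U) euclidean fst"
    and snd: "continuous_map (subtopology curve_topology U) euclidean snd" if "U \<subseteq> affine_part"
  proof -
    have "continuous_map (subtopology curve_topology U) euclidean (\<lambda>q. q)"
      using continuous_map_affine_coords that by (rule continuous_map_from_subtopology_mono)
    from continuous_map_compose[OF this proj(1)] continuous_map_compose[OF this proj(2)]
    show "continuous_map (subtopology curve_topology U) euclidean fst"
      "continuous_map (subtopology curve_topology U) euclidean snd" by (simp_all add: o_def)
  qed
  have u: "continuous_map (subtopology curve_topology U) euclidean u_coord" if "U \<subseteq> far_part"
  proof -
    have "continuous_map (subtopology curve_topology U) euclidean (\<lambda>q. (u_coord q, v_coord q))"
      using continuous_map_uv_coords that by (rule continuous_map_from_subtopology_mono)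
    from continuous_map_compose[OF this proj(1)] show ?thesis by (simp add: o_def)
  qed
  have "openin curve_topology U \<and> open (\<phi> ` U) \<and> continuous_map (top_of_set (\<phi> ` U)) curve_topology \<rho> \<and>
    continuous_map (subtopology curve_topology U) euclidean \<phi> \<and> (\<forall>q\<in>U. \<rho> (\<phi> q) = q)"
    using assms
  proof (cases rule: is_patch_cases)
    case (z \<sigma>)
    have "U \<subseteq> affine_part" by (auto simp: z z_patch_def)
    then show ?thesis
      using fst by (simp add: z openin_z_patch fst_z_patch open_slit continuous_map_z_param z_patch_coord)
  next
    case (u \<sigma>)
    have "U \<subseteq> far_part" by (auto simp: u u_patch_def)
    with \<open>U \<subseteq> far_part \<Longrightarrow> continuous_map (subtopology curve_topology U) euclidean u_coord\<close> show ?thesis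
      by (simp add: u openin_u_patch u_coord_u_patch open_slit continuous_map_u_param u_patch_coord)
  next
    case (w \<zeta>)
    have "U \<subseteq> affine_part" by (auto simp: w w_patch_def)
    moreover have "w_param \<zeta> (snd q) = q" if "q \<in> w_patch \<zeta>" for q
      using that by (simp add: w_patch_def w_param_def prod_eq_iff)
    ultimately show ?thesis
      using snd w(1) by (simp add: w(2-4) openin_w_patch snd_w_patch continuous_map_w_param)
  qed
  then show "openin curve_topology U" "open (\<phi> ` U)" "continuous_map (top_of_set (\<phi> ` U)) curve_topology \<rho>"
    "continuous_map (subtopology curve_topology U) euclidean \<phi>" "\<And>q. q \<in> U \<Longrightarrow> \<rho> (\<phi> q) = q" by auto
qed

text \<open>All open subsets of the patches are admitted as chart domains, so that the charts of the
  punctured curve are among those of the curve.\<close>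

definition curve_charts :: "surface_point chart set" where
  "curve_charts = {c. \<exists>U \<rho>. is_patch U (snd c) \<rho> \<and> fst c \<subseteq> U \<and> openin curve_topology (fst c)}"

definition curve_surface :: "surface_point surface" where
  "curve_surface = \<lparr> stop = curve_topology, atlas = curve_charts \<rparr>"

lemma curve_surface_simps [simp]: "stop curve_surface = curve_topology" "atlas curve_surface = curve_charts"
  by (simp_all add: curve_surface_def)

lemma curve_charts_restrict:
  "c \<in> curve_charts \<Longrightarrow> openin curve_topology V \<Longrightarrow> V \<subseteq> fst c \<Longrightarrow> (V, snd c) \<in> curve_charts"
  unfolding curve_charts_def by force

lemma curve_chart_param:
  assumes "is_patch U (snd c) \<rho>" "fst c \<subseteq> U" "q \<in> fst c"
  shows "param c (snd c q) = q" "\<rho> (snd c q) = q"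
proof -
  have r: "\<rho> (snd c q) = q" if "q \<in> fst c" for q using patch_param_coord[OF assms(1)] assms(2) that by blast
  then have "inj_on (snd c) (fst c)" by (metis inj_onI)
  then show "param c (snd c q) = q" using assms(3) by simp
  show "\<rho> (snd c q) = q" by (rule r[OF assms(3)])
qed

lemma open_curve_chart_image:
  assumes "c \<in> curve_charts" shows "open (chart_image c)"
proof -
  obtain U \<rho> where U: "is_patch U (snd c) \<rho>" "fst c \<subseteq> U" "openin curve_topology (fst c)"
    using assms by (auto simp: curve_charts_def)
  have "chart_image c = {z \<in> topspace (top_of_set (snd c ` U)). \<rho> z \<in> fst c}"
    using curve_chart_param(2)[OF U(1,2)] patch_param_coord[OF U(1)] U(2) by auto
  moreover have "openin (top_of_set (snd c ` U)) {z \<in> topspace (top_of_set (snd c ` U)). \<rho> z \<in> fst c}"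
    using continuous_map_patch_param[OF U(1)] U(3) by (rule openin_continuous_map_preimage)
  ultimately show ?thesis using open_patch_image[OF U(1)] by (simp add: openin_open_eq)
qed

lemma is_chart_curve:
  assumes c: "c \<in> curve_charts" shows "is_chart curve_topology c"
  unfolding is_chart_def
proof (intro conjI)
  obtain U \<rho> where U: "is_patch U (snd c) \<rho>" "fst c \<subseteq> U" "openin curve_topology (fst c)"
    using c by (auto simp: curve_charts_def)
  show "openin curve_topology (fst c)" by (rule U(3))
  show "open (chart_image c)" by (rule open_curve_chart_image[OF c])
  have "homeomorphic_maps (subtopology curve_topology (fst c)) (top_of_set (chart_image c)) (snd c) \<rho>"
    unfolding homeomorphic_maps_def
  proof (intro conjI ballI)
    show "continuous_map (subtopology curve_topology (fst c)) (top_of_set (chart_image c)) (snd c)"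
      using continuous_map_from_subtopology_mono[OF continuous_map_patch_coord[OF U(1)] U(2)]
      by (auto simp: continuous_map_in_subtopology)
    show "continuous_map (top_of_set (chart_image c)) (subtopology curve_topology (fst c)) \<rho>"
      using continuous_map_from_subtopology_mono[OF continuous_map_patch_param[OF U(1)] image_mono[OF U(2)]]
        curve_chart_param(2)[OF U(1,2)]
      by (auto simp: continuous_map_in_subtopology)
  qed (use curve_chart_param(2)[OF U(1,2)] in auto)
  then show "homeomorphic_map (subtopology curve_topology (fst c)) (top_of_set (chart_image c)) (snd c)"
    using homeomorphic_map_maps by blast
qed

lemma eventually_curve_param:
  assumes c: "c \<in> curve_charts" and "q \<in> fst c" "openin curve_topology W" "q \<in> W"
  shows "\<forall>\<^sub>F z in nhds (snd c q). z \<in> chart_image c \<and> param c z \<in> W"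
proof -
  obtain U \<rho> where U: "is_patch U (snd c) \<rho>" "fst c \<subseteq> U" "openin curve_topology (fst c)"
    using c by (auto simp: curve_charts_def)
  have "(fst c \<inter> W, snd c) \<in> curve_charts"
    using U(3) assms(3) by (intro curve_charts_restrict[OF c]) auto
  then have "open (snd c ` (fst c \<inter> W))" using open_curve_chart_image by force
  then have "\<forall>\<^sub>F z in nhds (snd c q). z \<in> snd c ` (fst c \<inter> W)"
    using assms by (intro eventually_nhds_in_open) auto
  then show ?thesis
    by eventually_elim (use curve_chart_param(1)[OF U(1,2)] in auto)
qed

lemma analytic_eventually_eq:
  fixes f g :: "complex \<Rightarrow> complex"
  assumes "g analytic_on {x}" "\<forall>\<^sub>F z in nhds x. f z = g z"
  shows "f analytic_on {x}"
  using assms analytic_at_cong[of f g x x] by simp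

lemma fst_nonzero_far: "q \<in> affine_part \<Longrightarrow> q \<in> far_part \<longleftrightarrow> fst q \<noteq> 0"
  using not_affine_infinite[of q] affine_subset by (auto simp: far_part_def)

lemma u_coord_affine: "q \<in> affine_part \<Longrightarrow> u_coord q = 1 / fst q"
  and v_coord_affine: "q \<in> affine_part \<Longrightarrow> v_coord q = snd q / fst q ^ m"
  using not_affine_infinite[of q] by (auto simp: u_coord_def v_coord_def)

lemma openin_affine_far: "openin curve_topology (affine_part \<inter> far_part)"
  using openin_affine openin_far by blast

text \<open>Each patch has one pair among \<open>(z, w)\<close> and \<open>(u, v)\<close> given by explicit analytic functions of its coordinate. The other
  pair consists of quotients of these wherever both are defined.\<close>

lemma analytic_curve_coords:
  assumes c: "c \<in> curve_charts" and q: "q \<in> fst c"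
  shows analytic_fst: "q \<in> affine_part \<Longrightarrow> (fst \<circ> param c) analytic_on {snd c q}"
    and analytic_snd: "q \<in> affine_part \<Longrightarrow> (snd \<circ> param c) analytic_on {snd c q}"
    and analytic_u: "q \<in> far_part \<Longrightarrow> (u_coord \<circ> param c) analytic_on {snd c q}"
    and analytic_v: "q \<in> far_part \<Longrightarrow> (v_coord \<circ> param c) analytic_on {snd c q}"
proof -
  obtain U \<rho> where U: "is_patch U (snd c) \<rho>" "fst c \<subseteq> U" "openin curve_topology (fst c)"
    using c by (auto simp: curve_charts_def)
  note par = curve_chart_param[OF U(1,2)]
  have param_q: "param c (snd c q) = q" by (rule par(1)[OF q])
  have near: "\<forall>\<^sub>F z in nhds (snd c q). z \<in> chart_image c \<and> param c z \<in> W" if "openin curve_topology W" "q \<in> W" for W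
    by (rule eventually_curve_param[OF c q that])
  have ev: "\<forall>\<^sub>F z in nhds (snd c q). z \<in> chart_image c \<and> param c z = \<rho> z"
    using near[OF U(3) q] by eventually_elim (use par in auto)
  have zw_uv: "(u_coord \<circ> param c) analytic_on {snd c q} \<and> (v_coord \<circ> param c) analytic_on {snd c q}"
    if "(fst \<circ> param c) analytic_on {snd c q}" "(snd \<circ> param c) analytic_on {snd c q}" "q \<in> affine_part \<inter> far_part"
  proof
    have e: "\<forall>\<^sub>F z in nhds (snd c q). param c z \<in> affine_part \<inter> far_part"
      using near[OF openin_affine_far that(3)] by eventually_elim simp
    have nz: "(fst \<circ> param c) (snd c q) \<noteq> 0" using that(3) fst_nonzero_far[of q] by (auto simp: param_q)
    have "(\<lambda>z. 1 / (fst \<circ> param c) z) analytic_on {snd c q}"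
      using nz by (intro analytic_intros that) auto
    then show "(u_coord \<circ> param c) analytic_on {snd c q}"
      by (rule analytic_eventually_eq) (use e in eventually_elim, simp add: u_coord_affine)
    have "(\<lambda>z. (snd \<circ> param c) z / (fst \<circ> param c) z ^ m) analytic_on {snd c q}"
      using nz by (intro analytic_intros that) auto
    then show "(v_coord \<circ> param c) analytic_on {snd c q}"
      by (rule analytic_eventually_eq) (use e in eventually_elim, simp add: v_coord_affine)
  qed
  have uv_zw: "(fst \<circ> param c) analytic_on {snd c q} \<and> (snd \<circ> param c) analytic_on {snd c q}"
    if "(u_coord \<circ> param c) analytic_on {snd c q}" "(v_coord \<circ> param c) analytic_on {snd c q}" "q \<in> affine_part \<inter> far_part"
  proof
    have e: "\<forall>\<^sub>F z in nhds (snd c q). param c z \<in> affine_part \<inter> far_part"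
      using near[OF openin_affine_far that(3)] by eventually_elim simp
    have nz: "(u_coord \<circ> param c) (snd c q) \<noteq> 0"
      using that(3) fst_nonzero_far[of q] by (auto simp: param_q u_coord_affine)
    have "(\<lambda>z. 1 / (u_coord \<circ> param c) z) analytic_on {snd c q}"
      using nz by (intro analytic_intros that) auto
    then show "(fst \<circ> param c) analytic_on {snd c q}"
      by (rule analytic_eventually_eq) (use e in eventually_elim, simp add: u_coord_affine)
    have "(\<lambda>z. (v_coord \<circ> param c) z / (u_coord \<circ> param c) z ^ m) analytic_on {snd c q}"
      using nz by (intro analytic_intros that) auto
    then show "(snd \<circ> param c) analytic_on {snd c q}"
      by (rule analytic_eventually_eq)
         (use e in eventually_elim, auto simp: u_coord_affine v_coord_affine fst_nonzero_far power_divide)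
  qed
  have "(q \<in> affine_part \<longrightarrow> (fst \<circ> param c) analytic_on {snd c q} \<and> (snd \<circ> param c) analytic_on {snd c q}) \<and>
    (q \<in> far_part \<longrightarrow> (u_coord \<circ> param c) analytic_on {snd c q} \<and> (v_coord \<circ> param c) analytic_on {snd c q})"
    using U(1)
  proof (cases rule: is_patch_cases)
    case (z \<sigma>)
    have qU: "q \<in> z_patch \<sigma>" using q U(2) z by blast
    have slit: "snd c q \<in> slit" using z_patch_coord(1)[OF z(1) qU] z(3) by simp
    have f: "(fst \<circ> param c) analytic_on {snd c q}"
    proof (rule analytic_eventually_eq[of "\<lambda>z. z"])
      show "\<forall>\<^sub>F z in nhds (snd c q). (fst \<circ> param c) z = z"
        using ev by eventually_elim (simp add: z z_param_def)
    qed (intro analytic_intros)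
    have "(\<lambda>z. \<sigma> * csqrt (1 + z ^ n)) analytic_on {snd c q}"
      using slit by (intro analytic_intros) (auto simp: slit_def)
    then have g: "(snd \<circ> param c) analytic_on {snd c q}"
    proof (rule analytic_eventually_eq)
      show "\<forall>\<^sub>F z in nhds (snd c q). (snd \<circ> param c) z = \<sigma> * csqrt (1 + z ^ n)"
        using ev by eventually_elim (simp add: z z_param_def)
    qed
    show ?thesis using f g zw_uv qU by (auto simp: z_patch_def)
  next
    case (u \<sigma>)
    have qU: "q \<in> u_patch \<sigma>" using q U(2) u by blast
    have slit: "snd c q \<in> slit" using u_patch_coord(1)[OF u(1) qU] u(3) by simp
    have near_slit: "\<forall>\<^sub>F z in nhds (snd c q). z \<in> slit" using slit open_slit by (rule eventually_nhds_in_open[rotated])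
    have f: "(u_coord \<circ> param c) analytic_on {snd c q}"
    proof (rule analytic_eventually_eq[of "\<lambda>z. z"])
      show "\<forall>\<^sub>F z in nhds (snd c q). (u_coord \<circ> param c) z = z"
        using ev near_slit by eventually_elim (use u_param_slit[OF u(1)] in \<open>simp add: u\<close>)
    qed (intro analytic_intros)
    have g: "(v_coord \<circ> param c) analytic_on {snd c q}"
    proof (rule analytic_eventually_eq)
      show "(\<lambda>z. \<sigma> * csqrt (1 + z ^ n)) analytic_on {snd c q}"
        using slit by (intro analytic_intros) (auto simp: slit_def)
      show "\<forall>\<^sub>F z in nhds (snd c q). (v_coord \<circ> param c) z = \<sigma> * csqrt (1 + z ^ n)"
        using ev near_slit by eventually_elim (use u_param_slit[OF u(1)] in \<open>simp add: u\<close>)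
    qed
    show ?thesis using f g uv_zw qU by (auto simp: u_patch_def)
  next
    case (w \<zeta>)
    have qU: "q \<in> w_patch \<zeta>" using q U(2) w by blast
    have disc: "snd c q \<in> ball 0 1" using qU w(3) by (simp add: w_patch_def)
    have "(\<lambda>w. \<zeta> * branch_root w) analytic_on {snd c q}"
      using holomorphic_branch_root disc by (intro analytic_intros) (auto simp: analytic_at intro!: exI[of _ "ball 0 1"])
    then have f: "(fst \<circ> param c) analytic_on {snd c q}"
    proof (rule analytic_eventually_eq)
      show "\<forall>\<^sub>F z in nhds (snd c q). (fst \<circ> param c) z = \<zeta> * branch_root z"
        using ev by eventually_elim (simp add: w w_param_def)
    qed
    have g: "(snd \<circ> param c) analytic_on {snd c q}"
    proof (rule analytic_eventually_eq[of "\<lambda>z. z"])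
      show "\<forall>\<^sub>F z in nhds (snd c q). (snd \<circ> param c) z = z"
        using ev by eventually_elim (simp add: w w_param_def)
    qed (intro analytic_intros)
    show ?thesis using f g zw_uv qU by (auto simp: w_patch_def)
  qed
  then show "q \<in> affine_part \<Longrightarrow> (fst \<circ> param c) analytic_on {snd c q}"
    "q \<in> affine_part \<Longrightarrow> (snd \<circ> param c) analytic_on {snd c q}"
    "q \<in> far_part \<Longrightarrow> (u_coord \<circ> param c) analytic_on {snd c q}"
    "q \<in> far_part \<Longrightarrow> (v_coord \<circ> param c) analytic_on {snd c q}" by auto
qed

lemma curve_chart_cases:
  assumes "c \<in> curve_charts"
  shows "snd c = fst \<and> fst c \<subseteq> affine_part \<or> snd c = snd \<and> fst c \<subseteq> affine_part \<or> snd c = u_coord \<and> fst c \<subseteq> far_part"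
proof -
  obtain U \<rho> where U: "is_patch U (snd c) \<rho>" "fst c \<subseteq> U" using assms by (auto simp: curve_charts_def)
  from U(1) show ?thesis
    by (cases rule: is_patch_cases) (use U(2) in \<open>auto simp: z_patch_def u_patch_def w_patch_def\<close>)
qed

lemma curve_transition_holomorphic:
  assumes c: "c \<in> curve_charts" and d: "d \<in> curve_charts"
  shows "transition c d holomorphic_on snd c ` (fst c \<inter> fst d)"
proof -
  have "transition c d analytic_on {z}" if "z \<in> snd c ` (fst c \<inter> fst d)" for z
    using curve_chart_cases[OF d] that analytic_curve_coords[OF c] by (auto simp: transition_def)
  then have "transition c d analytic_on snd c ` (fst c \<inter> fst d)"
    using analytic_on_analytic_at by blast
  then show ?thesis by (rule analytic_imp_holomorphic)
qed

text \<open>If \<open>Re w = 0\<close> but \<open>w \<noteq> 0\<close>, then \<open>w\<^sup>2 = -r\<close> with \<open>r > 0\<close>, so \<open>z\<^sup>n = -(1 + r)\<close> and \<open>v\<^sup>2 = w\<^sup>2 / z\<^sup>n = r/(1 + r)\<close> is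
  positive. Hence \<open>Re v \<noteq> 0\<close>, and the point is in a patch around infinity.\<close>

lemma patches_cover:
  assumes "q \<in> curve"
  shows "\<exists>U \<phi> \<rho>. is_patch U \<phi> \<rho> \<and> q \<in> U"
proof -
  have u: "\<exists>U \<phi> \<rho>. is_patch U \<phi> \<rho> \<and> q \<in> U" if "q \<in> far_part" "Re (v_coord q) \<noteq> 0"
  proof -
    have "\<exists>\<sigma>\<in>{1,-1}. q \<in> u_patch \<sigma>" using that by (auto simp: u_patch_def)
    then show ?thesis unfolding is_patch_def by blast
  qed
  show ?thesis
  proof (cases "q \<in> affine_part")
    case False
    then have "q \<in> infinite_points" using assms by (simp add: curve_def)
    then have "q \<in> far_part" "Re (v_coord q) \<noteq> 0"
      using assms by (auto simp: far_part_def v_coord_def infinite_points_def)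
    then show ?thesis by (rule u)
  next
    case True
    consider "Re (snd q) \<noteq> 0" | "Re (snd q) = 0" "snd q \<noteq> 0" | "snd q = 0" by blast
    then show ?thesis
    proof cases
      case 1
      then have "\<exists>\<sigma>\<in>{1,-1}. q \<in> z_patch \<sigma>" using True by (auto simp: z_patch_def)
      then show ?thesis unfolding is_patch_def by blast
    next
      case 2
      define r where "r = (Im (snd q))\<^sup>2"
      have r: "0 < r" using 2 by (auto simp: r_def complex_eq_iff)
      have "(snd q)\<^sup>2 = - of_real r"
        using 2(1) by (simp add: complex_eq_iff r_def power2_eq_square)
      then have zn: "fst q ^ n = - of_real (1 + r)" using True by (simp add: affine_part_def algebra_simps)
      have nz: "fst q \<noteq> 0"
      proof
        assume "fst q = 0"
        then have "- of_real (1 + r) = (0::complex)" unfolding zn[symmetric] by simp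
        then have "of_real (1 + r) = (0::complex)" by (simp only: neg_equal_0_iff_equal)
        then have "1 + r = 0" by (simp only: of_real_eq_0_iff)
        then show False using r by simp
      qed
      then have far: "q \<in> far_part" using True fst_nonzero_far by blast
      have "(v_coord q)\<^sup>2 = (snd q)\<^sup>2 / fst q ^ n"
        by (simp add: v_coord_affine[OF True] power_divide mult.commute flip: power_mult)
      also have "\<dots> = of_real (r / (1 + r))"
        unfolding zn \<open>(snd q)\<^sup>2 = - of_real r\<close> by (simp only: minus_divide_divide of_real_divide)
      finally have v2: "(v_coord q)\<^sup>2 = of_real (r / (1 + r))" .
      have "Re (v_coord q) \<noteq> 0"
      proof
        assume "Re (v_coord q) = 0"
        then have "Re ((v_coord q)\<^sup>2) \<le> 0" by (simp only: Re_power2) simp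
        then have "r / (1 + r) \<le> 0" unfolding v2 by (simp only: Re_complex_of_real)
        moreover have "0 < r / (1 + r)" using r by simp
        ultimately show False by linarith
      qed
      then show ?thesis by (rule u[OF far])
    next
      case 3
      then have "1 + fst q ^ n = 0" using True by (simp add: affine_part_def)
      then have "fst q \<in> branch_points" by (simp add: branch_points_def add_eq_0_iff)
      moreover from 3 True have "q \<in> w_patch (fst q)" by (simp add: w_patch_def branch_root_def)
      ultimately show ?thesis unfolding is_patch_def by blast
    qed
  qed
qed

lemma patch_in_curve_charts: "is_patch U \<phi> \<rho> \<Longrightarrow> (U, \<phi>) \<in> curve_charts"
  unfolding curve_charts_def using openin_patch by auto

lemma patch_subset: "is_patch U \<phi> \<rho> \<Longrightarrow> U \<subseteq> curve"
  using openin_patch openin_subset by fastforce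

lemma Union_curve_charts: "\<Union> (fst ` curve_charts) = curve"
proof
  show "\<Union> (fst ` curve_charts) \<subseteq> curve"
    unfolding curve_charts_def using openin_subset by fastforce
  show "curve \<subseteq> \<Union> (fst ` curve_charts)"
  proof
    fix q assume "q \<in> curve"
    then obtain U \<phi> \<rho> where U: "is_patch U \<phi> \<rho>" "q \<in> U" using patches_cover by blast
    have "fst (U, \<phi>) \<in> fst ` curve_charts" by (rule imageI[OF patch_in_curve_charts[OF U(1)]])
    then show "q \<in> \<Union> (fst ` curve_charts)" using U(2) by auto
  qed
qed

lemma is_patch_z: "\<sigma> = 1 \<or> \<sigma> = -1 \<Longrightarrow> is_patch (z_patch \<sigma>) fst (z_param \<sigma>)"
  and is_patch_u: "\<sigma> = 1 \<or> \<sigma> = -1 \<Longrightarrow> is_patch (u_patch \<sigma>) u_coord (u_param \<sigma>)"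
  and is_patch_w: "\<zeta> \<in> branch_points \<Longrightarrow> is_patch (w_patch \<zeta>) snd (w_param \<zeta>)"
  unfolding is_patch_def by blast+

lemma connectedin_patch:
  assumes "is_patch U \<phi> \<rho>" shows "connectedin curve_topology U"
proof -
  have "connected (\<phi> ` U)"
    using assms
    by (cases rule: is_patch_cases)
       (simp_all add: fst_z_patch u_coord_u_patch snd_w_patch connected_slit)
  then have "connectedin curve_topology (\<rho> ` \<phi> ` U)"
    by (intro connectedin_continuous_map_image[OF continuous_map_patch_param[OF assms]])
       (simp add: connectedin_subtopology)
  moreover have "\<rho> ` \<phi> ` U = U" using patch_param_coord[OF assms] by force
  ultimately show ?thesis by simp
qed

text \<open>The branch discs join the two sheets over the slit plane, and each of the two patches around
  infinity meets one of these sheets over \<open>z = 1\<close>.\<close>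

lemma connected_curve: "connected_space curve_topology"
proof -
  have half: "w_param \<zeta> (1/2) \<in> w_patch \<zeta> \<inter> z_patch 1" "w_param \<zeta> (-1/2) \<in> w_patch \<zeta> \<inter> z_patch (-1)"
    if "\<zeta> \<in> branch_points" for \<zeta>
    using w_param_patch[OF that, of "1/2"] w_param_patch[OF that, of "-1/2"]
    by (auto simp: z_patch_def w_patch_def w_param_def)
  have one: "(1, \<sigma> * of_real (sqrt 2)) \<in> z_patch \<sigma> \<inter> u_patch \<sigma>" if "\<sigma> = 1 \<or> \<sigma> = -1" for \<sigma>
  proof -
    have aff: "(1, \<sigma> * of_real (sqrt 2)) \<in> affine_part"
    proof -
      have "(\<sigma> * of_real (sqrt 2))\<^sup>2 = \<sigma>\<^sup>2 * of_real ((sqrt 2)\<^sup>2)" by (simp only: power_mult_distrib of_real_power)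
      then show ?thesis using sign_square[OF that] by (simp add: affine_part_def)
    qed
    then have "(1, \<sigma> * of_real (sqrt 2)) \<in> far_part" using fst_nonzero_far by simp
    moreover have "0 < Re (\<sigma> * (\<sigma> * of_real (sqrt 2)))" using that by auto
    ultimately show ?thesis using aff by (simp add: z_patch_def u_patch_def v_coord_affine)
  qed
  obtain \<zeta>0 where \<zeta>0: "\<zeta>0 \<in> branch_points"
    using card_branch_points m_nonzero by (metis all_not_in_conv card.empty mult_eq_0_iff zero_neq_numeral)
  define Y where "Y = (z_patch 1 \<union> w_patch \<zeta>0) \<union> z_patch (-1)"
  have Y: "connectedin curve_topology Y"
    unfolding Y_def using half[OF \<zeta>0] \<zeta>0
    by (intro connectedin_Un connectedin_patch[OF is_patch_z] connectedin_patch[OF is_patch_w]) auto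
  have YU: "connectedin curve_topology (Y \<union> U)" if U: "is_patch U \<phi> \<rho>" for U \<phi> \<rho>
  proof (rule connectedin_Un[OF Y connectedin_patch[OF U]])
    show "Y \<inter> U \<noteq> {}"
      using U
    proof (cases rule: is_patch_cases)
      case (z \<sigma>)
      then have "(1, \<sigma> * of_real (sqrt 2)) \<in> Y \<inter> U" using one[of \<sigma>] by (auto simp: Y_def)
      then show ?thesis by blast
    next
      case (u \<sigma>)
      then have "(1, \<sigma> * of_real (sqrt 2)) \<in> Y \<inter> U" using one[of \<sigma>] by (auto simp: Y_def)
      then show ?thesis by blast
    next
      case (w \<zeta>)
      then have "w_param \<zeta> (1/2) \<in> Y \<inter> U" using half[of \<zeta>] by (auto simp: Y_def)
      then show ?thesis by blast
    qed
  qed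
  have "connectedin curve_topology (\<Union> {Y \<union> U | U. \<exists>\<phi> \<rho>. is_patch U \<phi> \<rho>})"
  proof (rule connectedin_Union)
    show "connectedin curve_topology S" if "S \<in> {Y \<union> U | U. \<exists>\<phi> \<rho>. is_patch U \<phi> \<rho>}" for S
      using that YU by blast
    have "w_param \<zeta>0 (1/2) \<in> Y" using half[OF \<zeta>0] by (auto simp: Y_def)
    then have "w_param \<zeta>0 (1/2) \<in> \<Inter> {Y \<union> U | U. \<exists>\<phi> \<rho>. is_patch U \<phi> \<rho>}" by blast
    then show "\<Inter> {Y \<union> U | U. \<exists>\<phi> \<rho>. is_patch U \<phi> \<rho>} \<noteq> {}" by blast
  qed
  moreover have "\<Union> {Y \<union> U | U. \<exists>\<phi> \<rho>. is_patch U \<phi> \<rho>} = curve"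
  proof
    have "Y \<subseteq> curve" using connectedin_subset_topspace[OF Y] by simp
    then show "\<Union> {Y \<union> U | U. \<exists>\<phi> \<rho>. is_patch U \<phi> \<rho>} \<subseteq> curve" using patch_subset by blast
    show "curve \<subseteq> \<Union> {Y \<union> U | U. \<exists>\<phi> \<rho>. is_patch U \<phi> \<rho>}"
    proof
      fix q assume "q \<in> curve"
      then obtain U \<phi> \<rho> where U: "is_patch U \<phi> \<rho>" "q \<in> U" using patches_cover by blast
      have "Y \<union> U \<in> {Y \<union> U | U. \<exists>\<phi> \<rho>. is_patch U \<phi> \<rho>}" using U(1) by blast
      moreover have "q \<in> Y \<union> U" using U(2) by blast
      ultimately show "q \<in> \<Union> {Y \<union> U | U. \<exists>\<phi> \<rho>. is_patch U \<phi> \<rho>}" by (rule UnionI)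
    qed
  qed
  ultimately show ?thesis using connectedin_topspace[of curve_topology] by simp
qed

lemma connected_riemann_surface_curve: "connected_riemann_surface curve_surface"
  unfolding connected_riemann_surface_def
proof (intro conjI ballI)
  have "(0, 2) \<in> curve" by (simp add: curve_def infinite_points_def)
  then show "points curve_surface \<noteq> {}" by auto
qed (simp_all add: connected_curve Hausdorff_curve is_chart_curve Union_curve_charts curve_transition_holomorphic)

end

sublocale hyperelliptic \<subseteq> curve: riemann_surface curve_surface
  by unfold_locales (rule connected_riemann_surface_curve)

section \<open>Holomorphic forms on the hyperelliptic curve\<close>

context hyperelliptic
begin

lemma curve_chart_self_param: "c \<in> curve_charts \<Longrightarrow> q \<in> fst c \<Longrightarrow> param c (snd c q) = q"
  using curve.param_chart by simp

lemma has_derivative_coord: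
  assumes "(f \<circ> param c) analytic_on {snd c q}"
  shows "((\<lambda>z. f (param c z)) has_field_derivative differential f c q) (at (snd c q))"
  using analytic_derivI[OF assms] by (simp add: differential_def o_def)

lemma analytic_differential:
  assumes c: "c \<in> curve_charts" "q \<in> fst c" and f: "(f \<circ> param c) analytic_on {snd c q}"
  shows "(\<lambda>z. differential f c (param c z)) analytic_on {snd c q}"
proof (rule analytic_eventually_eq[OF analytic_deriv[OF f]])
  have "\<forall>\<^sub>F z in nhds (snd c q). z \<in> chart_image c"
    using c open_curve_chart_image[OF c(1)] by (intro eventually_nhds_in_open) auto
  then show "\<forall>\<^sub>F z in nhds (snd c q). differential f c (param c z) = deriv (f \<circ> param c) z"
    by eventually_elim (simp only: differential_def curve.chart_param)
qed

lemma differential_own_coord: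
  assumes c: "c \<in> curve_charts" "q \<in> fst c"
  shows "differential (snd c) c q = 1"
proof -
  have "((\<lambda>z. z) has_field_derivative 1) (at (snd c q))" by (rule DERIV_ident)
  then have "(snd c \<circ> param c has_field_derivative 1) (at (snd c q))"
    by (rule has_field_derivative_transform_within_open[OF _ open_curve_chart_image[OF c(1)]])
       (use c in \<open>simp_all only: o_def curve.chart_param imageI\<close>)
  then show ?thesis unfolding differential_def by (rule DERIV_imp_deriv)
qed

lemma differential_zw:
  assumes c: "c \<in> curve_charts" "q \<in> fst c" and q: "q \<in> affine_part"
  shows "2 * snd q * differential snd c q = of_nat n * fst q ^ (n - 1) * differential fst c q"
proof -
  note param_q = curve_chart_self_param[OF c]
  have 1: "((\<lambda>z. (snd (param c z))\<^sup>2) has_field_derivative 2 * snd q * differential snd c q) (at (snd c q))"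
    using has_derivative_coord[OF analytic_snd[OF c q]]
    by (auto intro!: derivative_eq_intros simp: param_q)
  have 2: "((\<lambda>z. 1 + fst (param c z) ^ n) has_field_derivative of_nat n * fst q ^ (n - 1) * differential fst c q) (at (snd c q))"
    using has_derivative_coord[OF analytic_fst[OF c q]]
    by (auto intro!: derivative_eq_intros simp: param_q)
  have "\<forall>\<^sub>F z in nhds (snd c q). (snd (param c z))\<^sup>2 = 1 + fst (param c z) ^ n"
    using eventually_curve_param[OF c openin_affine q] by eventually_elim (simp add: affine_part_def)
  then have "((\<lambda>z. (snd (param c z))\<^sup>2) has_field_derivative of_nat n * fst q ^ (n - 1) * differential fst c q) (at (snd c q))"
    using 2 by (subst DERIV_cong_ev[OF refl _ refl]) auto
  with 1 show ?thesis by (rule DERIV_unique)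
qed

lemma differential_zu:
  assumes c: "c \<in> curve_charts" "q \<in> fst c" and q: "q \<in> affine_part" "q \<in> far_part"
  shows "differential fst c q = - (1 / (u_coord q)\<^sup>2) * differential u_coord c q"
proof -
  note param_q = curve_chart_self_param[OF c]
  have nz: "fst q \<noteq> 0" "u_coord q \<noteq> 0" using q fst_nonzero_far[of q] by (auto simp: u_coord_affine)
  have 1: "((\<lambda>z. 1 / u_coord (param c z)) has_field_derivative - (1 / (u_coord q)\<^sup>2) * differential u_coord c q) (at (snd c q))"
    using has_derivative_coord[OF analytic_u[OF c q(2)]] nz
    by (auto intro!: derivative_eq_intros simp: param_q power2_eq_square)
  have "\<forall>\<^sub>F z in nhds (snd c q). fst (param c z) = 1 / u_coord (param c z)"
    using eventually_curve_param[OF c openin_affine q(1)] by eventually_elim (simp add: u_coord_affine)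
  then have "((\<lambda>z. fst (param c z)) has_field_derivative - (1 / (u_coord q)\<^sup>2) * differential u_coord c q) (at (snd c q))"
    using 1 by (subst DERIV_cong_ev[OF refl _ refl]) auto
  with has_derivative_coord[OF analytic_fst[OF c q(1)]] show ?thesis by (rule DERIV_unique)
qed

text \<open>The form \<open>z\<^sup>i dz / w\<close>. At the branch points it is written as \<open>2 z\<^sup>i dw / (n z\<^sup>n\<^sup>-\<^sup>1)\<close>, by differentiating
  the equation of the curve, and at infinity as \<open>- u\<^sup>m\<^sup>-\<^sup>2\<^sup>-\<^sup>i du / v\<close>.\<close>

definition \<eta> :: "nat \<Rightarrow> surface_point form" where
  "\<eta> i c q =
    (if q \<in> affine_part then
       if snd q \<noteq> 0 then fst q ^ i / snd q * differential fst c q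
       else 2 * fst q ^ i / (of_nat n * fst q ^ (n - 1)) * differential snd c q
     else - (u_coord q ^ (m - 2 - i) / v_coord q) * differential u_coord c q)"

lemma \<eta>_affine: "q \<in> affine_part \<Longrightarrow> \<eta> i c q = fst q ^ i * \<eta> 0 c q"
  by (simp add: \<eta>_def)

lemma fst_nonzero_branch: "q \<in> affine_part \<Longrightarrow> snd q = 0 \<Longrightarrow> fst q \<noteq> 0"
  by (auto simp: affine_part_def)

lemma v_nonzero_infinity: "q \<in> curve \<Longrightarrow> q \<notin> affine_part \<Longrightarrow> q \<in> far_part \<and> v_coord q \<noteq> 0 \<and> u_coord q = 0"
  by (auto simp: curve_def far_part_def infinite_points_def v_coord_def u_coord_def)

lemma \<eta>_w:
  assumes c: "c \<in> curve_charts" "q \<in> fst c" and q: "q \<in> affine_part" "fst q \<noteq> 0"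
  shows "\<eta> i c q = 2 * fst q ^ i / (of_nat n * fst q ^ (n - 1)) * differential snd c q"
proof (cases "snd q = 0")
  case False
  have nz: "of_nat n * fst q ^ (n - 1) \<noteq> 0" using q(2) by simp
  have "\<eta> i c q = fst q ^ i / snd q * differential fst c q" using q False by (simp add: \<eta>_def)
  also have "differential fst c q = 2 * snd q * differential snd c q / (of_nat n * fst q ^ (n - 1))"
    unfolding differential_zw[OF c q(1)] by (rule nonzero_mult_div_cancel_left[OF nz, symmetric])
  finally show ?thesis using False by simp
qed (use q in \<open>simp add: \<eta>_def\<close>)

lemma \<eta>_u:
  assumes c: "c \<in> curve_charts" "q \<in> fst c" and q: "q \<in> far_part" "v_coord q \<noteq> 0" and i: "i \<le> m - 2"
  shows "\<eta> i c q = - (u_coord q ^ (m - 2 - i) / v_coord q) * differential u_coord c q"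
proof (cases "q \<in> affine_part")
  case True
  define z w where "z = fst q" and "w = snd q"
  have nz: "z \<noteq> 0" "w \<noteq> 0"
    using True q fst_nonzero_far[of q] by (auto simp: v_coord_affine z_def w_def)
  have "m = i + (m - 2 - i) + 2" using i m by simp
  then have zm: "z ^ m = z ^ i * z ^ (m - 2 - i) * z\<^sup>2" by (metis power_add)
  have "\<eta> i c q = z ^ i / w * (- (z\<^sup>2) * differential u_coord c q)"
    using nz True unfolding \<eta>_def differential_zu[OF c True q(1)]
    by (simp add: u_coord_affine power_divide z_def w_def)
  also have "\<dots> = - ((1 / z) ^ (m - 2 - i) / (w / z ^ m)) * differential u_coord c q"
    using nz by (simp add: zm power_divide field_simps)
  finally show ?thesis by (simp add: u_coord_affine[OF True] v_coord_affine[OF True] z_def w_def)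
qed (simp add: \<eta>_def)

lemma curve_analytic_differentiable:
  "(f \<circ> param c) analytic_on {snd c q} \<Longrightarrow> f \<circ> param c field_differentiable at (snd c q)"
  using analytic_on_imp_differentiable_at by blast

lemma \<eta>_transition:
  assumes c: "c \<in> curve_charts" and d: "d \<in> curve_charts" and q: "q \<in> fst c \<inter> fst d"
  shows "\<eta> i c q = \<eta> i d q * deriv (transition c d) (snd c q)"
proof -
  have tr: "differential f c q = differential f d q * deriv (transition c d) (snd c q)"
    if "(f \<circ> param d) analytic_on {snd d q}" for f
    using c d q by (intro curve.differential_transition curve_analytic_differentiable that) auto
  show ?thesis
  proof (cases "q \<in> affine_part")
    case True
    then show ?thesis
      using tr[OF analytic_fst[OF d]] tr[OF analytic_snd[OF d]] q by (simp add: \<eta>_def)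
  next
    case False
    have "q \<in> curve" using curve.chart_subset[of c] c q by auto
    then have "q \<in> far_part" using v_nonzero_infinity False by blast
    then show ?thesis using tr[OF analytic_u[OF d]] q False by (simp add: \<eta>_def)
  qed
qed

lemma analytic_\<eta>:
  assumes c: "c \<in> curve_charts" "q \<in> fst c" and i: "i \<le> m - 2"
  shows "(\<eta> i c \<circ> param c) analytic_on {snd c q}"
proof -
  note param_q = curve_chart_self_param[OF c]
  note near = eventually_curve_param[OF c]
  have qc: "q \<in> curve" using curve.chart_subset[of c] c by auto
  consider "q \<in> affine_part" "snd q \<noteq> 0" | "q \<in> affine_part" "fst q \<noteq> 0" | "q \<notin> affine_part"
    using fst_nonzero_branch by blast
  then show ?thesis
  proof cases
    case 1
    have "open {q::surface_point. snd q \<noteq> 0}" by (intro open_Collect_neq continuous_intros)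
    note W = openin_affine_preimage[OF this]
    have a: "(\<lambda>z. snd (param c z)) analytic_on {snd c q}" "(\<lambda>z. fst (param c z)) analytic_on {snd c q}"
      using analytic_snd[OF c 1(1)] analytic_fst[OF c 1(1)] by (simp_all add: o_def)
    have "(\<lambda>z. fst (param c z) ^ i / snd (param c z) * differential fst c (param c z)) analytic_on {snd c q}"
      by (intro analytic_intros a analytic_differential[OF c] analytic_fst[OF c 1(1)]) (simp add: param_q 1)
    then show ?thesis
    proof (rule analytic_eventually_eq)
      show "\<forall>\<^sub>F z in nhds (snd c q). (\<eta> i c \<circ> param c) z = fst (param c z) ^ i / snd (param c z) * differential fst c (param c z)"
        using near[OF W] 1 by (auto elim!: eventually_mono simp: \<eta>_def)
    qed
  next
    case 2
    have "open {q::surface_point. fst q \<noteq> 0}" by (intro open_Collect_neq continuous_intros)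
    note W = openin_affine_preimage[OF this]
    have a: "(\<lambda>z. fst (param c z)) analytic_on {snd c q}"
      using analytic_fst[OF c 2(1)] by (simp add: o_def)
    have "(\<lambda>z. 2 * fst (param c z) ^ i / (of_nat n * fst (param c z) ^ (n - 1)) * differential snd c (param c z)) analytic_on {snd c q}"
      by (intro analytic_intros a analytic_differential[OF c] analytic_snd[OF c 2(1)]) (simp add: param_q 2)
    then show ?thesis
    proof (rule analytic_eventually_eq)
      have "\<forall>\<^sub>F z in nhds (snd c q). z \<in> chart_image c \<and> param c z \<in> {q \<in> affine_part. q \<in> {q. fst q \<noteq> 0}}"
        by (rule near[OF W]) (use 2 in simp)
      then show "\<forall>\<^sub>F z in nhds (snd c q). (\<eta> i c \<circ> param c) z =
          2 * fst (param c z) ^ i / (of_nat n * fst (param c z) ^ (n - 1)) * differential snd c (param c z)"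
      proof eventually_elim
        case (elim z)
        then have "\<eta> i c (param c z) = 2 * fst (param c z) ^ i / (of_nat n * fst (param c z) ^ (n - 1)) * differential snd c (param c z)"
          using c(1) by (intro \<eta>_w inv_into_into) auto
        then show ?case by (simp only: o_def)
      qed
    qed
  next
    case 3
    note inf = v_nonzero_infinity[OF qc 3]
    have "open {q::surface_point. snd q \<noteq> 0}" by (intro open_Collect_neq continuous_intros)
    note W = openin_far_preimage[OF this]
    have a: "(\<lambda>z. v_coord (param c z)) analytic_on {snd c q}" "(\<lambda>z. u_coord (param c z)) analytic_on {snd c q}"
      using analytic_v[OF c] analytic_u[OF c] inf by (simp_all add: o_def)
    have "(\<lambda>z. - (u_coord (param c z) ^ (m - 2 - i) / v_coord (param c z)) * differential u_coord c (param c z)) analytic_on {snd c q}"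
      using inf by (intro analytic_intros a analytic_differential[OF c] analytic_u[OF c]) (auto simp: param_q)
    then show ?thesis
    proof (rule analytic_eventually_eq)
      have "\<forall>\<^sub>F z in nhds (snd c q). z \<in> chart_image c \<and>
          param c z \<in> {q \<in> far_part. (u_coord q, v_coord q) \<in> {q. snd q \<noteq> 0}}"
        by (rule near[OF W]) (use inf in simp)
      then show "\<forall>\<^sub>F z in nhds (snd c q). (\<eta> i c \<circ> param c) z =
          - (u_coord (param c z) ^ (m - 2 - i) / v_coord (param c z)) * differential u_coord c (param c z)"
      proof eventually_elim
        case (elim z)
        then have "\<eta> i c (param c z) = - (u_coord (param c z) ^ (m - 2 - i) / v_coord (param c z)) * differential u_coord c (param c z)"
          using c(1) i by (intro \<eta>_u inv_into_into) auto
        then show ?case by (simp only: o_def)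
      qed
    qed
  qed
qed

lemma analytic_on_chart_imp_holomorphic:
  assumes "\<And>q. q \<in> fst c \<Longrightarrow> (f \<circ> param c) analytic_on {snd c q}"
  shows "(f \<circ> param c) holomorphic_on chart_image c"
proof -
  have "(f \<circ> param c) analytic_on {z}" if "z \<in> chart_image c" for z
    using that assms by blast
  then have "(f \<circ> param c) analytic_on chart_image c" using analytic_on_analytic_at by blast
  then show ?thesis by (rule analytic_imp_holomorphic)
qed

lemma holomorphic_form_\<eta>: "i \<le> m - 2 \<Longrightarrow> holomorphic_form curve_surface (\<eta> i)"
  unfolding holomorphic_form_def
  by (auto intro!: analytic_on_chart_imp_holomorphic analytic_\<eta> \<eta>_transition)

text \<open>\<open>dz/w\<close> has no zero on the affine part and \<open>z\<^sup>m\<^sup>-\<^sup>2 dz/w\<close> has none at infinity, so these two forms have no common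
  zero.\<close>

lemma \<eta>_0_nonzero:
  assumes c: "c \<in> curve_charts" "q \<in> fst c" and q: "q \<in> affine_part"
  shows "\<eta> 0 c q \<noteq> 0"
proof -
  have own: "differential (snd c) c q = 1" by (rule differential_own_coord[OF c])
  obtain U \<rho> where U: "is_patch U (snd c) \<rho>" "fst c \<subseteq> U" using c by (auto simp: curve_charts_def)
  from U(1) show ?thesis
  proof (cases rule: is_patch_cases)
    case (z \<sigma>)
    then have "snd q \<noteq> 0" using c U by (auto simp: z_patch_def)
    then show ?thesis using own q z(3) by (simp add: \<eta>_def)
  next
    case (u \<sigma>)
    then have "q \<in> far_part" "v_coord q \<noteq> 0" using c U by (auto simp: u_patch_def)
    moreover from this have "u_coord q \<noteq> 0" using fst_nonzero_far[OF q] by (simp add: u_coord_affine q)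
    ultimately show ?thesis using own u(3) \<eta>_u[OF c, of 0] by simp
  next
    case (w \<zeta>)
    then have "fst q \<noteq> 0" using c U branch_point_nonzero branch_root_nonzero by (auto simp: w_patch_def)
    then show ?thesis using own w(3) \<eta>_w[OF c q, of 0] by simp
  qed
qed

lemma \<eta>_last_nonzero:
  assumes c: "c \<in> curve_charts" "q \<in> fst c" and q: "q \<notin> affine_part"
  shows "\<eta> (m - 2) c q \<noteq> 0"
proof -
  have qc: "q \<in> curve" using curve.chart_subset[of c] c by auto
  have "snd c = u_coord" using curve_chart_cases[OF c(1)] c(2) q by blast
  then have "differential u_coord c q = 1" using differential_own_coord[OF c] by simp
  then show ?thesis using v_nonzero_infinity[OF qc q] q by (simp add: \<eta>_def)
qed

end

section \<open>The genus of the hyperelliptic curve\<close>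

context hyperelliptic
begin

definition sheet :: "complex \<Rightarrow> complex" where "sheet z = csqrt (1 + z ^ n)"

lemma sheet_square [simp]: "(sheet z)\<^sup>2 = 1 + z ^ n" by (simp add: sheet_def)

lemma sheet_affine: "(z, sheet z) \<in> affine_part" "(z, - sheet z) \<in> affine_part"
  by (simp_all add: affine_part_def)

lemma sheet_branch: "z \<in> branch_points \<Longrightarrow> sheet z = 0"
  by (simp add: sheet_def branch_points_def)

lemma affine_sheet_cases: "q \<in> affine_part \<Longrightarrow> q = (fst q, sheet (fst q)) \<or> q = (fst q, - sheet (fst q))"
proof -
  assume "q \<in> affine_part"
  then have "(snd q)\<^sup>2 = (sheet (fst q))\<^sup>2" by (simp add: affine_part_def)
  then have "snd q = sheet (fst q) \<or> snd q = - sheet (fst q)" by (simp only: power2_eq_iff)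
  then show ?thesis by (metis prod.collapse)
qed

text \<open>The sum over the fibre of \<open>z\<close>. At a branch point the only point of the fibre counts twice.\<close>

definition trace :: "(surface_point \<Rightarrow> complex) \<Rightarrow> complex \<Rightarrow> complex" where
  "trace H z = H (z, sheet z) + H (z, - sheet z)"

definition analytic_on_affine :: "(surface_point \<Rightarrow> complex) \<Rightarrow> bool" where
  "analytic_on_affine H \<longleftrightarrow> (\<forall>c\<in>curve_charts. \<forall>q\<in>fst c \<inter> affine_part. (H \<circ> param c) analytic_on {snd c q})"

lemma trace_fiber:
  assumes "w\<^sup>2 = 1 + z ^ n"
  shows "trace H z = H (z, w) + H (z, - w)"
proof -
  have "w\<^sup>2 = (sheet z)\<^sup>2" using assms by simp
  then have "w = sheet z \<or> w = - sheet z" by (simp only: power2_eq_iff)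
  then show ?thesis by (auto simp: trace_def add.commute)
qed

text \<open>If \<open>1 + z\<^sup>n = r < 0\<close>, then \<open>1 + z\<^sup>-\<^sup>n = r/(r - 1)\<close> is positive, so the slits of \<open>z\<close> and of \<open>1/z\<close> meet only in the
  branch points.\<close>

lemma slit_cases:
  "z \<in> slit \<or> z \<in> branch_points \<or> (z \<noteq> 0 \<and> 1 / z \<in> slit)"
proof (rule ccontr)
  assume neg: "\<not> (z \<in> slit \<or> z \<in> branch_points \<or> (z \<noteq> 0 \<and> 1 / z \<in> slit))"
  then have "z \<notin> slit" and *: "\<not> (z \<noteq> 0 \<and> 1 / z \<in> slit)" by auto
  then obtain r where r: "r \<le> 0" "1 + z ^ n = of_real r" by (auto simp: slit_def nonpos_Reals_def)
  then have zn: "z ^ n = of_real (r - 1)" by (simp add: algebra_simps)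
  have "z \<noteq> 0" using \<open>z \<notin> slit\<close> slit_0 by auto
  then have "1 + (1 / z) ^ n \<in> \<real>\<^sub>\<le>\<^sub>0" using * by (simp add: slit_def)
  moreover have "1 + (1 / z) ^ n = of_real (1 + 1 / (r - 1))"
    unfolding power_one_over zn by (simp only: of_real_add of_real_1 of_real_divide)
  ultimately have "1 + 1 / (r - 1) \<le> 0" by (simp only: nonpos_Reals_of_real_iff)
  then have "r = 0" using r(1) by (simp add: field_simps)
  then have "z \<in> branch_points" using r(2) by (simp add: branch_points_def add_eq_0_iff)
  then show False using neg by blast
qed

text \<open>The trace is symmetric in the two sheets, so the slits at which \<open>sheet\<close> jumps are invisible to it: near them it can
  be computed from the patches around infinity.\<close>

lemma analytic_trace:
  assumes H: "analytic_on_affine H" and "z \<notin> branch_points"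
  shows "trace H analytic_on {z}"
  using slit_cases[of z]
proof (elim disjE conjE)
  assume z: "z \<in> slit"
  have branch: "(\<lambda>z. H (z_param \<sigma> z)) analytic_on {z}" if \<sigma>: "\<sigma> = 1 \<or> \<sigma> = -1" for \<sigma>
  proof -
    define c where "c = (z_patch \<sigma>, fst :: surface_point \<Rightarrow> complex)"
    have c: "c \<in> curve_charts" unfolding c_def by (rule patch_in_curve_charts[OF is_patch_z[OF \<sigma>]])
    have in_c: "z_param \<sigma> y \<in> fst c" "snd c (z_param \<sigma> y) = y" if "y \<in> slit" for y
      using z_param_slit[OF \<sigma> that] by (auto simp: c_def z_param_def)
    have "(H \<circ> param c) analytic_on {snd c (z_param \<sigma> z)}"
      using H c in_c[OF z] unfolding analytic_on_affine_def
      using z_param_slit[OF \<sigma> z] z_patch_def by blast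
    then have "(H \<circ> param c) analytic_on {z}" using in_c(2)[OF z] by simp
    then show ?thesis
    proof (rule analytic_eventually_eq)
      have "\<forall>\<^sub>F y in nhds z. y \<in> slit" using z open_slit by (intro eventually_nhds_in_open)
      then show "\<forall>\<^sub>F y in nhds z. H (z_param \<sigma> y) = (H \<circ> param c) y"
        by eventually_elim (use in_c curve_chart_self_param[OF c] in \<open>metis o_def\<close>)
    qed
  qed
  have "(\<lambda>z. H (z_param 1 z) + H (z_param (-1) z)) analytic_on {z}"
    by (intro analytic_intros branch) auto
  then show ?thesis by (simp add: z_param_def trace_def[abs_def] sheet_def)
next
  assume z: "z \<noteq> 0" "1 / z \<in> slit"
  have branch: "(\<lambda>z. H (u_param \<sigma> (1 / z))) analytic_on {z}" if \<sigma>: "\<sigma> = 1 \<or> \<sigma> = -1" for \<sigma>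
  proof -
    define c where "c = (u_patch \<sigma>, u_coord)"
    have c: "c \<in> curve_charts" unfolding c_def by (rule patch_in_curve_charts[OF is_patch_u[OF \<sigma>]])
    have in_c: "u_param \<sigma> y \<in> fst c" "snd c (u_param \<sigma> y) = y" if "y \<in> slit" for y
      using u_param_slit[OF \<sigma> that] by (auto simp: c_def)
    have aff: "u_param \<sigma> (1 / z) \<in> affine_part"
    proof -
      have "u_param \<sigma> (1 / z) \<in> far_part" "u_coord (u_param \<sigma> (1 / z)) \<noteq> 0"
        using u_param_slit[OF \<sigma> z(2)] z(1) by (auto simp: u_patch_def)
      then show ?thesis using far_subset by (auto simp: curve_def u_coord_def)
    qed
    have "(H \<circ> param c) analytic_on {snd c (u_param \<sigma> (1 / z))}"
      using H c in_c(1)[OF z(2)] aff unfolding analytic_on_affine_def by blast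
    then have "(H \<circ> param c) analytic_on (\<lambda>z. 1 / z) ` {z}" using in_c(2)[OF z(2)] by simp
    moreover have "(\<lambda>z. 1 / z) analytic_on {z}" using z(1) by (intro analytic_intros) auto
    ultimately have "((H \<circ> param c) \<circ> (\<lambda>z. 1 / z)) analytic_on {z}" by (rule analytic_on_compose[rotated])
    then show ?thesis
    proof (rule analytic_eventually_eq)
      have "open ((\<lambda>z. 1 / z) -` slit \<inter> (- {0}))"
        by (rule continuous_open_preimage[of "- {0}" "\<lambda>z. 1 / z" slit, unfolded Int_commute[of "- {0}"]])
           (auto intro!: continuous_intros open_slit)
      then have "\<forall>\<^sub>F y in nhds z. y \<in> (\<lambda>z. 1 / z) -` slit \<inter> (- {0})" using z by (intro eventually_nhds_in_open) auto
      then show "\<forall>\<^sub>F y in nhds z. H (u_param \<sigma> (1 / y)) = ((H \<circ> param c) \<circ> (\<lambda>z. 1 / z)) y"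
      proof eventually_elim
        case (elim y)
        then have "1 / y \<in> slit" by auto
        then have "param c (1 / y) = u_param \<sigma> (1 / y)" using in_c curve_chart_self_param[OF c] by metis
        then show ?case by (simp only: o_def)
      qed
    qed
  qed
  have "(\<lambda>z. H (u_param 1 (1 / z)) + H (u_param (-1) (1 / z))) analytic_on {z}"
    by (intro analytic_intros branch) auto
  then show ?thesis
  proof (rule analytic_eventually_eq)
    have "\<forall>\<^sub>F y in nhds z. y \<in> - {0}" using z(1) by (intro eventually_nhds_in_open) auto
    then show "\<forall>\<^sub>F y in nhds z. trace H y = H (u_param 1 (1 / y)) + H (u_param (-1) (1 / y))"
    proof eventually_elim
      case (elim y)
      then have y: "y \<noteq> 0" by simp
      define k where "k = 1 / y"
      define a where "a = csqrt (1 + k ^ n) / k ^ m"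
      have "a\<^sup>2 = (1 + k ^ n) / k ^ n"
        by (simp add: a_def power_divide mult.commute flip: power_mult)
      also have "\<dots> = 1 + y ^ n"
      proof -
        have "k ^ n \<noteq> 0" "y ^ n = 1 / k ^ n" using y by (simp_all add: k_def power_one_over)
        then show ?thesis by (simp add: add_divide_distrib)
      qed
      finally have "trace H y = H (y, a) + H (y, - a)" by (rule trace_fiber)
      then show ?case using y by (simp add: u_param_def from_uv_def a_def k_def)
    qed
  qed
qed (use assms in simp)

lemma sheet_tendsto_0:
  assumes "\<zeta> \<in> branch_points" shows "(sheet \<longlongrightarrow> 0) (at \<zeta>)"
proof (rule tendsto_norm_zero_cancel)
  have norm_sheet: "norm (sheet z) = sqrt (norm (1 + z ^ n))" for z
  proof -
    have "(norm (sheet z))\<^sup>2 = norm (1 + z ^ n)" by (simp flip: norm_power)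
    then show ?thesis by (metis norm_ge_zero real_sqrt_unique)
  qed
  have "((\<lambda>z. sqrt (norm (1 + z ^ n))) \<longlongrightarrow> sqrt (norm (1 + \<zeta> ^ n))) (at \<zeta>)" by (intro tendsto_intros)
  then show "((\<lambda>z. norm (sheet z)) \<longlongrightarrow> 0) (at \<zeta>)"
    using assms unfolding norm_sheet by (simp add: branch_points_def)
qed

lemma eventually_sheets_in_open:
  assumes \<zeta>: "\<zeta> \<in> branch_points" and T: "openin curve_topology T" "(\<zeta>, 0) \<in> T"
  shows "\<forall>\<^sub>F z in at \<zeta>. (z, sheet z) \<in> T \<and> (z, - sheet z) \<in> T"
proof -
  have "continuous_map (top_of_set affine_part) curve_topology (\<lambda>q. (fst q, snd q))"
    by (rule continuous_map_zw) (auto intro!: continuous_intros simp: affine_part_def)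
  then have "openin (top_of_set affine_part) {q \<in> topspace (top_of_set affine_part). (fst q, snd q) \<in> T}"
    using T(1) by (rule openin_continuous_map_preimage)
  then obtain V where V: "open V" "{q \<in> affine_part. q \<in> T} = affine_part \<inter> V"
    unfolding openin_open by auto
  have "(\<zeta>, 0) \<in> affine_part" using \<zeta> by (simp add: affine_part_def branch_points_def)
  then have \<zeta>V: "(\<zeta>, 0) \<in> V" using V(2) T(2) by blast
  have "((\<lambda>z. (z, sheet z)) \<longlongrightarrow> (\<zeta>, 0)) (at \<zeta>)" by (intro tendsto_Pair tendsto_ident_at sheet_tendsto_0 \<zeta>)
  then have 1: "\<forall>\<^sub>F z in at \<zeta>. (z, sheet z) \<in> V" using V(1) \<zeta>V by (rule topological_tendstoD)
  have "((\<lambda>z. (z, - sheet z)) \<longlongrightarrow> (\<zeta>, - 0)) (at \<zeta>)" by (intro tendsto_Pair tendsto_ident_at tendsto_minus sheet_tendsto_0 \<zeta>)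
  then have "((\<lambda>z. (z, - sheet z)) \<longlongrightarrow> (\<zeta>, 0)) (at \<zeta>)" by simp
  then have 2: "\<forall>\<^sub>F z in at \<zeta>. (z, - sheet z) \<in> V" using V(1) \<zeta>V by (rule topological_tendstoD)
  show ?thesis
    using 1 2 by eventually_elim (use V(2) sheet_affine in blast)
qed

lemma trace_tendsto_branch:
  assumes H: "analytic_on_affine H" and \<zeta>: "\<zeta> \<in> branch_points"
  shows "(trace H \<longlongrightarrow> trace H \<zeta>) (at \<zeta>)"
proof -
  define c where "c = (w_patch \<zeta>, snd :: surface_point \<Rightarrow> complex)"
  have c: "c \<in> curve_charts" unfolding c_def by (rule patch_in_curve_charts[OF is_patch_w[OF \<zeta>]])
  have q: "(\<zeta>, 0) \<in> fst c" "(\<zeta>, 0) \<in> affine_part"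
    using \<zeta> by (auto simp: c_def w_patch_def branch_root_def affine_part_def branch_points_def)
  have "(H \<circ> param c) analytic_on {snd c (\<zeta>, 0)}" using H c q unfolding analytic_on_affine_def by blast
  then have cont: "isCont (H \<circ> param c) (snd c (\<zeta>, 0))" by (rule analytic_at_imp_isCont)
  have param_q: "param c (snd c (\<zeta>, 0)) = (\<zeta>, 0)" by (rule curve_chart_self_param[OF c q(1)])
  have lim: "((\<lambda>z. H (z, s * sheet z)) \<longlongrightarrow> H (\<zeta>, 0)) (at \<zeta>)" if s: "s = 1 \<or> s = -1" for s
  proof (rule topological_tendstoI)
    fix S assume S: "open S" "H (\<zeta>, 0) \<in> S"
    have ct: "((H \<circ> param c) \<longlongrightarrow> H (\<zeta>, 0)) (nhds (snd c (\<zeta>, 0)))"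
    proof -
      have "((H \<circ> param c) \<longlongrightarrow> (H \<circ> param c) (snd c (\<zeta>, 0))) (nhds (snd c (\<zeta>, 0)))"
        using cont unfolding isCont_def tendsto_at_iff_tendsto_nhds .
      then show ?thesis by (simp only: o_def param_q)
    qed
    have "\<forall>\<^sub>F x in nhds (snd c (\<zeta>, 0)). (H \<circ> param c) x \<in> S" by (rule topological_tendstoD[OF ct S])
    then obtain B where B: "open B" "snd c (\<zeta>, 0) \<in> B" "\<And>x. x \<in> B \<Longrightarrow> H (param c x) \<in> S"
      by (auto simp: eventually_nhds)
    define T where "T = param c ` (B \<inter> chart_image c)"
    have "openin curve_topology T"
      using curve.openin_param_image[of c "B \<inter> chart_image c"] c B(1) open_curve_chart_image[OF c]
      by (auto simp: T_def)
    moreover have "(\<zeta>, 0) \<in> T" unfolding T_def using B(2) q(1) param_q by (metis IntI image_eqI)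
    ultimately have "\<forall>\<^sub>F z in at \<zeta>. (z, sheet z) \<in> T \<and> (z, - sheet z) \<in> T"
      by (rule eventually_sheets_in_open[OF \<zeta>])
    then show "\<forall>\<^sub>F z in at \<zeta>. H (z, s * sheet z) \<in> S"
      by eventually_elim (use B(3) s in \<open>auto simp: T_def\<close>)
  qed
  have "((\<lambda>z. H (z, 1 * sheet z) + H (z, -1 * sheet z)) \<longlongrightarrow> H (\<zeta>, 0) + H (\<zeta>, 0)) (at \<zeta>)"
    by (intro tendsto_add lim) auto
  then show ?thesis using sheet_branch[OF \<zeta>] by (simp add: trace_def[abs_def])
qed

text \<open>The trace of a function on the curve descends to the \<open>z\<close>-plane. It is analytic off the branch
  points and continuous at them.\<close>

lemma entire_trace:
  assumes H: "analytic_on_affine H"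
  shows "trace H holomorphic_on UNIV"
proof (rule no_isolated_singularity'[OF _ _ open_UNIV finite_branch_points])
  show "(trace H \<longlongrightarrow> trace H z) (at z within UNIV)" if "z \<in> branch_points" for z
    using trace_tendsto_branch[OF H that] by simp
  have "trace H analytic_on (UNIV - branch_points)"
    using analytic_trace[OF H] analytic_on_analytic_at by blast
  then show "trace H holomorphic_on (UNIV - branch_points)" by (rule analytic_imp_holomorphic)
qed

text \<open>The function \<open>F\<close> in \<open>\<omega> = F dz/w\<close>. It is meant for the affine part, where \<open>dz/w\<close> has no zeros.\<close>

definition quotient :: "surface_point form \<Rightarrow> surface_point \<Rightarrow> complex" where
  "quotient \<omega> q = (let c = some_chart curve_surface q in \<omega> c q / \<eta> 0 c q)"

lemma form_transition:
  assumes "holomorphic_form curve_surface \<omega>" "c \<in> curve_charts" "d \<in> curve_charts" "q \<in> fst c \<inter> fst d"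
  shows "\<omega> c q = \<omega> d q * deriv (transition c d) (snd c q)"
  using assms unfolding holomorphic_form_def curve_surface_simps by blast

lemma quotient_eq:
  assumes \<omega>: "holomorphic_form curve_surface \<omega>" and c: "c \<in> curve_charts" "q \<in> fst c" and q: "q \<in> affine_part"
  shows "quotient \<omega> q = \<omega> c q / \<eta> 0 c q"
proof -
  define d where "d = some_chart curve_surface q"
  have "q \<in> points curve_surface" using q affine_subset by auto
  then have d: "d \<in> curve_charts" "q \<in> fst d"
    using curve.some_chart[of q] by (simp_all add: d_def)
  have "\<omega> d q = \<omega> c q * deriv (transition d c) (snd d q)" "\<eta> 0 d q = \<eta> 0 c q * deriv (transition d c) (snd d q)"
    using c d by (auto intro!: form_transition[OF \<omega>] \<eta>_transition)
  moreover have "\<eta> 0 d q \<noteq> 0" by (rule \<eta>_0_nonzero[OF d q])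
  ultimately have "\<omega> d q / \<eta> 0 d q = \<omega> c q / \<eta> 0 c q" by simp
  then show ?thesis by (simp add: quotient_def Let_def d_def)
qed

lemma holomorphic_form_analytic:
  assumes "holomorphic_form curve_surface \<omega>" "c \<in> curve_charts" "q \<in> fst c"
  shows "(\<lambda>z. \<omega> c (param c z)) analytic_on {snd c q}"
proof -
  have "(\<omega> c \<circ> param c) holomorphic_on chart_image c" using assms by (simp add: holomorphic_form_def)
  then show ?thesis
    using open_curve_chart_image[OF assms(2)] assms(3) unfolding analytic_at o_def by blast
qed

lemma analytic_quotient:
  assumes \<omega>: "holomorphic_form curve_surface \<omega>"
  shows "analytic_on_affine (quotient \<omega>)"
  unfolding analytic_on_affine_def
proof (intro ballI)
  fix c q assume c: "c \<in> curve_charts" and "q \<in> fst c \<inter> affine_part"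
  then have q: "q \<in> fst c" "q \<in> affine_part" by auto
  have "(\<lambda>z. \<omega> c (param c z) / \<eta> 0 c (param c z)) analytic_on {snd c q}"
    using \<eta>_0_nonzero[OF c q] curve_chart_self_param[OF c q(1)]
    by (intro analytic_intros holomorphic_form_analytic[OF \<omega> c q(1)] holomorphic_form_analytic[OF holomorphic_form_\<eta> c q(1)]) auto
  then show "(quotient \<omega> \<circ> param c) analytic_on {snd c q}"
  proof (rule analytic_eventually_eq)
    show "\<forall>\<^sub>F z in nhds (snd c q). (quotient \<omega> \<circ> param c) z = \<omega> c (param c z) / \<eta> 0 c (param c z)"
      using eventually_curve_param[OF c q(1) openin_affine q(2)]
    proof eventually_elim
      case (elim z)
      then have "quotient \<omega> (param c z) = \<omega> c (param c z) / \<eta> 0 c (param c z)"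
        by (intro quotient_eq[OF \<omega> c] inv_into_into) auto
      then show ?case by (simp only: o_def)
    qed
  qed
qed

lemma analytic_snd_times:
  assumes "analytic_on_affine H"
  shows "analytic_on_affine (\<lambda>q. snd q * H q)"
  unfolding analytic_on_affine_def
proof (intro ballI)
  fix c q assume c: "c \<in> curve_charts" and q: "q \<in> fst c \<inter> affine_part"
  have "(H \<circ> param c) analytic_on {snd c q}" using assms c q unfolding analytic_on_affine_def by blast
  moreover have "(snd \<circ> param c) analytic_on {snd c q}" using analytic_snd[OF c] q by blast
  ultimately have "(\<lambda>z. (snd \<circ> param c) z * (H \<circ> param c) z) analytic_on {snd c q}"
    by (rule analytic_on_mult[rotated])
  then show "((\<lambda>q. snd q * H q) \<circ> param c) analytic_on {snd c q}" by (simp add: o_def)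
qed

lemma small_in_slit:
  assumes "norm u \<le> 1/2" shows "u \<in> slit" "norm (1 + u ^ n) \<le> 4"
proof -
  have "norm (u ^ n) \<le> norm u ^ 1"
    unfolding norm_power using assms m by (intro power_decreasing) auto
  then have le: "norm (u ^ n) \<le> 1/2" using assms by simp
  have "- (1/2) \<le> Re (u ^ n)" using abs_Re_le_cmod[of "u ^ n"] le by linarith
  then have "0 < Re (1 + u ^ n)" by simp
  then show "u \<in> slit" by (auto simp: slit_def complex_nonpos_Reals_iff)
  have "norm (1 + u ^ n) \<le> 1 + norm (u ^ n)" by (metis norm_one norm_triangle_ineq)
  then show "norm (1 + u ^ n) \<le> 4" using le by simp
qed

text \<open>Near infinity \<open>dz / w\<close> is \<open>- u\<^sup>m\<^sup>-\<^sup>2 du / v\<close>, which bounds the order of the pole of the quotient.\<close>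

lemma quotient_growth:
  assumes \<omega>: "holomorphic_form curve_surface \<omega>"
  obtains B where "0 \<le> B" "\<And>q. q \<in> affine_part \<Longrightarrow> 2 \<le> norm (fst q) \<Longrightarrow> norm (quotient \<omega> q) \<le> B * norm (fst q) ^ (m - 2)"
proof -
  define c where "c \<sigma> = (u_patch \<sigma>, u_coord)" for \<sigma>
  have c: "c \<sigma> \<in> curve_charts" if "\<sigma> = 1 \<or> \<sigma> = -1" for \<sigma>
    unfolding c_def by (rule patch_in_curve_charts[OF is_patch_u[OF that]])
  have "\<exists>K. \<forall>u\<in>cball 0 (1/2). norm (\<omega> (c \<sigma>) (param (c \<sigma>) u)) \<le> K" if \<sigma>: "\<sigma> = 1 \<or> \<sigma> = -1" for \<sigma>
  proof -
    have "(\<omega> (c \<sigma>) \<circ> param (c \<sigma>)) holomorphic_on chart_image (c \<sigma>)"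
      using \<omega> c[OF \<sigma>] by (simp add: holomorphic_form_def)
    moreover have "cball 0 (1/2) \<subseteq> chart_image (c \<sigma>)"
      using small_in_slit(1) by (auto simp: c_def u_coord_u_patch[OF \<sigma>])
    ultimately have "continuous_on (cball 0 (1/2)) (\<omega> (c \<sigma>) \<circ> param (c \<sigma>))"
      using holomorphic_on_imp_continuous_on continuous_on_subset by blast
    then have "bounded ((\<omega> (c \<sigma>) \<circ> param (c \<sigma>)) ` cball 0 (1/2))"
      by (intro compact_imp_bounded compact_continuous_image) auto
    then show ?thesis unfolding bounded_iff by auto
  qed
  then obtain K where K: "\<And>\<sigma> u. \<sigma> = 1 \<or> \<sigma> = -1 \<Longrightarrow> u \<in> cball 0 (1/2) \<Longrightarrow> norm (\<omega> (c \<sigma>) (param (c \<sigma>) u)) \<le> K \<sigma>"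
    by metis
  \<comment> \<open>A bound for the coefficient of \<open>\<omega>\<close> in either patch, times a bound for \<open>|v|\<close>.\<close>
  define B where "B = 2 * (\<bar>K 1\<bar> + \<bar>K (-1)\<bar>)"
  show ?thesis
  proof (rule that[of B])
    show "0 \<le> B" by (simp add: B_def)
    fix q assume q: "q \<in> affine_part" and large: "2 \<le> norm (fst q)"
    define u v where "u = u_coord q" and "v = v_coord q"
    have nz: "fst q \<noteq> 0" using large by auto
    have far: "q \<in> far_part" using nz q fst_nonzero_far by blast
    have u: "u = 1 / fst q" "u \<noteq> 0" using nz q by (auto simp: u_def u_coord_affine)
    have u_small: "norm u \<le> 1/2" using large by (simp add: u(1) norm_divide divide_le_eq)
    note slit = small_in_slit[OF u_small]
    have v2: "v\<^sup>2 = 1 + u ^ n" unfolding u_def v_def by (rule uv_relation[OF far])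
    have "v\<^sup>2 = (csqrt (1 + u ^ n))\<^sup>2" unfolding v2 by simp
    then have "v = csqrt (1 + u ^ n) \<or> v = - csqrt (1 + u ^ n)" by (simp only: power2_eq_iff)
    moreover have "0 < Re (csqrt (1 + u ^ n))" using slit(1) by (intro Re_csqrt_pos) (simp add: slit_def)
    ultimately obtain \<sigma> where \<sigma>: "\<sigma> = 1 \<or> \<sigma> = -1" "0 < Re (\<sigma> * v)"
    proof (elim disjE)
      assume "v = csqrt (1 + u ^ n)" "0 < Re (csqrt (1 + u ^ n))"
      then show ?thesis by (intro that[of 1]) (simp_all del: csqrt.sel)
    next
      assume "v = - csqrt (1 + u ^ n)" "0 < Re (csqrt (1 + u ^ n))"
      then show ?thesis by (intro that[of "-1"]) (simp_all del: csqrt.sel)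
    qed
    have qc: "q \<in> fst (c \<sigma>)" using far \<sigma> by (simp add: c_def u_patch_def v_def)
    have vnz: "v \<noteq> 0" using \<sigma>(2) by auto
    have "differential u_coord (c \<sigma>) q = 1"
      using differential_own_coord[OF c[OF \<sigma>(1)] qc] by (simp add: c_def)
    then have eta: "\<eta> 0 (c \<sigma>) q = - (u ^ (m - 2) / v)"
      using \<eta>_u[OF c[OF \<sigma>(1)] qc far, of 0] vnz by (simp add: u_def v_def)
    have param_u: "param (c \<sigma>) u = q"
      using curve_chart_self_param[OF c[OF \<sigma>(1)] qc] by (simp add: c_def u_def)
    have "norm (\<omega> (c \<sigma>) q) \<le> K \<sigma>" using K[OF \<sigma>(1), of u] u_small by (simp add: param_u)
    also have "\<dots> \<le> \<bar>K 1\<bar> + \<bar>K (-1)\<bar>" using \<sigma>(1) by auto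
    finally have \<omega>_le: "norm (\<omega> (c \<sigma>) q) \<le> \<bar>K 1\<bar> + \<bar>K (-1)\<bar>" .
    have "(norm v)\<^sup>2 \<le> 2\<^sup>2" using slit(2) v2 by (simp flip: norm_power)
    then have v_le: "norm v \<le> 2" by (rule power2_le_imp_le) simp
    have "quotient \<omega> q = \<omega> (c \<sigma>) q / \<eta> 0 (c \<sigma>) q" by (rule quotient_eq[OF \<omega> c[OF \<sigma>(1)] qc q])
    also have "\<dots> = - (\<omega> (c \<sigma>) q * v * fst q ^ (m - 2))"
      unfolding eta using u vnz by (simp add: power_one_over)
    finally have "norm (quotient \<omega> q) = norm (\<omega> (c \<sigma>) q) * norm v * norm (fst q) ^ (m - 2)"
      by (simp add: norm_mult norm_power)
    also have "\<dots> \<le> (\<bar>K 1\<bar> + \<bar>K (-1)\<bar>) * 2 * norm (fst q) ^ (m - 2)"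
      using \<omega>_le v_le by (intro mult_right_mono mult_mono) auto
    finally show "norm (quotient \<omega> q) \<le> B * norm (fst q) ^ (m - 2)" by (simp add: B_def algebra_simps)
  qed
qed

text \<open>Together with the bound on the quotient, this bounds the trace of \<open>w F\<close> by a multiple of \<open>|z|\<^sup>2\<^sup>m\<^sup>-\<^sup>2\<close>.\<close>

lemma sheet_growth: "2 \<le> norm z \<Longrightarrow> norm (sheet z) \<le> 2 * norm z ^ m"
proof -
  assume z: "2 \<le> norm z"
  have "(norm (sheet z))\<^sup>2 = norm (1 + z ^ n)" by (simp flip: norm_power)
  also have "\<dots> \<le> 1 + norm z ^ n" by (metis norm_one norm_power norm_triangle_ineq)
  also have "\<dots> \<le> 4 * norm z ^ n" 
  proof -
    have "1 \<le> norm z ^ n" using z by (intro one_le_power) simp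
    then show ?thesis by linarith
  qed
  also have "\<dots> = (2 * norm z ^ m)\<^sup>2" by (simp add: power_mult_distrib mult.commute flip: power_mult)
  finally show "norm (sheet z) \<le> 2 * norm z ^ m" by (rule power2_le_imp_le) simp
qed

text \<open>The trace of \<open>w F\<close> vanishes at the \<open>2m\<close> branch points, but its growth makes it a polynomial of degree
  less than \<open>2m\<close>. So it is zero, \<open>F\<close> takes the same values on both sheets, and \<open>F\<close> is a
  polynomial in \<open>z\<close>.\<close>

lemma quotient_polynomial:
  assumes \<omega>: "holomorphic_form curve_surface \<omega>"
  obtains a where "\<And>q. q \<in> affine_part \<Longrightarrow> quotient \<omega> q = (\<Sum>i<m - 1. a i * fst q ^ i)"
proof -
  let ?F = "quotient \<omega>"
  note F = analytic_quotient[OF \<omega>]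
  obtain B where B: "0 \<le> B" "\<And>q. q \<in> affine_part \<Longrightarrow> 2 \<le> norm (fst q) \<Longrightarrow> norm (?F q) \<le> B * norm (fst q) ^ (m - 2)"
    using quotient_growth[OF \<omega>] by blast
  have F_le: "norm (?F (z, sheet z)) \<le> B * norm z ^ (m - 2)" "norm (?F (z, - sheet z)) \<le> B * norm z ^ (m - 2)" if "2 \<le> norm z" for z
    using B(2)[OF sheet_affine(1)[of z]] B(2)[OF sheet_affine(2)[of z]] that by auto
  define t where "t = trace (\<lambda>q. snd q * ?F q)"
  have t_eq: "t z = sheet z * (?F (z, sheet z) - ?F (z, - sheet z))" for z
    by (simp add: t_def trace_def algebra_simps)
  have t_poly: "t z = (\<Sum>k\<le>2 * m - 2. (deriv ^^ k) t 0 / fact k * z ^ k)" for z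
  proof (rule Liouville_polynomial)
    show "t holomorphic_on UNIV" unfolding t_def by (rule entire_trace[OF analytic_snd_times[OF F]])
    fix z :: complex assume z: "2 \<le> norm z"
    have "norm (t z) \<le> norm (sheet z) * (norm (?F (z, sheet z)) + norm (?F (z, - sheet z)))"
      unfolding t_eq norm_mult by (intro mult_left_mono norm_triangle_ineq4) simp
    also have "\<dots> \<le> (2 * norm z ^ m) * (B * norm z ^ (m - 2) + B * norm z ^ (m - 2))"
      using sheet_growth[OF z] F_le[OF z] B(1) by (intro mult_mono add_mono) auto
    also have "\<dots> = 4 * B * (norm z ^ m * norm z ^ (m - 2))" by simp
    also have "norm z ^ m * norm z ^ (m - 2) = norm z ^ (2 * m - 2)"
    proof -
      have "m + (m - 2) = 2 * m - 2" using m by simp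
      then show ?thesis by (metis power_add)
    qed
    finally show "norm (t z) \<le> 4 * B * norm z ^ (2 * m - 2)" .
  qed
  have t_zero: "t z = 0" for z
  proof (rule ccontr)
    assume "t z \<noteq> 0"
    then obtain k where k: "(deriv ^^ k) t 0 / fact k \<noteq> 0" "k \<le> 2 * m - 2"
      unfolding t_poly[of z] by (metis (no_types, lifting) atMost_iff mult_zero_left sum.neutral)
    have roots: "finite {z. (\<Sum>i\<le>2 * m - 2. (deriv ^^ i) t 0 / fact i * z ^ i) = 0} \<and>
        card {z. (\<Sum>i\<le>2 * m - 2. (deriv ^^ i) t 0 / fact i * z ^ i) = 0} \<le> 2 * m - 2"
      by (rule polyfun_rootbound[where c="\<lambda>i. (deriv ^^ i) t 0 / fact i"]) (use k in blast)
    \<comment> \<open>\<open>w\<close> vanishes at the branch points, and there are \<open>2m\<close> of them.\<close>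
    have "branch_points \<subseteq> {z. (\<Sum>i\<le>2 * m - 2. (deriv ^^ i) t 0 / fact i * z ^ i) = 0}"
    proof
      fix \<zeta> assume "\<zeta> \<in> branch_points"
      then have "t \<zeta> = 0" by (simp add: t_eq sheet_branch)
      then show "\<zeta> \<in> {z. (\<Sum>i\<le>2 * m - 2. (deriv ^^ i) t 0 / fact i * z ^ i) = 0}" by (simp only: mem_Collect_eq flip: t_poly)
    qed
    then have "card branch_points \<le> 2 * m - 2" using roots card_mono by (meson order_trans)
    then show False using m by (simp add: card_branch_points)
  qed
  have same: "?F (z, - sheet z) = ?F (z, sheet z)" for z
    using t_zero[of z] by (cases "sheet z = 0") (auto simp: t_eq)
  define s where "s = trace ?F"
  have s_poly: "s z = (\<Sum>k\<le>m - 2. (deriv ^^ k) s 0 / fact k * z ^ k)" for z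
  proof (rule Liouville_polynomial)
    show "s holomorphic_on UNIV" unfolding s_def by (rule entire_trace[OF F])
    fix z :: complex assume z: "2 \<le> norm z"
    have "norm (s z) \<le> norm (?F (z, sheet z)) + norm (?F (z, - sheet z))"
      unfolding s_def trace_def by (rule norm_triangle_ineq)
    also have "\<dots> \<le> 2 * B * norm z ^ (m - 2)" using F_le[OF z] by simp
    finally show "norm (s z) \<le> 2 * B * norm z ^ (m - 2)" .
  qed
  show ?thesis
  proof (rule that[of "\<lambda>i. (deriv ^^ i) s 0 / fact i / 2"])
    fix q assume "q \<in> affine_part"
    then have "?F q = ?F (fst q, sheet (fst q))" using affine_sheet_cases[of q] same by metis
    also have "\<dots> = s (fst q) / 2" by (simp add: s_def trace_def same)
    also have "\<dots> = (\<Sum>k\<le>m - 2. (deriv ^^ k) s 0 / fact k * fst q ^ k) / 2" by (subst s_poly) (rule refl)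
    also have "\<dots> = (\<Sum>k\<le>m - 2. (deriv ^^ k) s 0 / fact k / 2 * fst q ^ k)"
      by (simp add: sum_divide_distrib)
    also have "{..m - 2} = {..<m - 1}" using m by auto
    finally show "?F q = (\<Sum>i<m - 1. (deriv ^^ i) s 0 / fact i / 2 * fst q ^ i)" .
  qed
qed

text \<open>The two points at infinity are isolated, so continuity determines the coefficients there.\<close>

lemma forms_eq_if_eq_affine:
  assumes \<omega>: "holomorphic_form curve_surface \<omega>" "holomorphic_form curve_surface \<omega>'"
    and eq: "\<And>c q. c \<in> curve_charts \<Longrightarrow> q \<in> fst c \<Longrightarrow> q \<in> affine_part \<Longrightarrow> \<omega> c q = \<omega>' c q"
    and c: "c \<in> curve_charts" "q \<in> fst c"
  shows "\<omega> c q = \<omega>' c q"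
proof -
  have lim: "((\<lambda>z. \<omega> c (param c z)) \<longlongrightarrow> \<omega> c q) (at (snd c q))" if "holomorphic_form curve_surface \<omega>" for \<omega>
    using analytic_at_imp_isCont[OF holomorphic_form_analytic[OF that c]] curve_chart_self_param[OF c]
    by (simp add: isCont_def)
  have fin: "finite infinite_points" by (simp add: infinite_points_def)
  have "\<forall>\<^sub>F z in at (snd c q). \<omega> c (param c z) = \<omega>' c (param c z)"
  proof (rule eventually_mono)
    show "\<forall>\<^sub>F z in at (snd c q). param c z \<in> fst c - infinite_points"
      by (rule curve.eventually_param_notin_finite[OF _ c(2) fin]) (simp add: c(1))
    fix z assume z: "param c z \<in> fst c - infinite_points"
    then have "param c z \<in> curve" using curve.chart_subset[of c] c(1) by auto
    then have "param c z \<in> affine_part" using z by (simp add: curve_def)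
    then show "\<omega> c (param c z) = \<omega>' c (param c z)" using z by (intro eq[OF c(1)]) auto
  qed
  then have "((\<lambda>z. \<omega>' c (param c z)) \<longlongrightarrow> \<omega> c q) (at (snd c q))"
    using lim[OF \<omega>(1)] by (rule Lim_transform_eventually[rotated])
  with lim[OF \<omega>(2)] show ?thesis using tendsto_unique by (metis at_neq_bot)
qed

text \<open>The forms \<open>z\<^sup>i dz/w\<close> with \<open>i < m - 1\<close> are a basis.\<close>

theorem has_genus_curve: "has_genus curve_surface (m - 1)"
  unfolding has_genus_def
proof (intro exI[of _ \<eta>] conjI allI impI)
  show "holomorphic_form curve_surface (\<eta> i)" if "i < m - 1" for i
    using that by (intro holomorphic_form_\<eta>) simp
  fix \<omega> :: "surface_point form" assume \<omega>: "holomorphic_form curve_surface \<omega>"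
  obtain a where a: "\<And>q. q \<in> affine_part \<Longrightarrow> quotient \<omega> q = (\<Sum>i<m - 1. a i * fst q ^ i)"
    using quotient_polynomial[OF \<omega>] by blast
  have sum_form: "holomorphic_form curve_surface (\<lambda>c q. \<Sum>i<m - 1. a i * \<eta> i c q)"
    unfolding holomorphic_form_def
  proof (intro conjI ballI)
    fix c assume c: "c \<in> atlas curve_surface"
    have "(\<eta> i c \<circ> param c) holomorphic_on chart_image c" if "i < m - 1" for i
      using holomorphic_form_\<eta>[of i] that c unfolding holomorphic_form_def by simp
    then have "(\<lambda>z. \<Sum>i<m - 1. a i * (\<eta> i c \<circ> param c) z) holomorphic_on chart_image c"
      by (intro holomorphic_on_sum holomorphic_on_mult holomorphic_on_const) (simp only: lessThan_iff o_def)
    then show "((\<lambda>q. \<Sum>i<m - 1. a i * \<eta> i c q) \<circ> param c) holomorphic_on chart_image c" by (simp add: o_def)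
  next
    fix c d q assume "c \<in> atlas curve_surface" "d \<in> atlas curve_surface" "q \<in> fst c \<inter> fst d"
    then have "\<eta> i c q = \<eta> i d q * deriv (transition c d) (snd c q)" for i by (intro \<eta>_transition) auto
    then have "(\<Sum>i<m - 1. a i * \<eta> i c q) = (\<Sum>i<m - 1. a i * \<eta> i d q * deriv (transition c d) (snd c q))"
      by (simp only: mult.assoc)
    then show "(\<Sum>i<m - 1. a i * \<eta> i c q) = (\<Sum>i<m - 1. a i * \<eta> i d q) * deriv (transition c d) (snd c q)"
      by (simp only: sum_distrib_right)
  qed
  have rep: "\<omega> c q = (\<Sum>i<m - 1. a i * \<eta> i c q)" if c: "c \<in> curve_charts" "q \<in> fst c" for c q
  proof (rule forms_eq_if_eq_affine[OF \<omega> sum_form _ c])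
    fix c q assume c: "c \<in> curve_charts" "q \<in> fst c" and q: "q \<in> affine_part"
    have "\<omega> c q = quotient \<omega> q * \<eta> 0 c q"
      using quotient_eq[OF \<omega> c q] \<eta>_0_nonzero[OF c q] by simp
    also have "\<dots> = (\<Sum>i<m - 1. a i * (fst q ^ i * \<eta> 0 c q))"
      unfolding a[OF q] sum_distrib_right by (simp only: mult.assoc)
    also have "\<dots> = (\<Sum>i<m - 1. a i * \<eta> i c q)" by (simp only: \<eta>_affine[OF q, symmetric])
    finally show "\<omega> c q = (\<Sum>i<m - 1. a i * \<eta> i c q)" .
  qed
  show "\<exists>!a. a \<in> extensional {..<m - 1} \<and>
      (\<forall>c\<in>atlas curve_surface. \<forall>q\<in>fst c. \<omega> c q = (\<Sum>i<m - 1. a i * \<eta> i c q))"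
  proof (rule ex1I[of _ "restrict a {..<m - 1}"])
    show "restrict a {..<m - 1} \<in> extensional {..<m - 1} \<and>
      (\<forall>c\<in>atlas curve_surface. \<forall>q\<in>fst c. \<omega> c q = (\<Sum>i<m - 1. restrict a {..<m - 1} i * \<eta> i c q))"
    proof (intro conjI restrict_extensional ballI)
      fix c q assume c: "c \<in> atlas curve_surface" "q \<in> fst c"
      have "\<omega> c q = (\<Sum>i<m - 1. a i * \<eta> i c q)" using c by (intro rep) simp_all
      also have "\<dots> = (\<Sum>i<m - 1. restrict a {..<m - 1} i * \<eta> i c q)" by (rule sum.cong) auto
      finally show "\<omega> c q = (\<Sum>i<m - 1. restrict a {..<m - 1} i * \<eta> i c q)" .
    qed
    fix b assume b: "b \<in> extensional {..<m - 1} \<and>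
      (\<forall>c\<in>atlas curve_surface. \<forall>q\<in>fst c. \<omega> c q = (\<Sum>i<m - 1. b i * \<eta> i c q))"
    have zero: "(\<Sum>i\<le>m - 2. (a i - b i) * z ^ i) = 0" for z
    proof -
      define q where "q = (z, sheet z)"
      have q: "q \<in> affine_part" unfolding q_def by (rule sheet_affine)
      then obtain c where c: "c \<in> curve_charts" "q \<in> fst c"
        using Union_curve_charts affine_subset by blast
      have "(\<Sum>i<m - 1. a i * \<eta> i c q) = (\<Sum>i<m - 1. b i * \<eta> i c q)" using rep[OF c] b c by simp
      then have "(\<Sum>i<m - 1. (a i - b i) * (fst q ^ i * \<eta> 0 c q)) = 0"
        by (simp only: \<eta>_affine[OF q, symmetric] left_diff_distrib sum_subtractf diff_self)
      then have "(\<Sum>i<m - 1. (a i - b i) * (z ^ i * \<eta> 0 c q)) = 0" by (simp add: q_def)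
      then have "(\<Sum>i<m - 1. (a i - b i) * z ^ i) * \<eta> 0 c q = 0" by (simp add: sum_distrib_right mult.assoc)
      moreover have "{..m - 2} = {..<m - 1}" using m by auto
      ultimately show ?thesis using \<eta>_0_nonzero[OF c q] by simp
    qed
    have "a i = b i" if "i < m - 1" for i
    proof -
      have "\<forall>k\<le>m - 2. a k - b k = 0" using zero polyfun_eq_0[of "\<lambda>i. a i - b i" "m - 2"] by blast
      moreover have "i \<le> m - 2" using that by simp
      ultimately show ?thesis by simp
    qed
    then show "b = restrict a {..<m - 1}"
      using b by (intro extensionalityI[of _ "{..<m - 1}"]) auto
  qed
qed

end

section \<open>The maximal map on the hyperelliptic curve\<close>

locale enneper_curve = hyperelliptic +
  fixes N :: nat
  assumes N: "0 < N"
begin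

definition poles :: "surface_point set" where
  "poles = {q \<in> affine_part. fst q ^ N = of_real (1/2)}"

text \<open>The value at infinity continues \<open>1 / (4 z\<^sup>N - 2)\<close>. Every solution of \<open>z\<^sup>N = 1/2\<close> has modulus less than 1, while the
  branch points have modulus 1, so all poles are simple and there are two over each solution. At a pole, division by 0
  assigns the value 0, but the poles are removed from the surface.\<close>

definition gauss_map :: "surface_point \<Rightarrow> complex" where
  "gauss_map q = (if q \<in> affine_part then 1 / (4 * fst q ^ N - 2) else 0)"

definition punctured_curve :: "surface_point surface" where
  "punctured_curve = puncture curve_surface poles"

lemma norm_less_1_root:
  assumes "z ^ N = of_real x" "0 < x" "x < 1" shows "norm (z::complex) < 1"
proof (rule ccontr)
  assume "\<not> norm z < 1"
  then have "1 \<le> norm z ^ N" by (intro one_le_power) simp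
  also have "norm z ^ N = x" using assms(1,2) by (simp flip: norm_power)
  finally show False using assms(3) by simp
qed

lemma Re_sheet_pos: "norm z < 1 \<Longrightarrow> 0 < Re (sheet z)"
proof -
  assume z: "norm z < 1"
  have "norm (z ^ n) < 1" unfolding norm_power using z m_nonzero by (simp add: power_less_one_iff)
  then have "- 1 < Re (z ^ n)" using abs_Re_le_cmod[of "z ^ n"] by linarith
  then have "0 < Re (1 + z ^ n)" by simp
  then have "1 + z ^ n \<notin> \<real>\<^sub>\<le>\<^sub>0" by (auto simp: complex_nonpos_Reals_iff)
  then show ?thesis unfolding sheet_def by (rule Re_csqrt_pos)
qed

lemma Re_snd_nonzero: "q \<in> affine_part \<Longrightarrow> norm (fst q) < 1 \<Longrightarrow> Re (snd q) \<noteq> 0"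
  using affine_sheet_cases[of q] Re_sheet_pos[of "fst q"] by (metis less_irrefl neg_equal_0_iff_equal snd_conv uminus_complex.sel(1))

lemma card_fiber:
  assumes x: "0 < x" "x < 1"
  shows "card {q \<in> affine_part. fst q ^ N = of_real x} = 2 * N"
proof -
  let ?R = "{z::complex. z ^ N = of_real x}"
  let ?f = "\<lambda>(z, s). (z, s * sheet z)"
  have nz: "sheet z \<noteq> 0" if "z \<in> ?R" for z
    using Re_sheet_pos[OF norm_less_1_root[OF _ x, of z]] that by auto
  have inj: "inj_on ?f (?R \<times> {1, -1})"
    using nz by (auto simp: inj_on_def)
  have img: "?f ` (?R \<times> {1, -1}) = {q \<in> affine_part. fst q ^ N = of_real x}"
  proof
    show "?f ` (?R \<times> {1, -1}) \<subseteq> {q \<in> affine_part. fst q ^ N = of_real x}"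
      using sheet_affine by auto
    show "{q \<in> affine_part. fst q ^ N = of_real x} \<subseteq> ?f ` (?R \<times> {1, -1})"
    proof
      fix q assume q: "q \<in> {q \<in> affine_part. fst q ^ N = of_real x}"
      then have or: "q = ?f (fst q, 1) \<or> q = ?f (fst q, -1)" using affine_sheet_cases[of q] by auto
      have R: "(fst q, 1) \<in> ?R \<times> {1, -1}" "(fst q, -1) \<in> ?R \<times> {1, -1}" using q by auto
      from or show "q \<in> ?f ` (?R \<times> {1, -1})"
      proof
        assume "q = ?f (fst q, 1)" then show ?thesis using R(1) by (rule image_eqI)
      next
        assume "q = ?f (fst q, -1)" then show ?thesis using R(2) by (rule image_eqI)
      qed
    qed
  qed
  have "card {q \<in> affine_part. fst q ^ N = of_real x} = card (?R \<times> {1, -1 :: complex})"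
    using card_image[OF inj] unfolding img .
  also have "\<dots> = N * 2" using x N by (simp add: card_cartesian_product card_nth_roots)
  finally show ?thesis by simp
qed

lemma card_poles: "card poles = 2 * N"
  unfolding poles_def by (rule card_fiber) auto

lemma finite_poles: "finite poles"
  using card_poles N by (metis card.infinite mult_eq_0_iff not_less_zero zero_neq_numeral)

lemma poles_subset: "poles \<subseteq> affine_part" by (auto simp: poles_def)

lemma pole_iff: "q \<in> affine_part \<Longrightarrow> q \<in> poles \<longleftrightarrow> 4 * fst q ^ N - 2 = 0"
  by (auto simp: poles_def field_simps)

lemma punctured_simps:
  "stop punctured_curve = subtopology curve_topology (curve - poles)"
  "points punctured_curve = curve - poles"
  by (auto simp: punctured_curve_def puncture_def)

lemma punctured_charts:
  assumes "c \<in> atlas punctured_curve"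
  shows "c \<in> curve_charts" "fst c \<inter> poles = {}"
proof -
  obtain c' where c': "c' \<in> curve_charts" "c = (fst c' - poles, snd c')"
    using assms by (auto simp: punctured_curve_def puncture_def)
  have "openin curve_topology (fst c' \<inter> (curve - poles))"
    using curve.openin_remove_finite[OF finite_poles] curve.openin_chart[of c'] c'(1) by auto
  moreover have "fst c' \<inter> (curve - poles) = fst c' - poles"
    using curve.chart_subset[of c'] c'(1) by auto
  ultimately show "c \<in> curve_charts" unfolding c'(2) by (intro curve_charts_restrict c'(1)) auto
  show "fst c \<inter> poles = {}" using c'(2) by auto
qed

lemma analytic_gauss_map:
  assumes c: "c \<in> curve_charts" "q \<in> fst c" and q: "q \<notin> poles"
  shows "(gauss_map \<circ> param c) analytic_on {snd c q}"
proof (cases "q \<in> affine_part")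
  case True
  have a: "(\<lambda>z. fst (param c z)) analytic_on {snd c q}" using analytic_fst[OF c True] by (simp add: o_def)
  have "4 * fst q ^ N - 2 \<noteq> 0" using pole_iff[OF True] q by simp
  then have "(\<lambda>z. 1 / (4 * fst (param c z) ^ N - 2)) analytic_on {snd c q}"
    by (intro analytic_intros a) (simp add: curve_chart_self_param[OF c])
  then show ?thesis
  proof (rule analytic_eventually_eq)
    show "\<forall>\<^sub>F z in nhds (snd c q). (gauss_map \<circ> param c) z = 1 / (4 * fst (param c z) ^ N - 2)"
      using eventually_curve_param[OF c openin_affine True] by eventually_elim (simp add: gauss_map_def)
  qed
next
  case False
  have qc: "q \<in> curve" using curve.chart_subset[of c] c by auto
  note inf = v_nonzero_infinity[OF qc False]
  have far: "q \<in> far_part" using inf by blast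
  have a: "(\<lambda>z. u_coord (param c z)) analytic_on {snd c q}" using analytic_u[OF c far] by (simp add: o_def)
  have "(\<lambda>z. u_coord (param c z) ^ N / (4 - 2 * u_coord (param c z) ^ N)) analytic_on {snd c q}"
    by (intro analytic_intros a) (use inf N in \<open>simp add: curve_chart_self_param[OF c] power_0_left\<close>)
  then show ?thesis
  proof (rule analytic_eventually_eq)
    have eq: "gauss_map y = u_coord y ^ N / (4 - 2 * u_coord y ^ N)" if y: "y \<in> far_part" for y
    proof (cases "y \<in> affine_part")
      case True
      then have nz: "fst y ^ N \<noteq> 0" using fst_nonzero_far y by simp
      have "u_coord y ^ N / (4 - 2 * u_coord y ^ N) = (1 / fst y ^ N) / ((4 * fst y ^ N - 2) / fst y ^ N)"
        using nz by (simp add: u_coord_affine[OF True] power_one_over diff_divide_distrib)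
      also have "\<dots> = 1 / (4 * fst y ^ N - 2)" using nz by simp
      finally show ?thesis using True by (simp add: gauss_map_def)
    next
      case False
      have "u_coord y = 0" using v_nonzero_infinity[of y] y far_subset False by blast
      then show ?thesis using False N by (simp add: gauss_map_def power_0_left)
    qed
    show "\<forall>\<^sub>F z in nhds (snd c q). (gauss_map \<circ> param c) z = u_coord (param c z) ^ N / (4 - 2 * u_coord (param c z) ^ N)"
      using eventually_curve_param[OF c openin_far far] by eventually_elim (simp add: eq)
  qed
qed

text \<open>The critical points lie over \<open>z = 0\<close>, over the branch points and at infinity, where \<open>|G| \<le> 1/2\<close>.\<close>

lemma gauss_map_critical:
  assumes c: "c \<in> curve_charts" "q \<in> fst c" and q: "q \<notin> poles" and crit: "differential gauss_map c q = 0"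
  shows "norm (gauss_map q) \<le> 1"
proof (cases "q \<in> affine_part")
  case False then show ?thesis by (simp add: gauss_map_def)
next
  case True
  note param_q = curve_chart_self_param[OF c]
  define d where "d = 4 * fst q ^ N - 2"
  have d: "d \<noteq> 0" using pole_iff[OF True] q by (simp add: d_def)
  have "((\<lambda>z. 1 / (4 * fst (param c z) ^ N - 2)) has_field_derivative
      - (4 * (of_nat N * fst q ^ (N - 1) * differential fst c q)) / (d * d)) (at (snd c q))"
    using has_derivative_coord[OF analytic_fst[OF c True]] d
    by (auto intro!: derivative_eq_intros simp: param_q d_def)
  moreover have "\<forall>\<^sub>F z in nhds (snd c q). gauss_map (param c z) = 1 / (4 * fst (param c z) ^ N - 2)"
    using eventually_curve_param[OF c openin_affine True] by eventually_elim (simp add: gauss_map_def)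
  ultimately have "((\<lambda>z. gauss_map (param c z)) has_field_derivative
      - (4 * (of_nat N * fst q ^ (N - 1) * differential fst c q)) / (d * d)) (at (snd c q))"
    by (subst DERIV_cong_ev[OF refl _ refl]) auto
  then have "- (4 * (of_nat N * fst q ^ (N - 1) * differential fst c q)) / (d * d) = 0"
    using has_derivative_coord[OF analytic_gauss_map[OF c q]] crit DERIV_unique by metis
  then have "fst q ^ (N - 1) = 0 \<or> differential fst c q = 0" using d N by simp
  then consider "fst q = 0" | "differential fst c q = 0" by auto
  then show ?thesis
  proof cases
    case 1
    then show ?thesis using True N by (simp add: gauss_map_def power_0_left)
  next
    case 2
    have "snd q = 0"
    proof (rule ccontr)
      assume "snd q \<noteq> 0"
      then have "\<eta> 0 c q = 0" using 2 True by (simp add: \<eta>_def)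
      then show False using \<eta>_0_nonzero[OF c True] by simp
    qed
    then have "fst q ^ n = - 1" using True by (simp add: affine_part_def add_eq_0_iff)
    then have "norm (fst q) ^ n = 1" by (metis norm_minus_cancel norm_one norm_power)
    then have "norm (fst q) = 1" by (intro power_eq_imp_eq_base[of "norm (fst q)" n 1]) auto
    then have "2 \<le> norm (4 * fst q ^ N - 2)"
      using norm_triangle_ineq2[of "4 * fst q ^ N" 2] by (simp add: norm_mult norm_power)
    then show ?thesis using True by (simp add: gauss_map_def norm_divide divide_le_eq)
  qed
qed

lemma openin_near_poles: "openin curve_topology {q \<in> affine_part. R * norm (4 * fst q ^ N - 2) < 1}"
proof -
  have "open {q::surface_point. R * norm (4 * fst q ^ N - 2) < 1}"
    by (intro open_Collect_less continuous_intros)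
  from openin_affine_preimage[OF this] show ?thesis by simp
qed

lemma norm_gauss_map_le_iff:
  assumes "q \<in> affine_part" "q \<notin> poles"
  shows "norm (gauss_map q) \<le> R \<longleftrightarrow> 1 \<le> R * norm (4 * fst q ^ N - 2)"
proof -
  have "0 < norm (4 * fst q ^ N - 2)" using assms pole_iff by simp
  then show ?thesis using assms by (simp add: gauss_map_def norm_divide divide_le_eq)
qed

text \<open>For \<open>R \<ge> 0\<close> the sublevel set is the complement, in the whole compact curve, of an open neighbourhood of the poles.\<close>

lemma compactin_sublevel: "compactin (stop punctured_curve) {q \<in> points punctured_curve. norm (gauss_map q) \<le> R}"
proof (cases "0 \<le> R")
  case False
  then have "\<not> norm (gauss_map q) \<le> R" for q using norm_ge_zero[of "gauss_map q"] by linarith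
  then have empty: "{q \<in> points punctured_curve. norm (gauss_map q) \<le> R} = {}" by blast
  show ?thesis unfolding empty by simp
next
  case True
  let ?K = "{q \<in> points punctured_curve. norm (gauss_map q) \<le> R}"
  have "?K = curve - {q \<in> affine_part. R * norm (4 * fst q ^ N - 2) < 1}"
  proof (intro equalityI subsetI)
    fix q assume "q \<in> ?K"
    then have q: "q \<in> curve" "q \<notin> poles" "norm (gauss_map q) \<le> R" by (auto simp: punctured_simps)
    then show "q \<in> curve - {q \<in> affine_part. R * norm (4 * fst q ^ N - 2) < 1}"
      using norm_gauss_map_le_iff[of q R] by auto
  next
    fix q assume "q \<in> curve - {q \<in> affine_part. R * norm (4 * fst q ^ N - 2) < 1}"
    then have q: "q \<in> curve" "q \<in> affine_part \<Longrightarrow> 1 \<le> R * norm (4 * fst q ^ N - 2)" by auto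
    have np: "q \<notin> poles"
    proof
      assume "q \<in> poles"
      then have "q \<in> affine_part" "4 * fst q ^ N - 2 = 0" using poles_subset pole_iff by blast+
      then have "R * norm (4 * fst q ^ N - 2) = 0" by (simp only: norm_zero mult_zero_right)
      then show False using q(2)[OF \<open>q \<in> affine_part\<close>] by linarith
    qed
    have "norm (gauss_map q) \<le> R"
    proof (cases "q \<in> affine_part")
      case True then show ?thesis using norm_gauss_map_le_iff[OF True np] q(2) by blast
    next
      case False then show ?thesis using \<open>0 \<le> R\<close> by (simp add: gauss_map_def)
    qed
    then show "q \<in> ?K" using q(1) np by (simp add: punctured_simps)
  qed
  then have "closedin curve_topology ?K"
    using closedin_diff[OF closedin_topspace openin_near_poles[of R]] by simp
  then have "compactin curve_topology ?K" by (rule closedin_compact_space[OF compact_curve])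
  then show ?thesis by (auto simp: punctured_simps compactin_subtopology)
qed

lemma pole_nearby:
  assumes "e \<in> poles"
  shows "\<exists>U. openin (stop curve_surface) U \<and> e \<in> U \<and> (\<forall>q\<in>U \<inter> points punctured_curve. R < norm (gauss_map q))"
proof (intro exI conjI ballI)
  show "openin (stop curve_surface) {q \<in> affine_part. R * norm (4 * fst q ^ N - 2) < 1}"
    using openin_near_poles by simp
  show "e \<in> {q \<in> affine_part. R * norm (4 * fst q ^ N - 2) < 1}"
  proof -
    have e: "e \<in> affine_part" using assms poles_subset by blast
    then have "4 * fst e ^ N - 2 = 0" using pole_iff assms by blast
    then have "R * norm (4 * fst e ^ N - 2) < 1" by (simp only: norm_zero mult_zero_right zero_less_one)
    then show ?thesis using e by blast
  qed
  fix q assume "q \<in> {q \<in> affine_part. R * norm (4 * fst q ^ N - 2) < 1} \<inter> points punctured_curve"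
  then have "q \<in> affine_part" "q \<notin> poles" "R * norm (4 * fst q ^ N - 2) < 1" by (auto simp: punctured_simps)
  then show "R < norm (gauss_map q)" using norm_gauss_map_le_iff[of q R] by linarith
qed

lemma enneper_data_punctured: "enneper_data punctured_curve gauss_map"
proof -
  interpret P: riemann_surface punctured_curve
    unfolding punctured_curve_def
    by unfold_locales (rule curve.connected_riemann_surface_puncture[OF finite_poles])
  show ?thesis
  proof
    show "holomorphic_function punctured_curve gauss_map"
      unfolding holomorphic_function_def
    proof
      fix c assume "c \<in> atlas punctured_curve"
      note c = punctured_charts[OF this]
      show "(gauss_map \<circ> param c) holomorphic_on chart_image c"
        by (rule analytic_on_chart_imp_holomorphic, rule analytic_gauss_map[OF c(1)]) (use c(2) in auto)
    qed
    have "{q \<in> points punctured_curve. gauss_map q = 0} \<subseteq> infinite_points"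
      using pole_iff by (auto simp: punctured_simps curve_def gauss_map_def split: if_splits)
    then show "finite {q \<in> points punctured_curve. gauss_map q = 0}"
      by (rule finite_subset) (simp add: infinite_points_def)
    have "(0, 1) \<in> affine_part" by (simp add: affine_part_def)
    moreover have "(0, 1) \<notin> poles" using N by (simp add: poles_def power_0_left)
    ultimately show "\<exists>q\<in>points punctured_curve. gauss_map q \<noteq> 0 \<and> norm (gauss_map q) \<noteq> 1"
      using affine_subset N by (intro bexI[of _ "(0, 1)"]) (auto simp: punctured_simps gauss_map_def power_0_left)
  qed
qed

text \<open>On \<open>|G| = 1\<close>, that is \<open>|z\<^sup>N - 1/2| = 1/4\<close>, the following functions are continuous and take finitely many
  values: the root of unity by which \<open>z\<close> differs from the principal root of \<open>z\<^sup>N\<close>, and the sheet.\<close>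

definition sector :: "surface_point \<Rightarrow> complex" where
  "sector q = fst q / exp (Ln (fst q ^ N) / of_nat N)"

definition sheet_sign :: "surface_point \<Rightarrow> real" where
  "sheet_sign q = Re (snd q) / \<bar>Re (snd q)\<bar>"

lemma singular_points:
  assumes "q \<in> singular_set punctured_curve gauss_map"
  shows "q \<in> affine_part" "0 < Re (fst q ^ N)" "norm (fst q) < 1"
proof -
  have q: "q \<in> curve" "q \<notin> poles" "norm (gauss_map q) = 1"
    using assms by (auto simp: singular_set_def punctured_simps)
  show aff: "q \<in> affine_part" using q(3) by (auto simp: gauss_map_def split: if_splits)
  have "norm (4 * fst q ^ N - 2) = 1" using q(3) aff by (simp add: gauss_map_def norm_divide)
  moreover have "4 * fst q ^ N - 2 = 4 * (fst q ^ N - 1/2)" by (simp add: algebra_simps)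
  ultimately have "norm (4::complex) * norm (fst q ^ N - 1/2) = 1" by (simp only: norm_mult)
  then have le: "norm (fst q ^ N - 1/2) = 1/4" by (simp only: norm_numeral)
  show "0 < Re (fst q ^ N)" 
  proof -
    have "\<bar>Re (fst q ^ N) - 1/2\<bar> \<le> 1/4" using abs_Re_le_cmod[of "fst q ^ N - 1/2"] unfolding le by simp
    then show ?thesis by linarith
  qed
  have "norm (fst q ^ N) \<le> norm (1/2 :: complex) + norm (fst q ^ N - 1/2)" by (rule norm_triangle_sub)
  then have "norm (fst q) ^ N < 1" using le by (simp add: norm_power norm_divide)
  then show "norm (fst q) < 1" by (metis not_less one_le_power)
qed

lemma continuous_on_invariants:
  defines "V \<equiv> {q::surface_point. 0 < Re (fst q ^ N) \<and> Re (snd q) \<noteq> 0}"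
  shows "continuous_on V sector" "continuous_on V sheet_sign"
proof -
  have pos: "fst q ^ N \<notin> \<real>\<^sub>\<le>\<^sub>0" if "q \<in> V" for q
    using that by (auto simp: V_def complex_nonpos_Reals_iff)
  have "continuous_on V (\<lambda>q. Ln (fst q ^ N))"
    by (rule continuous_on_Ln') (use pos in \<open>auto intro!: continuous_intros\<close>)
  then show "continuous_on V sector"
    unfolding sector_def[abs_def] using N
    by (intro continuous_on_divide continuous_on_exp continuous_on_fst continuous_on_id continuous_on_const) auto
  show "continuous_on V sheet_sign"
    unfolding sheet_sign_def[abs_def] by (intro continuous_intros) (auto simp: V_def)
qed

text \<open>One point with \<open>z\<^sup>N = 3/4\<close> is taken for each value of the two invariants. The invariants are locally constant, so
  these points lie in different components.\<close>

lemma singular_components_curve: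
  "\<exists>K \<subseteq> singular_components punctured_curve gauss_map. finite K \<and> 2 * N \<le> card K"
proof -
  let ?S = "singular_set punctured_curve gauss_map"
  define X where "X = subtopology (stop punctured_curve) ?S"
  define V where "V = {q::surface_point. 0 < Re (fst q ^ N) \<and> Re (snd q) \<noteq> 0}"
  have S_sub: "?S \<subseteq> curve - poles" by (auto simp: singular_set_def punctured_simps)
  have X: "X = subtopology curve_topology ?S" "topspace X = ?S"
    using S_sub by (auto simp: X_def punctured_simps subtopology_subtopology Int_absorb1)
  have S_aff: "?S \<subseteq> affine_part" using singular_points(1) by blast
  have S_V: "?S \<subseteq> V"
  proof
    fix q assume "q \<in> ?S"
    note q = singular_points[OF this]
    show "q \<in> V" using q(2) Re_snd_nonzero[OF q(1,3)] by (simp add: V_def)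
  qed
  have ident: "continuous_map X (top_of_set V) (\<lambda>q. q)"
    using continuous_map_from_subtopology_mono[OF continuous_map_affine_coords S_aff] S_V X
    by (auto simp: continuous_map_in_subtopology)
  have sector: "continuous_map X euclidean sector" and sign: "continuous_map X euclidean sheet_sign"
    using continuous_map_compose[OF ident, of euclidean sector] continuous_map_compose[OF ident, of euclidean sheet_sign]
      continuous_on_invariants by (simp_all add: V_def o_def)
  have sector_root: "sector q ^ N = 1" if "q \<in> ?S" for q
  proof -
    have nz: "fst q ^ N \<noteq> 0" using singular_points(2)[OF that] by (metis less_irrefl zero_complex.sel(1))
    have "exp (Ln (fst q ^ N) / of_nat N) ^ N = exp (of_nat N * (Ln (fst q ^ N) / of_nat N))"
      by (rule exp_of_nat_mult[symmetric])
    also have "\<dots> = fst q ^ N" using N nz by simp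
    finally show ?thesis using nz by (simp add: sector_def power_divide)
  qed
  have sign_values: "sheet_sign q \<in> {1, -1}" if "q \<in> ?S" for q
    using Re_snd_nonzero singular_points[OF that] by (auto simp: sheet_sign_def abs_if)
  have const: "f q = f q'"
    if comp: "connected_component_of X q q'" and f: "continuous_map X euclidean f" "finite (f ` ?S)"
    for q q' and f :: "surface_point \<Rightarrow> 'b::metric_space"
  proof -
    obtain C where C: "connectedin X C" "q \<in> C" "q' \<in> C" using comp by (auto simp: connected_component_of_def)
    have "connectedin euclidean (f ` C)" by (rule connectedin_continuous_map_image[OF f(1) C(1)])
    then have "connected (f ` C)" by simp
    moreover have "C \<subseteq> ?S" using connectedin_subset_topspace[OF C(1)] X(2) by simp
    then have "finite (f ` C)" using f(2) by (meson finite_subset image_mono)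
    ultimately have "f ` C = {} \<or> (\<exists>a. f ` C = {a})" by (simp add: connected_finite_iff_sing)
    then show ?thesis using C(2,3) by (metis empty_iff imageI singletonD)
  qed
  have fin_sector: "finite (sector ` ?S)"
  proof -
    have "finite {z::complex. z ^ N = 1}" using N by (intro finite_roots_unity) simp
    moreover have "sector ` ?S \<subseteq> {z. z ^ N = 1}" using sector_root by auto
    ultimately show ?thesis by (rule finite_subset[rotated])
  qed
  have fin_sign: "finite (sheet_sign ` ?S)"
    by (rule finite_subset[of _ "{1, -1}"]) (use sign_values in auto)
  define Q where "Q = {q \<in> affine_part. fst q ^ N = of_real (3/4)}"
  have card_Q: "card Q = 2 * N" unfolding Q_def by (rule card_fiber) auto
  have Q_S: "Q \<subseteq> ?S"
  proof
    fix q assume "q \<in> Q"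
    then have q: "q \<in> affine_part" "fst q ^ N = 3/4" by (auto simp: Q_def)
    have d: "4 * fst q ^ N - 2 = 1" unfolding q(2) by simp
    then have "q \<notin> poles" using pole_iff[OF q(1)] by simp
    then show "q \<in> ?S" using q(1) affine_subset d by (auto simp: singular_set_def punctured_simps gauss_map_def)
  qed
  have "inj_on (connected_component_of_set X) Q"
  proof (rule inj_onI)
    fix q q' assume q: "q \<in> Q" "q' \<in> Q" and eq: "connected_component_of_set X q = connected_component_of_set X q'"
    have "q' \<in> topspace X" unfolding X(2) using q(2) Q_S by blast
    then have "connected_component_of X q' q'" by (simp add: connected_component_of_refl)
    then have comp: "connected_component_of X q q'" using eq by blast
    have "sector q = sector q'" by (rule const[OF comp sector fin_sector])
    moreover have "fst q ^ N = fst q' ^ N" using q by (simp only: Q_def mem_Collect_eq)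
    ultimately have fst_eq: "fst q = fst q'" by (simp add: sector_def)
    have sgn: "sheet_sign q = sheet_sign q'" by (rule const[OF comp sign fin_sign])
    have "(snd q)\<^sup>2 = (snd q')\<^sup>2" using q fst_eq by (simp add: Q_def affine_part_def)
    then have "snd q = snd q' \<or> snd q = - snd q'" by (simp only: power2_eq_iff)
    moreover have "snd q \<noteq> - snd q'"
    proof
      assume "snd q = - snd q'"
      then have "sheet_sign q = - sheet_sign q'" by (simp add: sheet_sign_def)
      then show False using sgn sign_values[of q'] q(2) Q_S by auto
    qed
    ultimately show "q = q'" using fst_eq by (simp add: prod_eq_iff)
  qed
  then have "card (connected_component_of_set X ` Q) = 2 * N" using card_Q by (simp add: card_image)
  moreover have "connected_component_of_set X ` Q \<subseteq> singular_components punctured_curve gauss_map"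
    unfolding singular_components_def connected_components_of_def X_def[symmetric] using Q_S X(2) by auto
  moreover have "finite (connected_component_of_set X ` Q)"
    using card_Q N by (intro finite_imageI) (metis card.infinite mult_eq_0_iff not_less_zero zero_neq_numeral)
  ultimately show ?thesis by (metis order_refl)
qed

end

theorem theorem3p1:
  fixes p N :: nat
  assumes "p \<ge> 1" and "N > p + 2"
  shows "\<exists>(Mbar :: surface_point surface) E G \<Omega> X.
     connected_riemann_surface Mbar \<and> compact_space (stop Mbar) \<and> has_genus Mbar p \<and>
     E \<subseteq> points Mbar \<and> card E = 2 * N \<and>
     weierstrass_data (puncture Mbar E) G \<Omega> \<and>
     is_maximal_map (puncture Mbar E) G \<Omega> X \<and>
     complete_maximal_map (puncture Mbar E) G \<Omega> X \<and>
     (\<forall>e\<in>E. complete_end Mbar E G \<Omega> e) \<and>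
     (\<exists>K \<subseteq> singular_components (puncture Mbar E) G. finite K \<and> card K \<ge> 2 * N)"
proof -
  interpret H: enneper_curve "p + 1" N
    by unfold_locales (use assms in auto)
  interpret W: enneper_data H.punctured_curve H.gauss_map
    by (rule H.enneper_data_punctured)
  obtain z0 where z0: "z0 \<in> points H.punctured_curve"
    using W.nonconstant by blast
  have \<eta>: "holomorphic_form H.punctured_curve (H.\<eta> i)" if "i \<le> p - 1" for i
  proof -
    have "holomorphic_form H.curve_surface (H.\<eta> i)" by (rule H.holomorphic_form_\<eta>) (use that in simp)
    then show ?thesis using H.punctured_charts(1) unfolding holomorphic_form_def H.curve_surface_simps by blast
  qed
  have complete: "complete_maximal_map H.punctured_curve H.gauss_map W.\<Omega>
      (\<lambda>q. enneper (H.gauss_map q) - enneper (H.gauss_map z0))"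
  proof (rule W.complete_maximal_map[OF z0 H.compactin_sublevel \<eta> \<eta>])
    fix c q assume "c \<in> atlas H.punctured_curve" and q: "q \<in> fst c"
    note c = H.punctured_charts[OF this(1)]
    show "H.\<eta> 0 c q \<noteq> 0 \<or> H.\<eta> (p - 1) c q \<noteq> 0"
      using H.\<eta>_0_nonzero[OF c(1) q] H.\<eta>_last_nonzero[OF c(1) q] by auto
    show "norm (H.gauss_map q) \<le> 1" if "differential H.gauss_map c q = 0"
      using H.gauss_map_critical[OF c(1) q _ that] c(2) q by blast
  qed auto
  have ends: "\<forall>e\<in>H.poles. complete_end H.curve_surface H.poles H.gauss_map W.\<Omega> e"
    using W.complete_end[OF H.punctured_curve_def _ H.pole_nearby] by blast
  show ?thesis
  proof (rule exI, rule exI, rule exI, rule exI, rule exI, intro conjI)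
    show "connected_riemann_surface H.curve_surface" by (rule H.connected_riemann_surface_curve)
    show "compact_space (stop H.curve_surface)" unfolding H.curve_surface_simps by (rule H.compact_curve)
    show "has_genus H.curve_surface p" using H.has_genus_curve by simp
    show "H.poles \<subseteq> points H.curve_surface"
      unfolding H.curve_surface_simps H.topspace_curve using H.poles_subset H.affine_subset by blast
    show "card H.poles = 2 * N" by (rule H.card_poles)
    show "weierstrass_data (puncture H.curve_surface H.poles) H.gauss_map W.\<Omega>"
      using W.weierstrass_data unfolding H.punctured_curve_def .
    show "is_maximal_map (puncture H.curve_surface H.poles) H.gauss_map W.\<Omega>
        (\<lambda>q. enneper (H.gauss_map q) - enneper (H.gauss_map z0))"
      using W.is_maximal_map[OF z0] unfolding H.punctured_curve_def .
    show "complete_maximal_map (puncture H.curve_surface H.poles) H.gauss_map W.\<Omega>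
        (\<lambda>q. enneper (H.gauss_map q) - enneper (H.gauss_map z0))"
      using complete unfolding H.punctured_curve_def .
    show "\<forall>e\<in>H.poles. complete_end H.curve_surface H.poles H.gauss_map W.\<Omega> e" by (rule ends)
    show "\<exists>K\<subseteq>singular_components (puncture H.curve_surface H.poles) H.gauss_map. finite K \<and> 2 * N \<le> card K"
      using H.singular_components_curve unfolding H.punctured_curve_def .
  qed
qed

end
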